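(* Let $n\ge1$, $\alpha\in(0,1)$, and let $p\in\left[1,\frac{n}{n-\alpha}\right)$ and $q\in\left(\frac{n}{\alpha},+\infty\right]$ be such that $\frac1p+\frac1q=1$. Let $\eta\in B^\alpha_{q,1}(\mathbb{R}^n)$ have compact support and set $\eta_R(x)=\eta\left(\frac{x}{R}\right)$ for $x\in\mathbb{R}^n$ and $R>0$. If $f\in BV^{\alpha,p}(\mathbb{R}^n)\cap L^\infty(\mathbb{R}^n)$, then $$\frac{\mu_{1,\alpha}}{\alpha}\lim_{R\to+\infty}\int_{\mathbb{R}^n}\eta_R(x)\,\frac{f(x)\,\nu}{|(x-x_0)\cdot\nu|^\alpha}\,dx=-\eta(0)\,D^\alpha f(H_\nu^+(x_0))$$ for every $\nu\in\mathbb{S}^{n-1}$ and $x_0\in\mathbb{R}^n$. In particular, if either $\operatorname{supp} f$ is bounded or $f$ has constant sign, then $$\frac{\mu_{1,\alpha}}{\alpha}\int_{\mathbb{R}^n}\frac{f(x)\,\nu}{|(x-x_0)\cdot\nu|^\alpha}\,dx=-D^\alpha f(H_\nu^+(x_0))$$ for every $\nu\in\mathbb{S}^{n-1}$ and $x_0\in\mathbb{R}^n$.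
   Context: Let $\mu_{n,\alpha}=2^{\alpha}\pi^{-n/2}\,\Gamma\left(\frac{n+\alpha+1}{2}\right)/\Gamma\left(\frac{1-\alpha}{2}\right)$. For $\varphi\in \mathrm{Lip}_c(\mathbb{R}^n;\mathbb{R}^n)$ (compactly supported Lipschitz), the fractional $\alpha$-divergence is $$\mathrm{div}^\alpha\varphi(x)=\mu_{n,\alpha}\int_{\mathbb{R}^n}\frac{(y-x)\cdot(\varphi(y)-\varphi(x))}{|y-x|^{n+\alpha+1}}\,dy,\quad x\in\mathbb{R}^n.$$ For $p\in[1,+\infty]$ and $f\in L^p(\mathbb{R}^n)$ let $$|D^\alpha f|(\mathbb{R}^n)=\sup\left\{\int_{\mathbb{R}^n} f\,\mathrm{div}^\alpha\varphi\,dx:\varphi\in C^\infty_c(\mathbb{R}^n;\mathbb{R}^n),\ \|\varphi\|_{L^\infty(\mathbb{R}^n;\mathbb{R}^n)}\le1\right\},$$ and $BV^{\alpha,p}(\mathbb{R}^n)=\{f\in L^p(\mathbb{R}^n):|D^\alpha f|(\mathbb{R}^n)<+\infty\}$. A function $f\in L^p(\mathbb{R}^n)$ belongs to $BV^{\alpha,p}(\mathbb{R}^n)$ if and only if there is a (unique) finite $\mathbb{R}^n$-valued Radon measure $D^\alpha f$ on $\mathbb{R}^n$ with $\int_{\mathbb{R}^n} f\,\mathrm{div}^\alpha\varphi\,dx=-\int_{\mathbb{R}^n}\varphi\cdot dD^\alpha f$ for all $\varphi\in \mathrm{Lip}_c(\mathbb{R}^n;\mathbb{R}^n)$. For $\nu\in\mathbb{S}^{n-1}$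 and $x_0\in\mathbb{R}^n$, $H_\nu^+(x_0)=\{y\in\mathbb{R}^n:(y-x_0)\cdot\nu>0\}$. The Besov space $B^\alpha_{q,1}(\mathbb{R}^n)$ is the set of $u\in L^q(\mathbb{R}^n)$ with $[u]_{B^\alpha_{q,1}(\mathbb{R}^n)}=\int_{\mathbb{R}^n}\frac{\|u(\cdot+h)-u\|_{L^q(\mathbb{R}^n)}}{|h|^{n+\alpha}}\,dh<+\infty$; since $q>n/\alpha$, its elements have a bounded continuous representative, which is the one used to define $\eta(0)$. *)

theory Defs
  imports "HOL-Analysis.Analysis" "HOL-Probability.Essential_Supremum"
begin

text \<open>
  \<open>L\<^sup>p\<close> norm for an exponent \<open>p \<in> [1, \<infinity>]\<close>, with value \<open>\<infinity>\<close> when the function is not \<open>p\<close>-integrable.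
\<close>

definition Lp_norm :: "ennreal \<Rightarrow> (real^'n \<Rightarrow> 'b::real_normed_vector) \<Rightarrow> ennreal" where
  "Lp_norm p f =
     (if p = \<infinity> then esssup lebesgue (\<lambda>x. ennreal (norm (f x)))
      else let I = (\<integral>\<^sup>+x. ennreal (norm (f x) powr enn2real p) \<partial>lebesgue)
           in if I = \<infinity> then \<infinity> else ennreal (enn2real I powr (1 / enn2real p)))"

definition Lp_space :: "ennreal \<Rightarrow> (real^'n \<Rightarrow> real) set" where
  "Lp_space p = {f \<in> borel_measurable lebesgue. Lp_norm p f < \<infinity>}"

definition besov_seminorm :: "real \<Rightarrow> ennreal \<Rightarrow> (real^'n \<Rightarrow> real) \<Rightarrow> ennreal" where
  "besov_seminorm \<alpha> q u =
     (\<integral>\<^sup>+h. Lp_norm q (\<lambda>x. u (x + h) - u x) / ennreal (norm h powr (real CARD('n) + \<alpha>)) \<partial>lebesgue)"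

definition besov_space :: "real \<Rightarrow> ennreal \<Rightarrow> (real^'n \<Rightarrow> real) set" where
  "besov_space \<alpha> q = {u \<in> Lp_space q. besov_seminorm \<alpha> q u < \<infinity>}"

text \<open>
  Elements of the above spaces are only determined up to null sets, so their support is the
  essential one: the complement of the largest open set on which the function vanishes a.e.
\<close>

definition ess_support :: "(real^'n \<Rightarrow> real) \<Rightarrow> (real^'n) set" where
  "ess_support f = - \<Union>{U. open U \<and> (AE x in lebesgue. x \<in> U \<longrightarrow> f x = 0)}"

definition continuous_representative :: "(real^'n \<Rightarrow> real) \<Rightarrow> (real^'n \<Rightarrow> real) \<Rightarrow> bool" where
  "continuous_representative u v \<longleftrightarrow> continuous_on UNIV v \<and> (AE x in lebesgue. u x = v x)"

primrec Ck :: "nat \<Rightarrow> (real^'n \<Rightarrow> real^'n) \<Rightarrow> bool" where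
  "Ck 0 \<phi> \<longleftrightarrow> continuous_on UNIV \<phi>"
| "Ck (Suc k) \<phi> \<longleftrightarrow>
     \<phi> differentiable_on UNIV \<and> (\<forall>i. Ck k (\<lambda>x. frechet_derivative \<phi> (at x) (axis i 1)))"

definition compactly_supported :: "(real^'n \<Rightarrow> real^'n) \<Rightarrow> bool" where
  "compactly_supported \<phi> \<longleftrightarrow> compact (closure {x. \<phi> x \<noteq> 0})"

definition smooth_c :: "(real^'n \<Rightarrow> real^'n) set" where
  "smooth_c = {\<phi>. (\<forall>k. Ck k \<phi>) \<and> compactly_supported \<phi>}"

definition lip_c :: "(real^'n \<Rightarrow> real^'n) set" where
  "lip_c = {\<phi>. (\<exists>L. L-lipschitz_on UNIV \<phi>) \<and> compactly_supported \<phi>}"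

text \<open>
  A finite \<open>\<real>\<^sup>n\<close>-valued Radon measure is a countably additive \<open>\<real>\<^sup>n\<close>-valued set function on the Borel
  sets: countable additivity forces finite total variation, and finite Borel measures on \<open>\<real>\<^sup>n\<close> are
  automatically inner and outer regular. Values on non-Borel sets are irrelevant.
\<close>

definition vector_radon_measure :: "((real^'n) set \<Rightarrow> real^'n) \<Rightarrow> bool" where
  "vector_radon_measure D \<longleftrightarrow>
     D {} = 0 \<and>
     (\<forall>A :: nat \<Rightarrow> (real^'n) set. range A \<subseteq> sets borel \<longrightarrow> disjoint_family A \<longrightarrow>
        (\<lambda>k. D (A k)) sums D (\<Union>k. A k))"

text \<open>
  Positive part \<open>m\<^sup>+(A) = sup {m(B) : B \<subseteq> A Borel}\<close> in the Jordan decomposition of a finite signed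
  Borel measure; the negative part is the positive part of \<open>-m\<close>. The supremum is never negative
  because \<open>B = {}\<close> is allowed, so the truncation done by \<^const>\<open>ennreal\<close> has no effect.
\<close>

definition jordan_pos :: "((real^'n) set \<Rightarrow> real) \<Rightarrow> (real^'n) measure" where
  "jordan_pos m = measure_of UNIV (sets borel) (\<lambda>A. SUP B\<in>{B \<in> sets borel. B \<subseteq> A}. ennreal (m B))"

definition signed_integral :: "((real^'n) set \<Rightarrow> real) \<Rightarrow> (real^'n \<Rightarrow> real) \<Rightarrow> real" where
  "signed_integral m g = (LINT x|jordan_pos m. g x) - (LINT x|jordan_pos (\<lambda>B. - m B). g x)"

definition vector_integral :: "((real^'n) set \<Rightarrow> real^'n) \<Rightarrow> (real^'n \<Rightarrow> real^'n) \<Rightarrow> real" where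
  "vector_integral D \<phi> = (\<Sum>i\<in>UNIV. signed_integral (\<lambda>B. D B $ i) (\<lambda>x. \<phi> x $ i))"

definition frac_mu :: "nat \<Rightarrow> real \<Rightarrow> real" where
  "frac_mu n \<alpha> = 2 powr \<alpha> * pi powr (- real n / 2) * Gamma ((real n + \<alpha> + 1) / 2) / Gamma ((1 - \<alpha>) / 2)"

definition frac_div :: "real \<Rightarrow> (real^'n \<Rightarrow> real^'n) \<Rightarrow> real^'n \<Rightarrow> real" where
  "frac_div \<alpha> \<phi> x = frac_mu CARD('n) \<alpha> *
     (LINT y|lebesgue. ((y - x) \<bullet> (\<phi> y - \<phi> x)) / norm (y - x) powr (real CARD('n) + \<alpha> + 1))"

definition frac_variation :: "real \<Rightarrow> (real^'n \<Rightarrow> real) \<Rightarrow> ereal" where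
  "frac_variation \<alpha> f =
     (SUP \<phi>\<in>{\<phi> \<in> smooth_c. Lp_norm \<infinity> \<phi> \<le> 1}. ereal (LINT x|lebesgue. f x * frac_div \<alpha> \<phi> x))"

definition frac_BV :: "real \<Rightarrow> ennreal \<Rightarrow> (real^'n \<Rightarrow> real) set" where
  "frac_BV \<alpha> p = {f \<in> Lp_space p. frac_variation \<alpha> f < \<infinity>}"

text \<open>
  The relation \<open>D = D\<^sup>\<alpha> f\<close>. For \<open>f\<close> in \<open>BV\<^bsup>\<alpha>,p\<^esup>\<close> exactly one vector measure on the
  Borel sets satisfies it.
\<close>

definition has_frac_variation_measure ::
    "real \<Rightarrow> (real^'n \<Rightarrow> real) \<Rightarrow> ((real^'n) set \<Rightarrow> real^'n) \<Rightarrow> bool" where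
  "has_frac_variation_measure \<alpha> f D \<longleftrightarrow>
     vector_radon_measure D \<and>
     (\<forall>\<phi>\<in>lip_c. (LINT x|lebesgue. f x * frac_div \<alpha> \<phi> x) = - vector_integral D \<phi>)"

definition half_space :: "real^'n \<Rightarrow> real^'n \<Rightarrow> (real^'n) set" where
  "half_space \<nu> x0 = {y. (y - x0) \<bullet> \<nu> > 0}"

end

theory Submission
  imports Defs "HOL-Probability.Distributions"
begin

text \<open>
  Take \<open>\<phi> = v g e\<close> as a test field, where \<open>v\<close> mollifies \<open>\<eta>\<^sub>R\<close>, \<open>g\<close> is a Lipschitz approximation of
  the indicator of the half-space \<open>H\<close>, and \<open>e\<close> is a coordinate vector. Splitting
  \<open>v(y) g(y) - v(x) g(x) = v(x) (g(y) - g(x)) + (v(y) - v(x)) g(y)\<close> in the definition of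
  \<open>div\<^sup>\<alpha> \<phi>\<close> gives a first term that converges to \<open>\<eta>\<^sub>R\<close> times the fractional gradient of \<open>H\<close>, which is
  \<open>\<mu>\<^sub>1 \<nu> / (\<alpha> |(x - x0) \<bullet> \<nu>|\<^sup>\<alpha>)\<close> by an explicit computation. The second term, tested against \<open>f\<close>, is at most
  \<open>\<mu>\<^sub>n \<parallel>f\<parallel>\<^sub>p [\<eta>\<^sub>R]\<close> by Tonelli and Holder, and the Besov seminorm \<open>[\<eta>\<^sub>R]\<close> scales like
  \<open>R\<close> to the power \<open>n / q - \<alpha> < 0\<close>. On the measure side
  \<open>\<integral> \<eta>\<^sub>R d(D\<^sup>\<alpha> f)\<close> over \<open>H\<close> tends to \<open>\<eta>(0) D\<^sup>\<alpha> f(H)\<close> by dominated convergence. The last claim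
  follows with a radially decreasing cutoff \<open>\<eta>\<close> and monotone convergence.
\<close>

section \<open>Change of variables for Lebesgue integrals\<close>

text \<open>The identity defining \<open>D\<close> is available for Lipschitz fields only, while a
  Besov function need not be Lipschitz and the indicator of \<open>H\<close> is not even continuous;
  hence two regularisations, run with one index \<open>k\<close>. Neither comes with a uniform
  Lipschitz bound, so all estimates must be blind to \<open>k\<close>. This dictates the splitting:
  in the remainder the increment falls on \<open>v\<close> and \<open>g\<close> enters only through
  |g| \<le> 1, so that the Besov seminorm controls it; in the other term the increments of
  \<open>g\<close> are controlled by the distance of \<open>x\<close> to the hyperplane. The
  resulting majorant |(x - x0) . \<nu>|^(-\<alpha>) is locally integrable because \<alpha> < 1, and
  boundedness of \<open>f\<close> and the compact supports make it usable. The remainder is never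
  passed to the limit in \<open>k\<close>: a bound suffices, because dilation multiplies it by a
  power of \<open>R\<close> whose exponent is negative when q > n / \<alpha>. Integrability of
  \<open>f\<close> against the weight without a cutoff is not known a priori, which is why the
  general claim is a limit.\<close>

lemma nn_integral_lborel_shift:
  fixes c :: "'a::euclidean_space"
  assumes [measurable]: "F \<in> borel_measurable borel"
  shows "(\<integral>\<^sup>+x. F (c + x) \<partial>lborel) = (\<integral>\<^sup>+x. F x \<partial>lborel)"
  by (subst (2) lborel_distr_plus[of c, symmetric]) (simp add: nn_integral_distr)

lemma nn_integral_lborel_scale:
  fixes F :: "'a::euclidean_space \<Rightarrow> ennreal"
  assumes [measurable]: "F \<in> borel_measurable borel" and R: "R > 0"
  shows "(\<integral>\<^sup>+x. F (x /\<^sub>R R) \<partial>lborel) = ennreal (R ^ DIM('a)) * (\<integral>\<^sup>+x. F x \<partial>lborel)"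
proof -
  have "(\<integral>\<^sup>+x. F (x /\<^sub>R R) \<partial>lborel)
      = (\<integral>\<^sup>+x. F (x /\<^sub>R R) \<partial>density (distr lborel borel (\<lambda>x::'a. 0 + R *\<^sub>R x)) (\<lambda>_. ennreal (\<bar>R\<bar> ^ DIM('a))))"
    using R by (subst lborel_affine[of R 0, symmetric]) auto
  also have "\<dots> = ennreal (R ^ DIM('a)) * (\<integral>\<^sup>+x. F x \<partial>lborel)"
    using R by (simp add: nn_integral_density nn_integral_distr nn_integral_cmult)
  finally show ?thesis .
qed

lemma integral_lborel_shift:
  fixes F :: "'a::euclidean_space \<Rightarrow> real"
  assumes [measurable]: "F \<in> borel_measurable borel"
  shows "(LINT x|lborel. F (c + x)) = (LINT x|lborel. F x)"
  by (subst (2) lborel_distr_plus[of c, symmetric]) (simp add: integral_distr)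

lemma borel_measurable_orthogonal:
  fixes T :: "'a::euclidean_space \<Rightarrow> 'a"
  shows "orthogonal_transformation T \<Longrightarrow> T \<in> borel_measurable borel"
  by (intro borel_measurable_continuous_onI linear_continuous_on)
    (simp add: linear_conv_bounded_linear[symmetric] orthogonal_transformation_linear)

text \<open>
  Fubini gives \<open>\<integral>f d\<lambda> \<integral>g d\<mu> = \<integral>f d\<mu> \<integral>g d\<lambda>\<close> for the translation invariant measures
  \<open>\<lambda>\<close> (Lebesgue) and \<open>\<mu>\<close> (its image under \<open>T\<close>); take for \<open>g\<close> the indicator of a ball,
  on which they agree.
\<close>

lemma nn_integral_lborel_orthogonal:
  fixes T :: "'a::euclidean_space \<Rightarrow> 'a"
  assumes T: "orthogonal_transformation T" and [measurable]: "F \<in> borel_measurable borel"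
  shows "(\<integral>\<^sup>+x. F (T x) \<partial>lborel) = (\<integral>\<^sup>+x. F x \<partial>lborel)"
proof -
  have [measurable]: "T \<in> borel_measurable borel" by (rule borel_measurable_orthogonal[OF T])
  have lin: "linear T" using T by (simp add: orthogonal_transformation_linear)
  define g :: "'a \<Rightarrow> ennreal" where "g = indicator (ball 0 1)"
  have [measurable]: "g \<in> borel_measurable borel" unfolding g_def by (intro borel_measurable_indicator) simp
  have g: "g (T x) = g x" "g (- x) = g x" for x
    using T by (auto simp: g_def indicator_def orthogonal_transformation_norm)
  define b where "b = (\<integral>\<^sup>+x. g x \<partial>lborel)"
  have "b = emeasure lborel (ball (0::'a) 1)" by (simp add: b_def g_def)
  then have b: "b \<noteq> 0" "b \<noteq> \<infinity>"
    using emeasure_bounded_finite[of "ball (0::'a) 1"] content_ball_pos[of 1 "0::'a"]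
    by (auto simp: measure_def)
  have refl: "(\<integral>\<^sup>+x. g (c - x) \<partial>lborel) = b" for c :: 'a
  proof -
    have "(\<integral>\<^sup>+x. g (c - x) \<partial>lborel) = (\<integral>\<^sup>+x. g (- c + x) \<partial>lborel)"
      by (intro nn_integral_cong) (metis g(2) minus_diff_eq uminus_add_conv_diff)
    then show ?thesis unfolding b_def using nn_integral_lborel_shift[of g "- c"] by simp
  qed
  \<comment> \<open>A preimage \<open>S c\<close> turns \<open>c + T y\<close> into
    \<open>T (S c + y)\<close>, so the image measure under \<open>T\<close> inherits translation
    invariance.\<close>
  obtain S where S: "\<And>x. T (S x) = x"
    using orthogonal_transformation_surj[OF T] by (metis surj_def)
  have shift: "(\<integral>\<^sup>+y. f (c + T y) \<partial>lborel) = (\<integral>\<^sup>+y. f (T y) \<partial>lborel)"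
    if [measurable]: "f \<in> borel_measurable borel" for f :: "'a \<Rightarrow> ennreal" and c
  proof -
    have "(\<integral>\<^sup>+y. f (c + T y) \<partial>lborel) = (\<integral>\<^sup>+y. f (T (S c + y)) \<partial>lborel)"
      by (simp add: linear_add[OF lin] S)
    also have "\<dots> = (\<integral>\<^sup>+y. f (T y) \<partial>lborel)"
      by (rule nn_integral_lborel_shift) measurable
    finally show ?thesis .
  qed
  have "(\<integral>\<^sup>+x. F x \<partial>lborel) * b = (\<integral>\<^sup>+y. g (T y) * (\<integral>\<^sup>+x. F x \<partial>lborel) \<partial>lborel)"
    unfolding b_def by (simp add: g nn_integral_multc mult.commute)
  also have "\<dots> = (\<integral>\<^sup>+y. g (T y) * (\<integral>\<^sup>+x. F (T y + x) \<partial>lborel) \<partial>lborel)"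
    by (simp add: nn_integral_lborel_shift)
  also have "\<dots> = (\<integral>\<^sup>+y. (\<integral>\<^sup>+x. g (T y) * F (T y + x) \<partial>lborel) \<partial>lborel)"
    by (simp add: nn_integral_cmult)
  also have "\<dots> = (\<integral>\<^sup>+x. (\<integral>\<^sup>+y. g (T y) * F (T y + x) \<partial>lborel) \<partial>lborel)"
    by (rule lborel_pair.Fubini') measurable
  also have "\<dots> = (\<integral>\<^sup>+x. (\<integral>\<^sup>+y. g (T y - x) * F (T y) \<partial>lborel) \<partial>lborel)"
  proof (rule nn_integral_cong)
    fix x
    show "(\<integral>\<^sup>+y. g (T y) * F (T y + x) \<partial>lborel) = (\<integral>\<^sup>+y. g (T y - x) * F (T y) \<partial>lborel)"
      using shift[of "\<lambda>z. g (z - x) * F z" x] by (simp add: add.commute)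
  qed
  also have "\<dots> = (\<integral>\<^sup>+y. (\<integral>\<^sup>+x. g (T y - x) * F (T y) \<partial>lborel) \<partial>lborel)"
    by (rule lborel_pair.Fubini') measurable
  also have "\<dots> = (\<integral>\<^sup>+y. F (T y) \<partial>lborel) * b"
    by (simp add: nn_integral_multc refl nn_integral_cmult mult.commute)
  finally show ?thesis using b by (metis ennreal_mult_cancel_left mult.commute infinity_ennreal_def)
qed

lemma distr_lborel_orthogonal:
  fixes T :: "'a::euclidean_space \<Rightarrow> 'a"
  assumes T: "orthogonal_transformation T"
  shows "distr lborel borel T = lborel"
proof (rule measure_eqI)
  fix A :: "'a set" assume "A \<in> sets (distr lborel borel T)"
  then have [measurable]: "A \<in> sets borel" by simp
  have [measurable]: "T \<in> borel_measurable borel" by (rule borel_measurable_orthogonal[OF T])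
  have "emeasure (distr lborel borel T) A = (\<integral>\<^sup>+x. indicator A (T x) \<partial>lborel)"
    by (subst nn_integral_distr[symmetric, of T lborel borel "indicator A"]) auto
  also have "\<dots> = emeasure lborel A" by (subst nn_integral_lborel_orthogonal[OF T]) auto
  finally show "emeasure (distr lborel borel T) A = emeasure lborel A" .
qed simp

lemma integral_lborel_orthogonal:
  fixes T :: "'a::euclidean_space \<Rightarrow> 'a" and F :: "'a \<Rightarrow> real"
  assumes T: "orthogonal_transformation T" and [measurable]: "F \<in> borel_measurable borel"
  shows "(LINT x|lborel. F (T x)) = (LINT x|lborel. F x)"
  using borel_measurable_orthogonal[OF T]
  by (subst (2) distr_lborel_orthogonal[OF T, symmetric]) (simp add: integral_distr)

section \<open>The fractional kernel\<close>

lemma nn_integral_exp_power2: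
  assumes "t > 0"
  shows "(\<integral>\<^sup>+x. ennreal (exp (- t * x\<^sup>2)) \<partial>lborel) = ennreal (sqrt (pi / t))"
proof -
  \<comment> \<open>With this standard deviation the integrand is a multiple of a normal density,
    whose mass is 1.\<close>
  define \<sigma> where "\<sigma> = sqrt (1 / (2 * t))"
  have \<sigma>: "\<sigma> > 0" "2 * \<sigma>\<^sup>2 = 1 / t" using assms by (auto simp: \<sigma>_def)
  have eq: "exp (- t * x\<^sup>2) = sqrt (pi / t) * normal_density 0 \<sigma> x" for x
  proof -
    have "2 * pi * \<sigma>\<^sup>2 = pi * (2 * \<sigma>\<^sup>2)" by simp
    also have "\<dots> = pi / t" unfolding \<sigma>(2) by simp
    finally have "2 * pi * \<sigma>\<^sup>2 = pi / t" .
    moreover have "- (x - 0)\<^sup>2 / (2 * \<sigma>\<^sup>2) = - t * x\<^sup>2" unfolding \<sigma>(2) by simp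
    ultimately show ?thesis using assms by (simp add: normal_density_def)
  qed
  have "(\<integral>\<^sup>+x. ennreal (normal_density 0 \<sigma> x) \<partial>lborel) = 1"
    using \<sigma> by (subst nn_integral_eq_integral) auto
  then show ?thesis
    unfolding eq using assms by (simp add: ennreal_mult nn_integral_cmult)
qed

text \<open>A rotation carries a coordinate vector to \<nu>; the Gaussian then factors over the
  coordinates, and each of the n - 1 remaining directions contributes
  \<open>sqrt (pi / t)\<close>.\<close>

lemma nn_integral_exp_norm:
  fixes \<nu> :: "real^'n" and F :: "real \<Rightarrow> ennreal"
  assumes [measurable]: "F \<in> borel_measurable borel" and \<nu>: "norm \<nu> = 1" and t: "t > 0"
  shows "(\<integral>\<^sup>+h. F (h \<bullet> \<nu>) * ennreal (exp (- t * (norm h)\<^sup>2)) \<partial>lborel)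
    = ennreal ((pi / t) powr ((real CARD('n) - 1) / 2)) * (\<integral>\<^sup>+u. F u * ennreal (exp (- t * u\<^sup>2)) \<partial>lborel)"
proof -
  define b0 :: "real^'n" where "b0 = axis undefined 1"
  have b0: "b0 \<in> Basis" by (auto simp: b0_def Basis_vec_def)
  obtain T where T: "orthogonal_transformation T" "T b0 = \<nu>"
    using orthogonal_transformation_exists[of b0 \<nu>] \<nu> b0 by auto
  have inn: "T h \<bullet> \<nu> = h \<bullet> b0" "norm (T h) = norm h" for h
    using T by (auto simp: orthogonal_transformation_def orthogonal_transformation_norm)
  \<comment> \<open>One family of factors for the product formula: \<open>F\<close> sits on the
    distinguished coordinate, all others are plain Gaussians.\<close>
  define g :: "real^'n \<Rightarrow> real \<Rightarrow> ennreal"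
    where "g b u = (if b = b0 then F u else 1) * ennreal (exp (- t * u\<^sup>2))" for b u
  have "(\<integral>\<^sup>+h. F (h \<bullet> \<nu>) * ennreal (exp (- t * (norm h)\<^sup>2)) \<partial>lborel)
      = (\<integral>\<^sup>+h. F (h \<bullet> b0) * ennreal (exp (- t * (norm h)\<^sup>2)) \<partial>lborel)"
    by (subst nn_integral_lborel_orthogonal[OF T(1), symmetric]) (simp_all add: inn)
  also have "\<dots> = (\<integral>\<^sup>+h. (\<Prod>b\<in>Basis. g b (h \<bullet> b)) \<partial>lborel)"
  proof (rule nn_integral_cong)
    fix h :: "real^'n"
    have "(norm h)\<^sup>2 = (\<Sum>b\<in>Basis. (h \<bullet> b)\<^sup>2)"
      unfolding power2_norm_eq_inner by (subst euclidean_inner) (simp add: power2_eq_square)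
    then have "exp (- t * (norm h)\<^sup>2) = (\<Prod>b\<in>Basis. exp (- t * (h \<bullet> b)\<^sup>2))"
      by (simp add: exp_sum[symmetric] sum_distrib_left sum_negf)
    moreover have "(\<Prod>b\<in>Basis. (if b = b0 then F (h \<bullet> b) else 1)) = F (h \<bullet> b0)"
      using b0 by (simp add: prod.If_cases Int_absorb1)
    ultimately show "F (h \<bullet> b0) * ennreal (exp (- t * (norm h)\<^sup>2)) = (\<Prod>b\<in>Basis. g b (h \<bullet> b))"
      by (simp add: g_def prod.distrib prod_ennreal)
  qed
  also have "\<dots> = (\<Prod>b\<in>Basis. (\<integral>\<^sup>+u. g b u \<partial>lborel))"
    by (rule nn_integral_lborel_prod) (auto simp: g_def)
  also have "\<dots> = (\<integral>\<^sup>+u. g b0 u \<partial>lborel) * (\<Prod>b\<in>Basis - {b0}. (\<integral>\<^sup>+u. g b u \<partial>lborel))"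
    using b0 by (simp add: prod.remove)
  also have "(\<Prod>b\<in>Basis - {b0}. (\<integral>\<^sup>+u. g b u \<partial>lborel)) = (\<Prod>b\<in>Basis - {b0}. ennreal (sqrt (pi / t)))"
    using nn_integral_exp_power2[OF t] by (intro prod.cong) (auto simp: g_def)
  also have "\<dots> = ennreal (sqrt (pi / t) ^ (CARD('n) - 1))"
    using b0 t by (simp add: ennreal_power)
  also have "sqrt (pi / t) ^ (CARD('n) - 1) = (pi / t) powr ((real CARD('n) - 1) / 2)"
    using t by (simp add: powr_half_sqrt[symmetric] powr_realpow[symmetric] powr_powr of_nat_diff field_simps)
  finally show ?thesis by (simp add: g_def mult.commute)
qed

text \<open>Euler's integral after replacing \<open>t\<close> by \<open>a * t\<close>. Read from
  right to left it writes a negative power of \<open>a\<close> as a superposition of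
  exponentials.\<close>

lemma nn_integral_powr_exp_Gamma:
  assumes "s > 0" "a > 0"
  shows "(\<integral>\<^sup>+t. ennreal (indicator {0<..} t * t powr (s - 1) * exp (- t * a)) \<partial>lborel)
    = ennreal (Gamma s * a powr (- s))"
proof -
  have "ennreal (Gamma s) = (\<integral>\<^sup>+t. ennreal (indicator {0..} t * t powr (s - 1) / exp t) \<partial>lborel)"
    using Gamma_conv_nn_integral_real assms by simp
  also have "\<dots> = ennreal \<bar>a\<bar> * (\<integral>\<^sup>+t. ennreal (indicator {0..} (0 + a * t) * (0 + a * t) powr (s - 1) / exp (0 + a * t)) \<partial>lborel)"
    using assms by (intro nn_integral_real_affine) auto
  also have "(\<integral>\<^sup>+t. ennreal (indicator {0..} (0 + a * t) * (0 + a * t) powr (s - 1) / exp (0 + a * t)) \<partial>lborel)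
     = (\<integral>\<^sup>+t. ennreal (a powr (s - 1)) * ennreal (indicator {0<..} t * t powr (s - 1) * exp (- t * a)) \<partial>lborel)"
    using assms
    by (intro nn_integral_cong)
      (auto simp: indicator_def ennreal_mult[symmetric] powr_mult exp_minus field_simps zero_le_mult_iff
        intro!: arg_cong[where f=ennreal] split: if_splits)
  also have "\<dots> = ennreal (a powr (s - 1)) * (\<integral>\<^sup>+t. ennreal (indicator {0<..} t * t powr (s - 1) * exp (- t * a)) \<partial>lborel)"
    by (rule nn_integral_cmult) auto
  finally have *: "ennreal (Gamma s) = ennreal (a powr s) * (\<integral>\<^sup>+t. ennreal (indicator {0<..} t * t powr (s - 1) * exp (- t * a)) \<partial>lborel)"
    using assms by (simp add: mult.assoc[symmetric] ennreal_mult[symmetric] powr_mult_base)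
  have "ennreal (a powr (- s)) * ennreal (Gamma s) = (\<integral>\<^sup>+t. ennreal (indicator {0<..} t * t powr (s - 1) * exp (- t * a)) \<partial>lborel)"
    unfolding * using assms by (simp add: mult.assoc[symmetric] ennreal_mult[symmetric] powr_minus)
  then show ?thesis by (simp add: ennreal_mult' mult.commute[of "Gamma s"])
qed

text \<open>
  Writing \<open>|h|\<^sup>-\<^sup>2\<^sup>s\<close> as a Gamma integral of Gaussians \<open>exp (- t |h|\<^sup>2)\<close> decouples the
  direction \<open>\<nu>\<close> from the orthogonal ones.
\<close>

lemma nn_integral_kernel_projection:
  fixes \<nu> :: "real^'n" and F :: "real \<Rightarrow> ennreal"
  assumes [measurable]: "F \<in> borel_measurable borel" and \<nu>: "norm \<nu> = 1" and \<alpha>: "\<alpha> > 0"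
  shows "(\<integral>\<^sup>+h. F (h \<bullet> \<nu>) * ennreal (1 / norm h powr (real CARD('n) + \<alpha> + 1)) \<partial>lborel)
    = ennreal (pi powr ((real CARD('n) - 1) / 2) * Gamma ((\<alpha> + 2) / 2) / Gamma ((real CARD('n) + \<alpha> + 1) / 2))
      * (\<integral>\<^sup>+u. F u * ennreal (1 / \<bar>u\<bar> powr (\<alpha> + 2)) \<partial>lborel)"
proof -
  define N where "N = real CARD('n)"
  have N: "N \<ge> 1" by (simp add: N_def Suc_leI)
  \<comment> \<open>Half the exponent of the kernel, because the Gaussians involve the square of the
    norm.\<close>
  define s where "s = (N + \<alpha> + 1) / 2"
  have s: "s > 0" using N \<alpha> by (simp add: s_def)
  have s': "s - (N - 1) / 2 = (\<alpha> + 2) / 2" by (simp add: s_def field_simps)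
  define G where "G t a = ennreal (indicator {0<..} t * t powr (s - 1) * exp (- t * a))" for t a :: real
  have [measurable]: "case_prod G \<in> borel_measurable (borel \<Otimes>\<^sub>M borel)"
    unfolding G_def split_beta' by measurable
  have G: "ennreal (1 / r powr (2 * s)) = ennreal (1 / Gamma s) * (\<integral>\<^sup>+t. G t (r\<^sup>2) \<partial>lborel)" if "r > 0" for r
  proof -
    have "(r\<^sup>2) powr (- s) = 1 / r powr (2 * s)"
    proof -
      have "(r\<^sup>2) powr (- s) = (r powr 2) powr (- s)" using that by simp
      also have "\<dots> = r powr (- (2 * s))" by (simp only: powr_powr) simp
      finally show ?thesis by (simp add: powr_minus field_simps)
    qed
    then show ?thesis
      unfolding G_def using that s
      by (subst nn_integral_powr_exp_Gamma) (auto simp: ennreal_mult[symmetric] Gamma_real_pos less_imp_le less_imp_neq[symmetric])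
  qed
  have "(\<integral>\<^sup>+h. F (h \<bullet> \<nu>) * ennreal (1 / norm h powr (N + \<alpha> + 1)) \<partial>lborel)
     = (\<integral>\<^sup>+h. ennreal (1 / Gamma s) * (\<integral>\<^sup>+t. F (h \<bullet> \<nu>) * G t ((norm h)\<^sup>2) \<partial>lborel) \<partial>lborel)"
  proof (rule nn_integral_cong_AE)
    have "AE h in lborel. (h::real^'n) \<noteq> 0" by (rule AE_lborel_singleton)
    then show "AE h in lborel. F (h \<bullet> \<nu>) * ennreal (1 / norm h powr (N + \<alpha> + 1))
       = ennreal (1 / Gamma s) * (\<integral>\<^sup>+t. F (h \<bullet> \<nu>) * G t ((norm h)\<^sup>2) \<partial>lborel)"
    proof eventually_elim
      case (elim h)
      have "2 * s = N + \<alpha> + 1" by (simp add: s_def)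
      then show ?case using G[of "norm h"] elim by (simp add: nn_integral_cmult mult_ac)
    qed
  qed
  also have "\<dots> = ennreal (1 / Gamma s) * (\<integral>\<^sup>+h. (\<integral>\<^sup>+t. F (h \<bullet> \<nu>) * G t ((norm h)\<^sup>2) \<partial>lborel) \<partial>lborel)"
    by (rule nn_integral_cmult) measurable
  also have "(\<integral>\<^sup>+h. (\<integral>\<^sup>+t. F (h \<bullet> \<nu>) * G t ((norm h)\<^sup>2) \<partial>lborel) \<partial>lborel)
      = (\<integral>\<^sup>+t. (\<integral>\<^sup>+h. F (h \<bullet> \<nu>) * G t ((norm h)\<^sup>2) \<partial>lborel) \<partial>lborel)"
    by (rule lborel_pair.Fubini') measurable
  \<comment> \<open>Integrating out the n - 1 orthogonal directions costs a factor t^(-(n-1)/2).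
    This lowers the exponent of \<open>t\<close> from \<open>s - 1\<close> to
    \<open>(\<alpha> + 2) / 2 - 1\<close>, so undoing the Gamma integral in one variable produces
    the power |u|^(-\<alpha>-2).\<close>
  also have "\<dots> = (\<integral>\<^sup>+t. (\<integral>\<^sup>+u. ennreal (pi powr ((N - 1) / 2)) * F u *
        ennreal (indicator {0<..} t * t powr ((\<alpha> + 2) / 2 - 1) * exp (- t * u\<^sup>2)) \<partial>lborel) \<partial>lborel)"
  proof (rule nn_integral_cong)
    fix t :: real
    show "(\<integral>\<^sup>+h. F (h \<bullet> \<nu>) * G t ((norm h)\<^sup>2) \<partial>lborel) = (\<integral>\<^sup>+u. ennreal (pi powr ((N - 1) / 2)) * F u *
        ennreal (indicator {0<..} t * t powr ((\<alpha> + 2) / 2 - 1) * exp (- t * u\<^sup>2)) \<partial>lborel)"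
    proof (cases "t > 0")
      case True
      have "(\<integral>\<^sup>+h. F (h \<bullet> \<nu>) * G t ((norm h)\<^sup>2) \<partial>lborel)
        = (\<integral>\<^sup>+h. ennreal (t powr (s - 1)) * (F (h \<bullet> \<nu>) * ennreal (exp (- t * (norm h)\<^sup>2))) \<partial>lborel)"
        using True by (intro nn_integral_cong) (simp add: G_def ennreal_mult mult_ac)
      also have "\<dots> = ennreal (t powr (s - 1)) * (ennreal ((pi / t) powr ((N - 1) / 2)) * (\<integral>\<^sup>+u. F u * ennreal (exp (- t * u\<^sup>2)) \<partial>lborel))"
        unfolding N_def by (subst nn_integral_cmult, measurable, subst nn_integral_exp_norm[OF _ \<nu> True]) auto
      also have "ennreal (t powr (s - 1)) * (ennreal ((pi / t) powr ((N - 1) / 2)) * (\<integral>\<^sup>+u. F u * ennreal (exp (- t * u\<^sup>2)) \<partial>lborel))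
         = ennreal (pi powr ((N - 1) / 2) * t powr ((\<alpha> + 2) / 2 - 1)) * (\<integral>\<^sup>+u. F u * ennreal (exp (- t * u\<^sup>2)) \<partial>lborel)"
      proof -
        have "t powr (s - 1) * (pi / t) powr ((N - 1) / 2) = pi powr ((N - 1) / 2) * t powr ((\<alpha> + 2) / 2 - 1)"
        proof -
          define a b where "a = (\<alpha> + 2) / 2 - 1" and "b = (N - 1) / 2"
          have "s - 1 = a + b" unfolding s_def a_def b_def by (simp add: field_simps)
          then have "t powr (s - 1) * (pi / t) powr b = pi powr b * t powr a"
            using True by (simp add: powr_divide powr_add)
          then show ?thesis by (simp only: a_def b_def)
        qed
        then show ?thesis by (simp add: mult.assoc[symmetric] ennreal_mult[symmetric])
      qed
      also have "\<dots> = (\<integral>\<^sup>+u. ennreal (pi powr ((N - 1) / 2)) * F u *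
        ennreal (indicator {0<..} t * t powr ((\<alpha> + 2) / 2 - 1) * exp (- t * u\<^sup>2)) \<partial>lborel)"
        using True by (subst nn_integral_cmult[symmetric]) (auto intro!: nn_integral_cong simp: ennreal_mult mult_ac)
      finally show ?thesis .
    qed (simp add: G_def)
  qed
  also have "\<dots> = (\<integral>\<^sup>+u. (\<integral>\<^sup>+t. ennreal (pi powr ((N - 1) / 2)) * F u *
        ennreal (indicator {0<..} t * t powr ((\<alpha> + 2) / 2 - 1) * exp (- t * u\<^sup>2)) \<partial>lborel) \<partial>lborel)"
    by (rule lborel_pair.Fubini') measurable
  also have "\<dots> = (\<integral>\<^sup>+u. ennreal (pi powr ((N - 1) / 2) * Gamma ((\<alpha> + 2) / 2)) * (F u * ennreal (1 / \<bar>u\<bar> powr (\<alpha> + 2))) \<partial>lborel)"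
  proof (rule nn_integral_cong_AE)
    have "AE u in lborel. (u::real) \<noteq> 0" by (rule AE_lborel_singleton)
    then show "AE u in lborel. (\<integral>\<^sup>+t. ennreal (pi powr ((N - 1) / 2)) * F u *
        ennreal (indicator {0<..} t * t powr ((\<alpha> + 2) / 2 - 1) * exp (- t * u\<^sup>2)) \<partial>lborel)
       = ennreal (pi powr ((N - 1) / 2) * Gamma ((\<alpha> + 2) / 2)) * (F u * ennreal (1 / \<bar>u\<bar> powr (\<alpha> + 2)))"
    proof eventually_elim
      case (elim u)
      have "(u\<^sup>2) powr (- ((\<alpha> + 2) / 2)) = (\<bar>u\<bar> powr 2) powr (- ((\<alpha> + 2) / 2))" using elim by simp
      also have "\<dots> = 1 / \<bar>u\<bar> powr (\<alpha> + 2)"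
      proof -
        have "2 * - ((\<alpha> + 2) / 2) = - (\<alpha> + 2)" by (simp add: field_simps)
        then show ?thesis unfolding powr_powr by (simp only: powr_minus_divide)
      qed
      finally have "(u\<^sup>2) powr (- ((\<alpha> + 2) / 2)) = 1 / \<bar>u\<bar> powr (\<alpha> + 2)" .
      moreover have "ennreal (Gamma ((\<alpha> + 2) / 2) * (1 / \<bar>u\<bar> powr (\<alpha> + 2)))
          = ennreal (Gamma ((\<alpha> + 2) / 2)) * ennreal (1 / \<bar>u\<bar> powr (\<alpha> + 2))"
        and "ennreal (pi powr ((N - 1) / 2) * Gamma ((\<alpha> + 2) / 2))
          = ennreal (pi powr ((N - 1) / 2)) * ennreal (Gamma ((\<alpha> + 2) / 2))"
        using \<alpha> Gamma_real_pos[of "(\<alpha> + 2) / 2"] by (rule_tac [!] ennreal_mult) simp_all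
      moreover have "(\<integral>\<^sup>+t. ennreal (pi powr ((N - 1) / 2)) * F u *
          ennreal (indicator {0<..} t * t powr ((\<alpha> + 2) / 2 - 1) * exp (- t * u\<^sup>2)) \<partial>lborel)
        = ennreal (pi powr ((N - 1) / 2)) * F u * ennreal (Gamma ((\<alpha> + 2) / 2) * (u\<^sup>2) powr (- ((\<alpha> + 2) / 2)))"
        using elim \<alpha> by (subst nn_integral_cmult, simp, subst nn_integral_powr_exp_Gamma) auto
      ultimately show ?case by (simp only: mult_ac)
    qed
  qed
  also have "\<dots> = ennreal (pi powr ((N - 1) / 2) * Gamma ((\<alpha> + 2) / 2)) * (\<integral>\<^sup>+u. F u * ennreal (1 / \<bar>u\<bar> powr (\<alpha> + 2)) \<partial>lborel)"
    by (rule nn_integral_cmult) measurable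
  also have "ennreal (1 / Gamma s) * (ennreal (pi powr ((N - 1) / 2) * Gamma ((\<alpha> + 2) / 2)) * (\<integral>\<^sup>+u. F u * ennreal (1 / \<bar>u\<bar> powr (\<alpha> + 2)) \<partial>lborel))
     = ennreal (pi powr ((N - 1) / 2) * Gamma ((\<alpha> + 2) / 2) / Gamma s) * (\<integral>\<^sup>+u. F u * ennreal (1 / \<bar>u\<bar> powr (\<alpha> + 2)) \<partial>lborel)"
    using s \<alpha> by (simp add: mult.assoc[symmetric] ennreal_mult[symmetric] Gamma_real_pos less_imp_le)
  finally show ?thesis by (simp add: N_def s_def)
qed

text \<open>
  Since \<open>|h|\<^sup>-\<^sup>N\<^sup>-\<^sup>\<alpha>\<close> is comparable with the integral of \<open>r\<^sup>-\<^sup>N\<^sup>-\<^sup>\<alpha>\<^sup>-\<^sup>1\<close> over \<open>|h| < r < 2|h|\<close>,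
  Tonelli reduces the claim to volumes of balls and to one-dimensional integrals.
\<close>

lemma nn_integral_kernel_bound:
  fixes \<alpha> :: real
  assumes \<alpha>: "0 < \<alpha>" "\<alpha> < 1"
  obtains C where "C \<ge> 0" and
    "\<And>t. t > 0 \<Longrightarrow> (\<integral>\<^sup>+h. ennreal (min 1 (t * norm (h::real^'n)) / norm h powr (real CARD('n) + \<alpha>)) \<partial>lborel)
       \<le> ennreal (C * t powr \<alpha>)"
proof -
  define N where "N = real CARD('n)"
  \<comment> \<open>The loss from replacing \<open>r\<close> by its largest value 2|h| in
    r^(-N-\<alpha>-1) on the interval from |h| to 2|h|.\<close>
  define K where "K = 2 powr (N + \<alpha> + 1)"
  define \<omega> where "\<omega> = unit_ball_vol N"
  have \<omega>: "\<omega> \<ge> 0" by (simp add: \<omega>_def N_def)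
  \<comment> \<open>The two fractions are, up to the factor \<open>t powr \<alpha>\<close>, the
    integrals of \<open>t * r powr (- \<alpha>)\<close> up to \<open>1 / t\<close> and of
    \<open>r powr (- \<alpha> - 1)\<close> beyond it; the first converges because \<alpha> < 1, the
    second because \<alpha> > 0.\<close>
  define C where "C = K * \<omega> * (1 / (1 - \<alpha>) + 1 / \<alpha>)"
  show thesis
  proof (rule that[of C])
    show "C \<ge> 0" using \<alpha> \<omega> by (simp add: C_def K_def)
  next
    fix t :: real assume t: "t > 0"
    define w where "w r = indicator {0<..} r * (min 1 (t * r) * r powr (- N - \<alpha> - 1))" for r :: real
    have [measurable]: "w \<in> borel_measurable borel" unfolding w_def by measurable
    have w0: "w r \<ge> 0" for r using t by (auto simp: w_def indicator_def)
    define J where "J h r = ennreal (w r) * indicator {r. norm h < r \<and> r < 2 * norm h} r" for h :: "real^'n" and r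
    have Jm[measurable]: "case_prod J \<in> borel_measurable (borel \<Otimes>\<^sub>M borel)"
    proof -
      have "case_prod J = (\<lambda>(h, r). ennreal (w r) * (if norm h < r \<and> r < 2 * norm h then 1 else 0))"
        by (auto simp: J_def fun_eq_iff indicator_def)
      also have "\<dots> \<in> borel_measurable (borel \<Otimes>\<^sub>M borel)" by measurable
      finally show ?thesis .
    qed
    have lower: "ennreal (min 1 (t * norm h) / norm h powr (N + \<alpha>)) \<le> ennreal K * (\<integral>\<^sup>+r. J h r \<partial>lborel)" for h :: "real^'n"
    proof (cases "h = 0")
      case False
      define \<rho> where "\<rho> = norm h"
      have \<rho>: "\<rho> > 0" using False by (simp add: \<rho>_def)
      define m where "m = min 1 (t * \<rho>) * (2 * \<rho>) powr (- N - \<alpha> - 1)"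
      have m0: "m \<ge> 0" using t \<rho> by (simp add: m_def)
      have "m \<le> w r" if "\<rho> < r" "r < 2 * \<rho>" for r
      proof -
        have "(2 * \<rho>) powr (- N - \<alpha> - 1) \<le> r powr (- N - \<alpha> - 1)"
          using that \<rho> \<alpha> by (intro powr_mono2') (auto simp: N_def)
        moreover have "min 1 (t * \<rho>) \<le> min 1 (t * r)" using that t by (intro min.mono) auto
        ultimately show ?thesis using that \<rho> t by (auto simp: w_def m_def intro!: mult_mono)
      qed
      then have "(\<integral>\<^sup>+r. ennreal m * indicator {\<rho><..<2 * \<rho>} r \<partial>lborel) \<le> (\<integral>\<^sup>+r. J h r \<partial>lborel)"
        by (intro nn_integral_mono) (auto simp: J_def \<rho>_def indicator_def ennreal_leI)
      then have *: "ennreal (m * \<rho>) \<le> (\<integral>\<^sup>+r. J h r \<partial>lborel)"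
        using \<rho> m0 by (simp add: nn_integral_cmult_indicator ennreal_mult)
      have "K * (m * \<rho>) = min 1 (t * norm h) / norm h powr (N + \<alpha>)"
      proof -
        have "(2 * \<rho>) powr (- N - \<alpha> - 1) = 1 / (K * (\<rho> powr (N + \<alpha>) * \<rho>))"
        proof -
          have "- N - \<alpha> - 1 = - (N + \<alpha> + 1)" by simp
          then have "(2 * \<rho>) powr (- N - \<alpha> - 1) = 1 / (2 * \<rho>) powr (N + \<alpha> + 1)"
            by (simp only: powr_minus_divide)
          also have "(2 * \<rho>) powr (N + \<alpha> + 1) = K * (\<rho> powr (N + \<alpha>) * \<rho>)"
            unfolding powr_mult K_def using \<rho> by (simp add: powr_add)
          finally show ?thesis .
        qed
        moreover have "K > 0" by (simp add: K_def)
        ultimately show ?thesis using \<rho> by (simp add: m_def \<rho>_def[symmetric] field_simps)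
      qed
      then have "ennreal (min 1 (t * norm h) / norm h powr (N + \<alpha>)) = ennreal K * ennreal (m * \<rho>)"
        using m0 \<rho> by (metis K_def ennreal_mult'' less_imp_le mult_nonneg_nonneg powr_ge_zero)
      with * show ?thesis by (simp add: mult_left_mono)
    qed simp
    \<comment> \<open>For fixed \<open>r\<close> the admissible \<open>h\<close> lie in a ball of
      radius \<open>r\<close>, whose volume cancels the factor r^(-N) of the weight.\<close>
    have meas: "(\<integral>\<^sup>+h. J h r \<partial>lborel) \<le> ennreal (\<omega> * (indicator {0<..} r * (min 1 (t * r) * r powr (- \<alpha> - 1))))" for r
    proof (cases "r > 0")
      case True
      have "(\<integral>\<^sup>+h. J h r \<partial>lborel) \<le> (\<integral>\<^sup>+h. ennreal (w r) * indicator (ball (0::real^'n) r) h \<partial>lborel)"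
        by (intro nn_integral_mono) (auto simp: J_def indicator_def)
      also have "\<dots> = ennreal (w r) * ennreal (\<omega> * r ^ CARD('n))"
        using True by (simp add: nn_integral_cmult_indicator emeasure_ball \<omega>_def N_def)
      also have "\<dots> = ennreal (w r * (\<omega> * r ^ CARD('n)))" using w0 \<omega> True by (simp add: ennreal_mult)
      also have "w r * (\<omega> * r ^ CARD('n)) = \<omega> * (indicator {0<..} r * (min 1 (t * r) * r powr (- \<alpha> - 1)))"
      proof -
        have "r powr (- N - \<alpha> - 1) * r powr N = r powr (- \<alpha> - 1)"
          by (simp add: powr_add[symmetric])
        then have "r powr (- N - \<alpha> - 1) * r ^ CARD('n) = r powr (- \<alpha> - 1)"
          using True by (simp add: N_def powr_realpow)
        then show ?thesis using True by (simp add: w_def)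
      qed
      finally show ?thesis .
    next
      case False
      then have "(\<integral>\<^sup>+h. J h r \<partial>lborel) = (\<integral>\<^sup>+h. 0 \<partial>(lborel :: (real^'n) measure))"
        by (intro nn_integral_cong) (auto simp: J_def w_def)
      then show ?thesis by simp
    qed
    have I1: "(\<integral>\<^sup>+r. ennreal (indicator {0..1/t} r * (t * r powr (- \<alpha>))) \<partial>lborel) = ennreal (t powr \<alpha> / (1 - \<alpha>))"
    proof -
      have "((\<lambda>r. t * r powr (- \<alpha>)) has_integral (t * ((1/t) powr (- \<alpha> + 1) / (- \<alpha> + 1)))) {0..1/t}"
        using \<alpha> t by (intro has_integral_mult_right has_integral_powr_from_0) auto
      also have "t * ((1/t) powr (- \<alpha> + 1) / (- \<alpha> + 1)) = t powr \<alpha> / (1 - \<alpha>)"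
      proof -
        have "t powr \<alpha> * t powr (1 - \<alpha>) = t" using t by (simp add: powr_add[symmetric])
        then show ?thesis using t \<alpha> by (simp add: powr_divide field_simps)
      qed
      finally show ?thesis using t by (subst nn_integral_has_integral_lebesgue[where I="t powr \<alpha> / (1 - \<alpha>)"]) auto
    qed
    have I2: "(\<integral>\<^sup>+r. ennreal (indicator {1/t..} r * (r powr (- \<alpha> - 1))) \<partial>lborel) = ennreal (t powr \<alpha> / \<alpha>)"
    proof -
      have "((\<lambda>r. r powr (- \<alpha> - 1)) has_integral (- ((1/t) powr ((- \<alpha> - 1) + 1)) / ((- \<alpha> - 1) + 1))) {1/t..}"
        using \<alpha> t by (intro has_integral_powr_to_inf) auto
      also have "- ((1/t) powr ((- \<alpha> - 1) + 1)) / ((- \<alpha> - 1) + 1) = t powr \<alpha> / \<alpha>"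
        using t \<alpha> by (simp add: powr_divide powr_minus field_simps)
      finally show ?thesis by (subst nn_integral_has_integral_lebesgue[where I="t powr \<alpha> / \<alpha>"]) auto
    qed
    have "(\<integral>\<^sup>+h. ennreal (min 1 (t * norm (h::real^'n)) / norm h powr (N + \<alpha>)) \<partial>lborel)
      \<le> (\<integral>\<^sup>+h. ennreal K * (\<integral>\<^sup>+r. J h r \<partial>lborel) \<partial>lborel)"
      by (intro nn_integral_mono lower)
    also have "\<dots> = ennreal K * (\<integral>\<^sup>+h. (\<integral>\<^sup>+r. J h r \<partial>lborel) \<partial>lborel)"
      by (rule nn_integral_cmult) measurable
    also have "(\<integral>\<^sup>+h. (\<integral>\<^sup>+r. J h r \<partial>lborel) \<partial>lborel) = (\<integral>\<^sup>+r. (\<integral>\<^sup>+h. J h r \<partial>lborel) \<partial>lborel)"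
      by (rule lborel_pair.Fubini') measurable
    also have "\<dots> \<le> (\<integral>\<^sup>+r. ennreal (\<omega> * (indicator {0<..} r * (min 1 (t * r) * r powr (- \<alpha> - 1)))) \<partial>lborel)"
      by (intro nn_integral_mono meas)
    also have "\<dots> \<le> (\<integral>\<^sup>+r. ennreal \<omega> * (ennreal (indicator {0..1/t} r * (t * r powr (- \<alpha>)))
         + ennreal (indicator {1/t..} r * (r powr (- \<alpha> - 1)))) \<partial>lborel)"
    proof (rule nn_integral_mono)
      fix r :: real
      have "indicator {0<..} r * (min 1 (t * r) * r powr (- \<alpha> - 1))
        \<le> indicator {0..1/t} r * (t * r powr (- \<alpha>)) + indicator {1/t..} r * (r powr (- \<alpha> - 1))"
      proof (cases "0 < r")
        case True
        show ?thesis
        proof (cases "r \<le> 1 / t")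
          case le: True
          have "min 1 (t * r) * r powr (- \<alpha> - 1) \<le> t * r * r powr (- \<alpha> - 1)"
            by (intro mult_right_mono) auto
          also have "\<dots> = t * r powr (- \<alpha>)" using True by (simp add: powr_diff)
          finally show ?thesis using True le by (auto simp: indicator_def)
        next
          case False
          have "min 1 (t * r) * r powr (- \<alpha> - 1) \<le> 1 * r powr (- \<alpha> - 1)"
            by (intro mult_right_mono) auto
          then show ?thesis using True False by (auto simp: indicator_def)
        qed
      qed (use t in \<open>auto simp: indicator_def\<close>)
      then show "ennreal (\<omega> * (indicator {0<..} r * (min 1 (t * r) * r powr (- \<alpha> - 1))))
        \<le> ennreal \<omega> * (ennreal (indicator {0..1/t} r * (t * r powr (- \<alpha>)))
         + ennreal (indicator {1/t..} r * (r powr (- \<alpha> - 1))))"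
        using \<omega> t by (simp add: ennreal_mult[symmetric] ennreal_plus[symmetric] ennreal_leI mult_left_mono del: ennreal_plus)
    qed
    also have "\<dots> = ennreal \<omega> * (ennreal (t powr \<alpha> / (1 - \<alpha>)) + ennreal (t powr \<alpha> / \<alpha>))"
      by (simp add: nn_integral_cmult nn_integral_add I1 I2)
    also have "ennreal K * (ennreal \<omega> * (ennreal (t powr \<alpha> / (1 - \<alpha>)) + ennreal (t powr \<alpha> / \<alpha>)))
      = ennreal (C * t powr \<alpha>)"
    proof -
      have "C * t powr \<alpha> = K * (\<omega> * (t powr \<alpha> / (1 - \<alpha>) + t powr \<alpha> / \<alpha>))"
        using \<alpha> by (simp add: C_def field_simps)
      then show ?thesis using \<omega> \<alpha>
        by (simp add: ennreal_mult[symmetric] ennreal_plus[symmetric] K_def del: ennreal_plus)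
    qed
    finally show "(\<integral>\<^sup>+h. ennreal (min 1 (t * norm (h::real^'n)) / norm h powr (real CARD('n) + \<alpha>)) \<partial>lborel)
       \<le> ennreal (C * t powr \<alpha>)"
      by (simp add: N_def mult_left_mono)
  qed
qed

section \<open>Jordan decomposition\<close>

text \<open>Models one coordinate of a vector measure. Only real values and countable additivity are
  assumed, so finiteness of the variation has to be derived.\<close>

locale signed_borel_measure =
  fixes m :: "(real^'n) set \<Rightarrow> real"
  assumes m_empty: "m {} = 0"
    and m_sums: "range A \<subseteq> sets borel \<Longrightarrow> disjoint_family A \<Longrightarrow> (\<lambda>k. m (A k)) sums m (\<Union>k. A k)"
begin

text \<open>The set function inside \<open>jordan_pos\<close>, kept separate because
  \<open>measure_of\<close> returns it as a measure only after countable additivity has been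
  established.\<close>

definition pos_var :: "(real^'n) set \<Rightarrow> ennreal" where
  "pos_var A = (SUP B\<in>{B \<in> sets borel. B \<subseteq> A}. ennreal (m B))"

lemma m_Un:
  assumes A: "A \<in> sets borel" and B: "B \<in> sets borel" and AB: "A \<inter> B = {}"
  shows "m (A \<union> B) = m A + m B"
proof -
  define F where "F k = (if k = 0 then A else if k = Suc 0 then B else {})" for k :: nat
  have "(\<lambda>k. m (F k)) sums m (\<Union>k. F k)"
    using A B AB by (intro m_sums) (auto simp: F_def disjoint_family_on_def)
  moreover have "(\<Union>k. F k) = A \<union> B" by (auto simp: F_def split: if_splits)
  moreover have "(\<lambda>k. m (F k)) sums (\<Sum>k\<in>{0, Suc 0}. m (F k))"
    by (rule sums_finite) (auto simp: F_def m_empty)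
  ultimately show ?thesis using sums_unique2 by (fastforce simp: F_def)
qed

lemma m_Diff:
  assumes "A \<in> sets borel" "B \<in> sets borel" "B \<subseteq> A"
  shows "m (A - B) = m A - m B"
proof -
  have "(A - B) \<inter> B = {}" by auto
  then show ?thesis using m_Un[of "A - B" B] assms by (simp add: Un_absorb2)
qed

lemma pos_var_upper: "B \<in> sets borel \<Longrightarrow> B \<subseteq> A \<Longrightarrow> ennreal (m B) \<le> pos_var A"
  unfolding pos_var_def by (rule SUP_upper) auto

lemma pos_var_least: "(\<And>B. B \<in> sets borel \<Longrightarrow> B \<subseteq> A \<Longrightarrow> ennreal (m B) \<le> c) \<Longrightarrow> pos_var A \<le> c"
  unfolding pos_var_def by (rule SUP_least) auto

lemma pos_var_mono: "A \<subseteq> B \<Longrightarrow> pos_var A \<le> pos_var B"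
  by (rule pos_var_least) (auto intro: pos_var_upper)

text \<open>Competitors inside \<open>A\<close> and inside \<open>B\<close> merge into one inside
  the union. If one of them has negative mass, \<open>ennreal\<close> sends it to 0 and the other
  alone does the job.\<close>

lemma pos_var_Un:
  assumes AB: "A \<inter> B = {}"
  shows "pos_var A + pos_var B \<le> pos_var (A \<union> B)"
proof -
  have 1: "ennreal (m E) + ennreal (m F) \<le> pos_var (A \<union> B)"
    if E: "E \<in> sets borel" "E \<subseteq> A" and F: "F \<in> sets borel" "F \<subseteq> B" for E F
  proof (cases "m E \<ge> 0 \<and> m F \<ge> 0")
    case True
    have "m (E \<union> F) = m E + m F" using E F AB by (intro m_Un) auto
    then have "ennreal (m E) + ennreal (m F) = ennreal (m (E \<union> F))" using True by simp
    also have "\<dots> \<le> pos_var (A \<union> B)" using E F by (intro pos_var_upper) auto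
    finally show ?thesis .
  next
    case False
    then show ?thesis
      using pos_var_upper[of E "A \<union> B"] pos_var_upper[of F "A \<union> B"] E F
      by (auto simp: not_le ennreal_neg le_supI1 le_supI2)
  qed
  have 2: "ennreal (m E) + pos_var B \<le> pos_var (A \<union> B)" if E: "E \<in> sets borel" "E \<subseteq> A" for E
  proof -
    have "{F \<in> sets borel. F \<subseteq> B} \<noteq> {}" by auto
    then show ?thesis
      unfolding pos_var_def[of B] by (subst ennreal_SUP_add_right) (auto intro!: SUP_least 1 E)
  qed
  have "{E \<in> sets borel. E \<subseteq> A} \<noteq> {}" by auto
  then show ?thesis
    unfolding pos_var_def[of A] add.commute[of _ "pos_var B"]
    by (subst ennreal_SUP_add_right) (auto intro!: SUP_least 2 simp: add.commute)
qed

text \<open>One inequality iterates the superadditivity of \<open>pos_var_Un\<close>. For the other,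
  a competitor in the union is cut along the sets \<open>A k\<close>, and each piece competes in its
  own \<open>A k\<close>.\<close>

lemma pos_var_countably_additive: "countably_additive (sets borel) pos_var"
proof (rule countably_additiveI)
  fix A :: "nat \<Rightarrow> (real^'n) set"
  assume A: "range A \<subseteq> sets borel" "disjoint_family A"
  show "(\<Sum>k. pos_var (A k)) = pos_var (\<Union>k. A k)"
  proof (rule antisym)
    have "(\<Sum>k<n. pos_var (A k)) \<le> pos_var (\<Union>k<n. A k)" for n
    proof (induction n)
      case (Suc n)
      have disj: "(\<Union>k<n. A k) \<inter> A n = {}"
      proof -
        have "A i \<inter> A n = {}" if "i < n" for i
          using disjoint_family_onD[OF A(2), of i n] that by simp
        then show ?thesis by blast
      qed
      have "(\<Sum>k<Suc n. pos_var (A k)) = (\<Sum>k<n. pos_var (A k)) + pos_var (A n)" by simp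
      also have "\<dots> \<le> pos_var (\<Union>k<n. A k) + pos_var (A n)" using Suc by (rule add_right_mono)
      also have "\<dots> \<le> pos_var ((\<Union>k<n. A k) \<union> A n)" by (rule pos_var_Un[OF disj])
      also have "(\<Union>k<n. A k) \<union> A n = (\<Union>k<Suc n. A k)" by (auto simp: lessThan_Suc)
      finally show ?case .
    qed simp
    also have "pos_var (\<Union>k<n. A k) \<le> pos_var (\<Union>k. A k)" for n
      by (rule pos_var_mono) auto
    finally show "(\<Sum>k. pos_var (A k)) \<le> pos_var (\<Union>k. A k)"
      by (subst suminf_eq_SUP) (rule SUP_least)
  next
    show "pos_var (\<Union>k. A k) \<le> (\<Sum>k. pos_var (A k))"
    proof (rule pos_var_least)
      fix B :: "(real^'n) set" assume B: "B \<in> sets borel" "B \<subseteq> (\<Union>k. A k)"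
      have "(\<lambda>k. m (B \<inter> A k)) sums m (\<Union>k. B \<inter> A k)"
        using A B by (intro m_sums) (auto simp: disjoint_family_on_def)
      moreover have "(\<Union>k. B \<inter> A k) = B" using B by auto
      ultimately have "(\<lambda>n. ennreal (\<Sum>k<n. m (B \<inter> A k))) \<longlonglongrightarrow> ennreal (m B)"
        by (auto simp: sums_def intro: tendsto_ennrealI)
      moreover have "ennreal (\<Sum>k<n. m (B \<inter> A k)) \<le> (\<Sum>k. pos_var (A k))" for n
      proof -
        \<comment> \<open>Pieces of negative mass are raised to 0 first, since
          \<open>ennreal\<close> is additive on nonnegative reals only.\<close>
        have "ennreal (\<Sum>k<n. m (B \<inter> A k)) \<le> ennreal (\<Sum>k<n. max 0 (m (B \<inter> A k)))"
          by (intro ennreal_leI sum_mono) auto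
        also have "\<dots> = (\<Sum>k<n. ennreal (max 0 (m (B \<inter> A k))))" by (subst sum_ennreal) auto
        also have "\<dots> \<le> (\<Sum>k<n. pos_var (A k))"
        proof (rule sum_mono)
          fix k
          have "ennreal (m (B \<inter> A k)) \<le> pos_var (A k)" using A B by (intro pos_var_upper) auto
          then show "ennreal (max 0 (m (B \<inter> A k))) \<le> pos_var (A k)" by (simp add: max_def ennreal_neg)
        qed
        also have "\<dots> \<le> (\<Sum>k. pos_var (A k))" by (rule sum_le_suminf) auto
        finally show ?thesis .
      qed
      ultimately show "ennreal (m B) \<le> (\<Sum>k. pos_var (A k))" by (intro LIMSEQ_le_const2) blast+
    qed
  qed
qed

lemma pos_var_empty: "pos_var {} = 0"
proof -
  have "pos_var {} \<le> 0" by (rule pos_var_least) (auto simp: m_empty)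
  then show ?thesis by simp
qed

lemma sets_jordan_pos: "sets (jordan_pos m) = sets borel"
  unfolding jordan_pos_def using sets.sigma_sets_eq[of "borel :: (real^'n) measure"]
  by (subst sets_measure_of) auto

lemma space_jordan_pos: "space (jordan_pos m) = UNIV"
  unfolding jordan_pos_def by (rule space_measure_of) auto

lemma emeasure_jordan_pos:
  assumes "A \<in> sets borel"
  shows "emeasure (jordan_pos m) A = pos_var A"
proof (rule emeasure_measure_of[OF jordan_pos_def[of m, folded pos_var_def]])
  show "positive (sets (jordan_pos m)) pos_var" by (simp add: positive_def pos_var_empty)
  show "countably_additive (sets (jordan_pos m)) pos_var"
    unfolding sets_jordan_pos by (rule pos_var_countably_additive)
qed (use assms in \<open>auto simp: sets_jordan_pos\<close>)

lemma pos_var_add: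
  assumes "A \<in> sets borel" "B \<in> sets borel" "A \<inter> B = {}"
  shows "pos_var (A \<union> B) = pos_var A + pos_var B"
  using plus_emeasure[of A "jordan_pos m" B] assms
  by (simp add: sets_jordan_pos emeasure_jordan_pos)

text \<open>Take \<open>E\<close> inside \<open>A\<close> with \<open>m E\<close> larger than
  \<open>\<bar>K\<bar> + \<bar>m A\<bar>\<close>. By additivity \<open>E\<close> or
  \<open>A - E\<close> still has infinite positive variation, and the term
  \<open>\<bar>m A\<bar>\<close> ensures that \<open>m (A - E) = m A - m E\<close> is large in
  modulus too.\<close>

lemma pos_var_infinite_step:
  assumes A: "A \<in> sets borel" "pos_var A = \<infinity>"
  shows "\<exists>B. B \<in> sets borel \<and> B \<subseteq> A \<and> pos_var B = \<infinity> \<and> \<bar>m B\<bar> > K"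
proof -
  define M where "M = \<bar>K\<bar> + \<bar>m A\<bar>"
  have "ennreal M < pos_var A" using A by simp
  then obtain E where E: "E \<in> sets borel" "E \<subseteq> A" "ennreal M < ennreal (m E)"
    unfolding pos_var_def less_SUP_iff by auto
  have mE: "m E > M" using E(3) by (subst (asm) ennreal_less_iff) (simp add: M_def)
  have "pos_var E + pos_var (A - E) = \<infinity>"
    using pos_var_add[of E "A - E"] E A by (simp add: Un_absorb1)
  then consider "pos_var E = \<infinity>" | "pos_var (A - E) = \<infinity>" by fastforce
  then show ?thesis
  proof cases
    case 1 then show ?thesis using E mE by (intro exI[of _ E]) (auto simp: M_def)
  next
    case 2 then show ?thesis using E A mE m_Diff[of A E]
      by (intro exI[of _ "A - E"]) (auto simp: M_def)
  qed
qed

text \<open>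
  Otherwise there would be a decreasing sequence \<open>B\<close> of sets with \<open>\<bar>m (B k)\<bar>\<close> unbounded,
  whereas \<open>m\<close> converges along decreasing sequences.
\<close>

lemma pos_var_finite: "pos_var UNIV < \<infinity>"
proof (rule ccontr)
  assume "\<not> pos_var UNIV < \<infinity>"
  then have inf: "pos_var UNIV = \<infinity>" by (simp add: less_top[symmetric])
  define P where "P A \<longleftrightarrow> A \<in> sets borel \<and> pos_var A = \<infinity>" for A
  have "\<exists>B. \<forall>k. P (B k) \<and> (B (Suc k) \<subseteq> B k \<and> \<bar>m (B (Suc k))\<bar> > real k)"
  proof (rule dependent_nat_choice)
    show "\<exists>A. P A" using inf by (auto simp: P_def)
    show "\<exists>y. P y \<and> y \<subseteq> x \<and> real n < \<bar>m y\<bar>" if "P x" for x n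
      using pos_var_infinite_step[of x "real n"] that by (auto simp: P_def)
  qed
  then obtain B where B: "\<And>k. B k \<in> sets borel" "\<And>k. B (Suc k) \<subseteq> B k" "\<And>k. \<bar>m (B (Suc k))\<bar> > real k"
    by (auto simp: P_def)
  have dec: "decseq B" by (rule decseq_SucI) (rule B)
  \<comment> \<open>The successive differences are disjoint and their masses telescope, so countable
    additivity makes \<open>m (B n)\<close> converge.\<close>
  define D where "D k = B k - B (Suc k)" for k
  have "(\<lambda>k. m (D k)) sums m (\<Union>k. D k)"
  proof (rule m_sums)
    show "range D \<subseteq> sets borel" using B by (auto simp: D_def)
    show "disjoint_family D"
    proof -
      have "D i \<inter> D j = {}" if "i < j" for i j
        using that decseqD[OF dec, of "Suc i" j] by (auto simp: D_def)
      then show ?thesis unfolding disjoint_family_on_def by (metis Int_commute nat_neq_iff)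
    qed
  qed
  moreover have "m (D k) = m (B k) - m (B (Suc k))" for k unfolding D_def by (rule m_Diff) (use B in auto)
  ultimately have "(\<lambda>n. \<Sum>k<n. m (B k) - m (B (Suc k))) \<longlonglongrightarrow> m (\<Union>k. D k)" by (simp add: sums_def)
  moreover have "(\<Sum>k<n. m (B k) - m (B (Suc k))) = m (B 0) - m (B n)" for n
    by (rule sum_lessThan_telescope')
  ultimately have "(\<lambda>n. m (B 0) - m (B n)) \<longlonglongrightarrow> m (\<Union>k. D k)" by simp
  then have "(\<lambda>n. m (B 0) - (m (B 0) - m (B n))) \<longlonglongrightarrow> m (B 0) - m (\<Union>k. D k)"
    by (intro tendsto_intros)
  then have "Bseq (\<lambda>n. m (B n))" by (intro convergent_imp_Bseq) (auto simp: convergent_def)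
  then obtain K where K: "\<And>n. \<bar>m (B n)\<bar> \<le> K" by (auto simp: Bseq_def)
  obtain k :: nat where "K < real k" using reals_Archimedean2 by blast
  with K[of "Suc k"] B(3)[of k] show False by linarith
qed

lemma finite_measure_jordan_pos: "finite_measure (jordan_pos m)"
  using pos_var_finite by (intro finite_measureI) (simp add: space_jordan_pos emeasure_jordan_pos)

lemma uminus: "signed_borel_measure (\<lambda>B. - m B)"
proof
  show "(\<lambda>k. - m (A k)) sums (- m (\<Union>k. A k))" if "range A \<subseteq> sets borel" "disjoint_family A" for A
    using m_sums[OF that] by (rule sums_minus)
qed (simp add: m_empty)

lemma m_le_measure_jordan_pos:
  "A \<in> sets borel \<Longrightarrow> B \<in> sets borel \<Longrightarrow> B \<subseteq> A \<Longrightarrow> m B \<le> measure (jordan_pos m) A"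
  using pos_var_upper[of B A] finite_measure.emeasure_eq_measure[OF finite_measure_jordan_pos, of A]
  by (simp add: emeasure_jordan_pos)

lemma measure_jordan_pos_le:
  assumes "A \<in> sets borel" "\<And>B. B \<in> sets borel \<Longrightarrow> B \<subseteq> A \<Longrightarrow> m B \<le> c"
  shows "measure (jordan_pos m) A \<le> c"
proof -
  have "c \<ge> 0" using assms(2)[of "{}"] by (simp add: m_empty)
  have "emeasure (jordan_pos m) A \<le> ennreal c"
    unfolding emeasure_jordan_pos[OF assms(1)] by (rule pos_var_least) (auto intro: ennreal_leI assms(2))
  with \<open>c \<ge> 0\<close> show ?thesis
    using finite_measure.emeasure_eq_measure[OF finite_measure_jordan_pos, of A] by simp
qed

end

text \<open>For \<open>B\<close> inside \<open>A\<close>, \<open>m B = m A - m (A - B)\<close>;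
  maximising \<open>m\<close> over subsets of \<open>A\<close> is therefore the same as maximising
  \<open>- m\<close> over their complements in \<open>A\<close>, up to the constant
  \<open>m A\<close>.\<close>

lemma (in signed_borel_measure) jordan_decomposition:
  assumes A: "A \<in> sets borel"
  shows "m A = measure (jordan_pos m) A - measure (jordan_pos (\<lambda>B. - m B)) A"
proof -
  interpret neg: signed_borel_measure "\<lambda>B. - m B" by (rule uminus)
  have "m A + measure (jordan_pos (\<lambda>B. - m B)) A \<le> measure (jordan_pos m) A"
  proof -
    have "measure (jordan_pos (\<lambda>B. - m B)) A \<le> measure (jordan_pos m) A - m A"
    proof (rule neg.measure_jordan_pos_le[OF A])
      fix B :: "(real^'n) set" assume B: "B \<in> sets borel" "B \<subseteq> A"
      show "- m B \<le> measure (jordan_pos m) A - m A"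
        using m_le_measure_jordan_pos[of A "A - B"] m_Diff[OF A B] A B by auto
    qed
    then show ?thesis by simp
  qed
  moreover have "measure (jordan_pos m) A \<le> m A + measure (jordan_pos (\<lambda>B. - m B)) A"
  proof (rule measure_jordan_pos_le[OF A])
    fix B :: "(real^'n) set" assume B: "B \<in> sets borel" "B \<subseteq> A"
    show "m B \<le> m A + measure (jordan_pos (\<lambda>B. - m B)) A"
      using neg.m_le_measure_jordan_pos[of A "A - B"] m_Diff[OF A B] A B by auto
  qed
  ultimately show ?thesis by simp
qed

text \<open>Both Jordan parts are finite measures, so the constant \<open>M\<close> is an integrable
  majorant for each.\<close>

lemma (in signed_borel_measure) signed_integral_dominated_convergence:
  fixes g :: "nat \<Rightarrow> real^'n \<Rightarrow> real"
  assumes [measurable]: "\<And>k. g k \<in> borel_measurable borel" "G \<in> borel_measurable borel"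
    and lim: "\<And>x. (\<lambda>k. g k x) \<longlonglongrightarrow> G x" and bound: "\<And>k x. \<bar>g k x\<bar> \<le> M"
  shows "(\<lambda>k. signed_integral m (g k)) \<longlonglongrightarrow> signed_integral m G"
proof -
  interpret neg: signed_borel_measure "\<lambda>B. - m B" by (rule uminus)
  have *: "(\<lambda>k. LINT x|\<mu>. g k x) \<longlonglongrightarrow> (LINT x|\<mu>. G x)"
    if "finite_measure \<mu>" and s[measurable_cong]: "sets \<mu> = sets borel" for \<mu>
  proof (rule integral_dominated_convergence[where w="\<lambda>_. M"])
    interpret finite_measure \<mu> by fact
    show "integrable \<mu> (\<lambda>_. M)" by simp
  qed (use lim bound in auto)
  show ?thesis unfolding signed_integral_def
    by (intro tendsto_diff * finite_measure_jordan_pos neg.finite_measure_jordan_pos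
        sets_jordan_pos neg.sets_jordan_pos)
qed

lemma (in signed_borel_measure) signed_integral_indicator:
  assumes "A \<in> sets borel"
  shows "signed_integral m (\<lambda>x. c * indicator A x) = c * m A"
proof -
  interpret neg: signed_borel_measure "\<lambda>B. - m B" by (rule uminus)
  show ?thesis
    using assms jordan_decomposition[OF assms]
    by (simp add: signed_integral_def space_jordan_pos neg.space_jordan_pos right_diff_distrib)
qed

section \<open>The norm of \<open>L\<^sup>p\<close>\<close>

text \<open>Equalities and measurability of the essential supremum are later read off from its upper
  bounds, which become almost-everywhere statements for \<open>lborel\<close> here.\<close>

lemma Lp_norm_top_le_iff:
  assumes "v \<in> borel_measurable lebesgue"
  shows "Lp_norm \<infinity> v \<le> z \<longleftrightarrow> (AE x in lborel. ennreal (norm (v x)) \<le> z)"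
proof -
  have m: "(\<lambda>x. ennreal (norm (v x))) \<in> borel_measurable lebesgue" using assms by measurable
  have "esssup lebesgue (\<lambda>x. ennreal (norm (v x))) \<le> z" if "AE x in lborel. ennreal (norm (v x)) \<le> z"
    using that by (intro esssup_I m) (simp add: AE_completion_iff)
  moreover have "AE x in lborel. ennreal (norm (v x)) \<le> z" if "esssup lebesgue (\<lambda>x. ennreal (norm (v x))) \<le> z"
  proof -
    have "AE x in lborel. ennreal (norm (v x)) \<le> esssup lebesgue (\<lambda>x. ennreal (norm (v x)))"
      using esssup_AE[of "\<lambda>x. ennreal (norm (v x))" lebesgue] by (simp only: AE_completion_iff)
    then show ?thesis by eventually_elim (use that in auto)
  qed
  ultimately show ?thesis by (auto simp: Lp_norm_def)
qed

lemma Lp_norm_fin: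
  assumes "q \<noteq> \<infinity>"
  shows "Lp_norm q v = (let I = (\<integral>\<^sup>+x. ennreal (norm (v x) powr enn2real q) \<partial>lborel)
           in if I = \<infinity> then \<infinity> else ennreal (enn2real I powr (1 / enn2real q)))"
  using assms by (simp add: Lp_norm_def nn_integral_completion)

lemma Lp_norm_cong_AE:
  assumes "u \<in> borel_measurable lebesgue" "v \<in> borel_measurable lebesgue" and ae: "AE x in lborel. u x = v x"
  shows "Lp_norm q u = Lp_norm q v"
proof (cases "q = \<infinity>")
  case True
  have "Lp_norm \<infinity> u \<le> z \<longleftrightarrow> Lp_norm \<infinity> v \<le> z" for z
    using ae unfolding Lp_norm_top_le_iff[OF assms(1)] Lp_norm_top_le_iff[OF assms(2)]
    by (intro eventually_subst) (auto elim: eventually_mono)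
  then show ?thesis using True by (metis order_antisym order_refl)
next
  case False
  have "(\<integral>\<^sup>+x. ennreal (norm (u x) powr enn2real q) \<partial>lborel) = (\<integral>\<^sup>+x. ennreal (norm (v x) powr enn2real q) \<partial>lborel)"
    using ae by (intro nn_integral_cong_AE) (auto elim: eventually_mono)
  then show ?thesis by (simp only: Lp_norm_fin[OF False])
qed

text \<open>Separates the endpoint pair, where the supremum norm enters, from the range where
  Young's inequality applies to real exponents. The value \<open>q = 0\<close> is excluded because
  \<open>1 / 0\<close> is infinite in \<open>ennreal\<close>.\<close>

lemma conjugate_exponents:
  fixes p q :: ennreal
  assumes "1 \<le> p" "p \<noteq> \<infinity>" "1 / p + 1 / q = 1"
  shows "(p = 1 \<and> q = \<infinity>) \<or>
    (q \<noteq> \<infinity> \<and> enn2real p > 1 \<and> enn2real q > 1 \<and> 1 / enn2real p + 1 / enn2real q = 1)"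
proof -
  define a where "a = enn2real p"
  have p: "p = ennreal a" using assms(2) by (simp add: a_def ennreal_enn2real_if)
  have a: "a \<ge> 1" using assms(1) unfolding p by (cases "a \<ge> 0") (auto simp: ennreal_neg)
  have pa: "1 / p = ennreal (1 / a)" unfolding p using divide_ennreal[of 1 a] a by simp
  show ?thesis
  proof (cases "q = \<infinity>")
    case True
    then have "ennreal (1 / a) = 1" using assms(3) pa by simp
    then have "a = 1" using a by (simp add: ennreal_eq_1)
    then show ?thesis using True p by simp
  next
    case False
    define b where "b = enn2real q"
    have q: "q = ennreal b" using False by (simp add: b_def ennreal_enn2real_if)
    have "b > 0"
    proof (rule ccontr)
      assume "\<not> b > 0"
      then have "q = 0" unfolding q by (simp add: ennreal_neg)
      then show False using assms(3) by simp
    qed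
    then have "1 / q = ennreal (1 / b)" unfolding q using divide_ennreal[of 1 b] by simp
    then have "ennreal (1 / a + 1 / b) = 1" using assms(3) pa a \<open>b > 0\<close> by (simp add: ennreal_plus[symmetric] del: ennreal_plus)
    then have ab: "1 / a + 1 / b = 1" by (simp only: ennreal_eq_1)
    have "1 / b > 0" "1 / a > 0" using a \<open>b > 0\<close> by auto
    with ab have "1 / a < 1" "1 / b < 1" by linarith+
    then have "a > 1" "b > 1" using a \<open>b > 0\<close> by (auto simp: field_simps)
    then show ?thesis using ab False by (simp add: a_def b_def)
  qed
qed

lemma Lp_norm_one: "Lp_norm 1 v = (\<integral>\<^sup>+x. ennreal (norm (v x)) \<partial>lborel)"
  by (simp add: Lp_norm_fin Let_def ennreal_enn2real_if)

text \<open>Young's inequality for the functions divided by their norms. Vanishing and infinite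
  norms are split off beforehand, since this normalisation needs positive finite numbers.\<close>

theorem Holder_Lp_norm:
  fixes u v :: "real^'n \<Rightarrow> real"
  assumes pq: "1 \<le> p" "p \<noteq> \<infinity>" "1 / p + 1 / q = 1"
    and u[measurable]: "u \<in> borel_measurable borel" and v[measurable]: "v \<in> borel_measurable borel"
  shows "(\<integral>\<^sup>+x. ennreal (\<bar>u x\<bar> * \<bar>v x\<bar>) \<partial>lborel) \<le> Lp_norm p u * Lp_norm q v"
proof -
  have vl: "v \<in> borel_measurable lebesgue" by (simp add: measurable_completion)
  consider "p = 1" "q = \<infinity>" | "q \<noteq> \<infinity>" "enn2real p > 1" "enn2real q > 1" "1 / enn2real p + 1 / enn2real q = 1"
    using conjugate_exponents[OF pq] by auto
  then show ?thesis
  proof cases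
    case 1
    have "AE x in lborel. ennreal (norm (v x)) \<le> Lp_norm \<infinity> v"
      using Lp_norm_top_le_iff[OF vl, of "Lp_norm \<infinity> v"] by simp
    then have "AE x in lborel. ennreal (\<bar>u x\<bar> * \<bar>v x\<bar>) \<le> ennreal (norm (u x)) * Lp_norm \<infinity> v"
      by eventually_elim (simp add: ennreal_mult mult_left_mono)
    then have "(\<integral>\<^sup>+x. ennreal (\<bar>u x\<bar> * \<bar>v x\<bar>) \<partial>lborel) \<le> (\<integral>\<^sup>+x. ennreal (norm (u x)) * Lp_norm \<infinity> v \<partial>lborel)"
      by (rule nn_integral_mono_AE)
    also have "\<dots> = Lp_norm 1 u * Lp_norm \<infinity> v"
      unfolding Lp_norm_one by (rule nn_integral_multc) measurable
    finally show ?thesis using 1 by simp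
  next
    case 2
    define a b where "a = enn2real p" and "b = enn2real q"
    have ab: "a > 1" "b > 1" "1 / a + 1 / b = 1" using 2 by (auto simp: a_def b_def)
    define I J where "I = (\<integral>\<^sup>+x. ennreal (norm (u x) powr a) \<partial>lborel)"
      and "J = (\<integral>\<^sup>+x. ennreal (norm (v x) powr b) \<partial>lborel)"
    have Lu: "Lp_norm p u = (if I = \<infinity> then \<infinity> else ennreal (enn2real I powr (1 / a)))"
      using pq(2) by (simp add: Lp_norm_fin I_def a_def)
    have Lv: "Lp_norm q v = (if J = \<infinity> then \<infinity> else ennreal (enn2real J powr (1 / b)))"
      using 2(1) by (simp add: Lp_norm_fin J_def b_def)
    show ?thesis
    proof (cases "I = 0 \<or> J = 0")
      case True
      have "AE x in lborel. u x = 0 \<or> v x = 0"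
      proof (cases "I = 0")
        case True
        then have "AE x in lborel. ennreal (norm (u x) powr a) = 0"
          unfolding I_def by (subst (asm) nn_integral_0_iff_AE) auto
        then show ?thesis by eventually_elim simp
      next
        case False
        then have "J = 0" using True by simp
        then have "AE x in lborel. ennreal (norm (v x) powr b) = 0"
          unfolding J_def by (subst (asm) nn_integral_0_iff_AE) auto
        then show ?thesis by eventually_elim simp
      qed
      then have "(\<integral>\<^sup>+x. ennreal (\<bar>u x\<bar> * \<bar>v x\<bar>) \<partial>lborel) = 0"
        by (subst nn_integral_0_iff_AE) (auto elim: eventually_mono)
      then show ?thesis by simp
    next
      case IJ0: False
      show ?thesis
      proof (cases "I = \<infinity> \<or> J = \<infinity>")
        case True
        \<comment> \<open>The product of 0 and infinity is 0 in \<open>ennreal\<close>, so an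
          infinite factor helps only once the other one is known not to vanish.\<close>
        have "Lp_norm p u \<noteq> 0" "Lp_norm q v \<noteq> 0"
          using IJ0 unfolding Lu Lv by (auto simp: enn2real_eq_0_iff)
        moreover have "Lp_norm p u = \<infinity> \<or> Lp_norm q v = \<infinity>" using True unfolding Lu Lv by auto
        ultimately have "Lp_norm p u * Lp_norm q v = \<infinity>" by (auto simp: ennreal_mult_eq_top_iff)
        then show ?thesis by simp
      next
        case fin: False
        define i j where "i = enn2real I" and "j = enn2real J"
        have I: "I = ennreal i" "i > 0" and J: "J = ennreal j" "j > 0"
          using IJ0 fin by (auto simp: i_def j_def enn2real_positive_iff less_top zero_less_iff_neq_zero)
        \<comment> \<open>These are the two norms; after division by them the terms of Young's
          inequality integrate to \<open>1 / a\<close> and \<open>1 / b\<close>, which add up to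
          1.\<close>
        define A B where "A = i powr (1 / a)" and "B = j powr (1 / b)"
        have AB: "A > 0" "B > 0" using I J by (auto simp: A_def B_def)
        have pw: "A powr a = i" "B powr b = j" using ab I J by (auto simp: A_def B_def powr_powr)
        have ptw: "\<bar>u x\<bar> * \<bar>v x\<bar> \<le> A * B / (a * i) * (norm (u x) powr a) + A * B / (b * j) * (norm (v x) powr b)" for x
        proof -
          have "(\<bar>u x\<bar> / A) * (\<bar>v x\<bar> / B) \<le> (\<bar>u x\<bar> / A) powr a / a + (\<bar>v x\<bar> / B) powr b / b"
            using ab AB by (intro Youngs_inequality) auto
          also have "\<dots> = (norm (u x) powr a) / (a * i) + (norm (v x) powr b) / (b * j)"
            using AB by (simp add: powr_divide pw mult.commute)
          finally have "(\<bar>u x\<bar> / A) * (\<bar>v x\<bar> / B) * (A * B) \<le> ((norm (u x) powr a) / (a * i) + (norm (v x) powr b) / (b * j)) * (A * B)"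
            using AB by (intro mult_right_mono) auto
          then show ?thesis using AB by (simp add: field_simps)
        qed
        define c d where "c = A * B / (a * i)" and "d = A * B / (b * j)"
        have cd: "c \<ge> 0" "d \<ge> 0" using AB ab I J by (auto simp: c_def d_def)
        have "(\<integral>\<^sup>+x. ennreal (\<bar>u x\<bar> * \<bar>v x\<bar>) \<partial>lborel)
          \<le> (\<integral>\<^sup>+x. ennreal c * ennreal (norm (u x) powr a) + ennreal d * ennreal (norm (v x) powr b) \<partial>lborel)"
        proof (rule nn_integral_mono)
          fix x
          have "ennreal (\<bar>u x\<bar> * \<bar>v x\<bar>) \<le> ennreal (c * norm (u x) powr a + d * norm (v x) powr b)"
            unfolding c_def d_def by (intro ennreal_leI ptw)
          also have "\<dots> = ennreal c * ennreal (norm (u x) powr a) + ennreal d * ennreal (norm (v x) powr b)"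
            using cd by (simp add: ennreal_mult)
          finally show "ennreal (\<bar>u x\<bar> * \<bar>v x\<bar>)
            \<le> ennreal c * ennreal (norm (u x) powr a) + ennreal d * ennreal (norm (v x) powr b)" .
        qed
        also have "\<dots> = ennreal c * I + ennreal d * J"
          unfolding I_def J_def by (simp add: nn_integral_add nn_integral_cmult)
        also have "\<dots> = ennreal (c * i + d * j)"
          using I J cd by (simp add: ennreal_mult[symmetric] ennreal_plus[symmetric] del: ennreal_plus)
        also have "c * i + d * j = A * B * (1 / a + 1 / b)"
          using I J by (simp add: c_def d_def distrib_left)
        also have "\<dots> = A * B" using ab by simp
        also have "ennreal (A * B) = Lp_norm p u * Lp_norm q v"
          using fin AB unfolding Lu Lv by (simp add: A_def B_def i_def j_def ennreal_mult)
        finally show ?thesis .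
      qed
    qed
  qed
qed

text \<open>For \<open>q = \<infinity>\<close> the factor below is \<open>1\<close>, since \<open>enn2real \<infinity> = 0\<close> and \<open>1 / 0 = 0\<close>.\<close>

lemma Lp_norm_transform:
  fixes T :: "real^'n \<Rightarrow> real^'n" and v :: "real^'n \<Rightarrow> real"
  assumes [measurable]: "T \<in> borel_measurable borel" "v \<in> borel_measurable borel" and K: "K > 0"
    and T: "\<And>F :: real^'n \<Rightarrow> ennreal. F \<in> borel_measurable borel \<Longrightarrow>
      (\<integral>\<^sup>+x. F (T x) \<partial>lborel) = ennreal K * (\<integral>\<^sup>+x. F x \<partial>lborel)"
  shows "Lp_norm q (\<lambda>x. v (T x)) = ennreal (K powr (1 / enn2real q)) * Lp_norm q v"
proof (cases "q = \<infinity>")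
  case True
  have m: "v \<in> borel_measurable lebesgue" "(\<lambda>x. v (T x)) \<in> borel_measurable lebesgue"
    by (auto intro!: measurable_completion)
  have AE: "(AE x in lborel. P (T x)) \<longleftrightarrow> (AE x in lborel. P x)" if [measurable]: "Measurable.pred borel P" for P
  proof -
    have "(AE x in lborel. P (T x)) \<longleftrightarrow> (\<integral>\<^sup>+x. indicator {x. \<not> P x} (T x) \<partial>lborel) = 0"
      by (subst nn_integral_0_iff_AE) (auto simp: indicator_def intro!: eventually_cong)
    also have "\<dots> \<longleftrightarrow> (\<integral>\<^sup>+x. indicator {x. \<not> P x} x \<partial>lborel) = 0"
      using K by (subst T) auto
    also have "\<dots> \<longleftrightarrow> (AE x in lborel. P x)"
      by (subst nn_integral_0_iff_AE) (auto simp: indicator_def intro!: eventually_cong)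
    finally show ?thesis .
  qed
  have "Lp_norm \<infinity> (\<lambda>x. v (T x)) \<le> z \<longleftrightarrow> Lp_norm \<infinity> v \<le> z" for z
    unfolding Lp_norm_top_le_iff[OF m(1)] Lp_norm_top_le_iff[OF m(2)] by (rule AE) measurable
  then have "Lp_norm \<infinity> (\<lambda>x. v (T x)) = Lp_norm \<infinity> v" by (metis order_antisym order_refl)
  then show ?thesis using True K by simp
next
  case False
  define I where "I = (\<integral>\<^sup>+x. ennreal (norm (v x) powr enn2real q) \<partial>lborel)"
  have "(\<integral>\<^sup>+x. ennreal (norm (v (T x)) powr enn2real q) \<partial>lborel) = ennreal K * I"
    unfolding I_def by (rule T) measurable
  moreover have "ennreal K * I = \<infinity> \<longleftrightarrow> I = \<infinity>" using K by (auto simp: ennreal_mult_eq_top_iff)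
  ultimately show ?thesis
    unfolding Lp_norm_fin[OF False] Let_def I_def[symmetric]
    using K by (cases "I = \<infinity>") (auto simp: ennreal_mult_top enn2real_mult powr_mult ennreal_mult)
qed

section \<open>Translation and measurability of the norm, scaling of the Besov seminorm\<close>

lemma Lp_norm_shift:
  fixes v :: "real^'n \<Rightarrow> real"
  assumes [measurable]: "v \<in> borel_measurable borel"
  shows "Lp_norm q (\<lambda>x. v (c + x)) = Lp_norm q v"
  using Lp_norm_transform[of "\<lambda>x. c + x" v 1 q] by (simp add: nn_integral_lborel_shift)

text \<open>Makes the norm of an increment a legitimate integrand in the variable \<open>h\<close>,
  as the scaling law and the Tonelli argument demand.\<close>

lemma borel_measurable_Lp_norm:
  fixes G :: "'a \<Rightarrow> real^'n \<Rightarrow> real"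
  assumes [measurable]: "case_prod G \<in> borel_measurable (M \<Otimes>\<^sub>M borel)"
  shows "(\<lambda>h. Lp_norm q (G h)) \<in> borel_measurable M"
proof (cases "q = \<infinity>")
  case True
  show ?thesis unfolding True
  proof (rule borel_measurableI_le)
    fix z
    \<comment> \<open>An essential bound is the vanishing of the integral of an indicator, and such
      an integral depends measurably on \<open>h\<close>.\<close>
    have "Lp_norm \<infinity> (G h) \<le> z \<longleftrightarrow> (\<integral>\<^sup>+x. (if ennreal \<bar>G h x\<bar> \<le> z then 0 else 1) \<partial>lborel) = (0 :: ennreal)" if h: "h \<in> space M" for h
    proof -
      have Gm: "G h \<in> borel_measurable borel" using h by measurable
      then have "Lp_norm \<infinity> (G h) \<le> z \<longleftrightarrow> (AE x in lborel. ennreal (norm (G h x)) \<le> z)"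
        by (intro Lp_norm_top_le_iff measurable_completion) simp
      also have "\<dots> \<longleftrightarrow> (\<integral>\<^sup>+x. (if ennreal \<bar>G h x\<bar> \<le> z then 0 else 1) \<partial>lborel) = (0 :: ennreal)"
        using Gm by (subst nn_integral_0_iff_AE) (auto intro!: eventually_cong)
      finally show ?thesis .
    qed
    then have "{h \<in> space M. Lp_norm \<infinity> (G h) \<le> z}
      = {h \<in> space M. (\<integral>\<^sup>+x. (if ennreal \<bar>G h x\<bar> \<le> z then 0 else 1) \<partial>lborel) = (0 :: ennreal)}"
      by blast
    also have "\<dots> \<in> sets M" by measurable
    finally show "{h \<in> space M. Lp_norm \<infinity> (G h) \<le> z} \<in> sets M" .
  qed
next
  case False
  show ?thesis unfolding Lp_norm_fin[OF False] Let_def by measurable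
qed

lemma borel_measurable_Lp_norm_diff:
  fixes v :: "real^'n \<Rightarrow> real"
  assumes [measurable]: "v \<in> borel_measurable borel"
  shows "(\<lambda>h. Lp_norm q (\<lambda>x. v (x + h) - v x)) \<in> borel_measurable borel"
  by (rule borel_measurable_Lp_norm[where M=borel]) measurable

text \<open>At the origin \<open>inverse 0\<close> is infinite in \<open>ennreal\<close> while
  \<open>1 / 0\<close> is 0 in the reals; being a null set, the origin is discarded.\<close>

lemma besov_seminorm_lborel:
  fixes v :: "real^'n \<Rightarrow> real"
  shows "besov_seminorm \<alpha> q v
    = (\<integral>\<^sup>+h. Lp_norm q (\<lambda>x. v (x + h) - v x) * ennreal (1 / norm h powr (real CARD('n) + \<alpha>)) \<partial>lborel)"
  unfolding besov_seminorm_def nn_integral_completion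
proof (rule nn_integral_cong_AE)
  have "AE h in lborel. (h::real^'n) \<noteq> 0" by (rule AE_lborel_singleton)
  then show "AE h in lborel. Lp_norm q (\<lambda>x. v (x + h) - v x) / ennreal (norm h powr (real CARD('n) + \<alpha>))
      = Lp_norm q (\<lambda>x. v (x + h) - v x) * ennreal (1 / norm (h::real^'n) powr (real CARD('n) + \<alpha>))"
    by eventually_elim (simp add: divide_ennreal_def inverse_ennreal inverse_eq_divide)
qed

text \<open>The norm of a dilated increment contributes R^(N/q), the kernel R^(-N-\<alpha>), and the
  substitution in \<open>h\<close> a factor R^N. For \<open>q = \<infinity>\<close> the first
  exponent is 0 through \<open>enn2real \<infinity> = 0\<close>.\<close>

lemma besov_seminorm_scale:
  fixes v :: "real^'n \<Rightarrow> real"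
  assumes [measurable]: "v \<in> borel_measurable borel" and R: "R > 0"
  shows "besov_seminorm \<alpha> q (\<lambda>x. v (x /\<^sub>R R))
    = ennreal (R powr (real CARD('n) / enn2real q - \<alpha>)) * besov_seminorm \<alpha> q v"
proof -
  define N where "N = real CARD('n)"
  define \<Phi> where "\<Phi> h = Lp_norm q (\<lambda>x. v (x + h) - v x)" for h :: "real^'n"
  have [measurable]: "\<Phi> \<in> borel_measurable borel"
    unfolding \<Phi>_def by (rule borel_measurable_Lp_norm_diff) measurable
  have 1: "Lp_norm q (\<lambda>x. v ((x + h) /\<^sub>R R) - v (x /\<^sub>R R)) = ennreal (R powr (N / enn2real q)) * \<Phi> (h /\<^sub>R R)" for h
  proof -
    have "Lp_norm q (\<lambda>x. (\<lambda>y. v (y + h /\<^sub>R R) - v y) (x /\<^sub>R R))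
      = ennreal ((R ^ CARD('n)) powr (1 / enn2real q)) * \<Phi> (h /\<^sub>R R)"
      unfolding \<Phi>_def by (rule Lp_norm_transform) (use R in \<open>auto simp: nn_integral_lborel_scale\<close>)
    also have "(R ^ CARD('n)) powr (1 / enn2real q) = R powr (N / enn2real q)"
      using R by (simp add: N_def powr_realpow[symmetric] powr_powr)
    finally show ?thesis by (simp add: scaleR_add_right)
  qed
  have 2: "1 / norm h powr (N + \<alpha>) = R powr (- N - \<alpha>) * (1 / norm (h /\<^sub>R R) powr (N + \<alpha>))" for h :: "real^'n"
  proof -
    have "norm h = R * norm (h /\<^sub>R R)" using R by simp
    then have "norm h powr (N + \<alpha>) = R powr (N + \<alpha>) * norm (h /\<^sub>R R) powr (N + \<alpha>)"
      using R by (metis less_imp_le norm_ge_zero powr_mult)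
    moreover have "R powr (- N - \<alpha>) = 1 / R powr (N + \<alpha>)"
      by (simp add: powr_minus_divide[symmetric])
    ultimately show ?thesis by simp
  qed
  define \<Psi> where "\<Psi> h = \<Phi> h * ennreal (1 / norm h powr (N + \<alpha>))" for h
  have "besov_seminorm \<alpha> q (\<lambda>x. v (x /\<^sub>R R))
    = (\<integral>\<^sup>+h. ennreal (R powr (N / enn2real q) * R powr (- N - \<alpha>)) * \<Psi> (h /\<^sub>R R) \<partial>lborel)"
    unfolding besov_seminorm_lborel 1 N_def[symmetric] \<Psi>_def
  proof (rule nn_integral_cong)
    fix h :: "real^'n"
    have "ennreal (1 / norm h powr (N + \<alpha>)) = ennreal (R powr (- N - \<alpha>)) * ennreal (1 / norm (h /\<^sub>R R) powr (N + \<alpha>))"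
      by (subst 2, rule ennreal_mult) auto
    then show "ennreal (R powr (N / enn2real q)) * \<Phi> (h /\<^sub>R R) * ennreal (1 / norm h powr (N + \<alpha>))
      = ennreal (R powr (N / enn2real q) * R powr (- N - \<alpha>)) * (\<Phi> (h /\<^sub>R R) * ennreal (1 / norm (h /\<^sub>R R) powr (N + \<alpha>)))"
      by (simp only: ennreal_mult powr_ge_zero mult_ac)
  qed
  also have "\<dots> = ennreal (R powr (N / enn2real q) * R powr (- N - \<alpha>)) * (\<integral>\<^sup>+h. \<Psi> (h /\<^sub>R R) \<partial>lborel)"
    unfolding \<Psi>_def by (rule nn_integral_cmult) measurable
  also have "(\<integral>\<^sup>+h. \<Psi> (h /\<^sub>R R) \<partial>lborel) = ennreal (R ^ CARD('n)) * (\<integral>\<^sup>+h. \<Psi> h \<partial>lborel)"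
    unfolding \<Psi>_def using R by (subst nn_integral_lborel_scale[where F="\<lambda>h. \<Phi> h * ennreal (1 / norm h powr (N + \<alpha>))"]) auto
  also have "ennreal (R powr (N / enn2real q) * R powr (- N - \<alpha>)) * (ennreal (R ^ CARD('n)) * (\<integral>\<^sup>+h. \<Psi> h \<partial>lborel))
     = ennreal (R powr (N / enn2real q - \<alpha>)) * (\<integral>\<^sup>+h. \<Psi> h \<partial>lborel)"
  proof -
    have "R powr (N / enn2real q) * R powr (- N - \<alpha>) * R ^ CARD('n) = R powr (N / enn2real q - \<alpha>)"
      using R by (simp add: N_def powr_realpow[symmetric] powr_add[symmetric])
    then show ?thesis using R by (simp add: mult.assoc[symmetric] ennreal_mult[symmetric])
  qed
  finally show ?thesis unfolding besov_seminorm_lborel \<Psi>_def \<Phi>_def N_def .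
qed

section \<open>Mollification\<close>

definition mollify :: "('a::euclidean_space \<Rightarrow> real) \<Rightarrow> ('a \<Rightarrow> real) \<Rightarrow> 'a \<Rightarrow> real" where
  "mollify \<rho> v x = (LINT z|lborel. \<rho> (x - z) * v z)"

text \<open>The defining form passes the Lipschitz bound of \<rho> to the convolution; this form
  passes on bounds, continuity and increments of \<open>v\<close>.\<close>

lemma mollify_commute:
  fixes \<rho> :: "'a::euclidean_space \<Rightarrow> real"
  assumes [measurable]: "\<rho> \<in> borel_measurable borel" "v \<in> borel_measurable borel"
  shows "mollify \<rho> v x = (LINT z|lborel. \<rho> z * v (x - z))"
proof -
  have "orthogonal_transformation (\<lambda>z::'a. - z)"
    by (simp add: orthogonal_transformation_neg)
  from integral_lborel_orthogonal[OF this, of "\<lambda>z. \<rho> (x - (x + z)) * v (x + z)"]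
  have "(LINT z|lborel. \<rho> z * v (x - z)) = (LINT z|lborel. \<rho> (x - (x + z)) * v (x + z))" by simp
  also have "\<dots> = mollify \<rho> v x"
    unfolding mollify_def by (rule integral_lborel_shift) measurable
  finally show ?thesis by simp
qed

text \<open>Normalised tents: their Lipschitz regularity is what membership of the test field in
  \<open>lip_c\<close> asks for.\<close>

lemma mollifier_exists:
  obtains \<rho> :: "nat \<Rightarrow> 'a::euclidean_space \<Rightarrow> real" where
    "\<And>k z. \<rho> k z \<ge> 0" "\<And>k. \<exists>L. L-lipschitz_on UNIV (\<rho> k)" "\<And>k. \<exists>B. \<forall>z. \<bar>\<rho> k z\<bar> \<le> B"
    "\<And>k z. norm z \<ge> 1 / real (Suc k) \<Longrightarrow> \<rho> k z = 0"
    "\<And>k. integrable lborel (\<rho> k)" "\<And>k. (LINT z|lborel. \<rho> k z) = 1"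
proof -
  define \<tau> where "\<tau> k z = max 0 (1 - real (Suc k) * norm z)" for k and z :: 'a
  define c where "c k = (LINT z|lborel. \<tau> k z)" for k
  have m[measurable]: "\<tau> k \<in> borel_measurable borel" for k unfolding \<tau>_def by measurable
  have b: "0 \<le> \<tau> k z" "\<tau> k z \<le> 1" for k z by (auto simp: \<tau>_def)
  have supp: "\<tau> k z = 0" if "norm z \<ge> 1 / real (Suc k)" for k z
    using that by (simp add: \<tau>_def field_simps)
  have int: "integrable lborel (\<tau> k)" for k
  proof (rule Bochner_Integration.integrable_bound)
    show "integrable lborel (\<lambda>z. indicator (cball (0::'a) 1) z :: real)"
      using emeasure_bounded_finite[of "cball (0::'a) 1"] by (intro integrable_real_indicator) auto
    have "\<tau> k z = 0" if "norm z > 1" for z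
    proof (rule supp)
      have "1 / real (Suc k) \<le> 1" by simp
      then show "1 / real (Suc k) \<le> norm z" using that by linarith
    qed
    then show "AE z in lborel. norm (\<tau> k z) \<le> norm (indicator (cball (0::'a) 1) z :: real)"
      using b by (intro AE_I2) (auto simp: indicator_def not_le)
  qed simp
  have c: "c k > 0" for k
  proof -
    \<comment> \<open>On the ball of half the support radius the tent is at least
      \<open>1 / 2\<close>, and this ball has positive volume.\<close>
    define r where "r = 1 / (2 * real (Suc k))"
    have r: "r > 0" by (simp add: r_def)
    have fin: "emeasure lborel (ball (0::'a) r) < \<infinity>" by (intro emeasure_bounded_finite) auto
    have "0 < 1 / 2 * measure lborel (ball (0::'a) r)" using content_ball_pos[OF r] by simp
    also have "\<dots> = (LINT z|lborel. 1 / 2 * indicator (ball (0::'a) r) z)" by simp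
    also have "\<dots> \<le> c k" unfolding c_def
    proof (rule integral_mono[OF _ int])
      show "integrable lborel (\<lambda>z. 1 / 2 * indicator (ball (0::'a) r) z :: real)"
        using fin by (intro integrable_mult_right integrable_real_indicator) auto
      show "1 / 2 * indicator (ball (0::'a) r) z \<le> \<tau> k z" for z
        using b by (auto simp: indicator_def r_def \<tau>_def field_simps)
    qed
    finally show ?thesis .
  qed
  show thesis
  proof (rule that[of "\<lambda>k z. \<tau> k z / c k"])
    show "\<tau> k z / c k \<ge> 0" for k z using b[of k z] c[of k] by simp
    show "\<exists>L. L-lipschitz_on UNIV (\<lambda>z. \<tau> k z / c k)" for k
    proof (intro exI lipschitz_onI)
      fix y z :: 'a
      have "\<bar>\<tau> k y - \<tau> k z\<bar> \<le> real (Suc k) * \<bar>norm y - norm z\<bar>"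
      proof -
        have "\<bar>max 0 a - max 0 b\<bar> \<le> \<bar>a - b\<bar>" for a b :: real by linarith
        from this[of "1 - real (Suc k) * norm y" "1 - real (Suc k) * norm z"]
        show ?thesis unfolding \<tau>_def by (simp add: right_diff_distrib[symmetric] abs_mult abs_minus_commute del: of_nat_Suc)
      qed
      also have "\<dots> \<le> real (Suc k) * dist y z"
        by (intro mult_left_mono) (auto simp: dist_norm norm_triangle_ineq3)
      finally show "dist (\<tau> k y / c k) (\<tau> k z / c k) \<le> real (Suc k) / c k * dist y z"
        using c[of k] by (simp add: dist_real_def diff_divide_distrib[symmetric] divide_right_mono del: of_nat_Suc)
    qed (use c[of k] in auto)
    show "\<exists>B. \<forall>z. \<bar>\<tau> k z / c k\<bar> \<le> B" for k
      using b c[of k] by (intro exI[of _ "1 / c k"]) (auto simp: abs_mult divide_right_mono)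
    show "integrable lborel (\<lambda>z. \<tau> k z / c k)" for k using int by auto
    show "(LINT z|lborel. \<tau> k z / c k) = 1" for k using c[of k] by (simp add: c_def)
  qed (simp add: supp)
qed

context
  fixes \<rho> v :: "'a::euclidean_space \<Rightarrow> real" and M :: real
  assumes \<rho>_m[measurable]: "\<rho> \<in> borel_measurable borel" and v_m[measurable]: "v \<in> borel_measurable borel"
    and \<rho>_nonneg: "\<And>z. \<rho> z \<ge> 0" and \<rho>_int: "integrable lborel \<rho>" and \<rho>_1: "(LINT z|lborel. \<rho> z) = 1"
    and v_bound: "\<And>x. \<bar>v x\<bar> \<le> M"
begin

lemma integrable_mollify_aux: "integrable lborel (\<lambda>z. \<rho> z * v (x - z))"
proof (rule Bochner_Integration.integrable_bound)
  show "integrable lborel (\<lambda>z. \<rho> z * M)" using \<rho>_int by simp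
  show "AE z in lborel. norm (\<rho> z * v (x - z)) \<le> norm (\<rho> z * M)"
    using v_bound \<rho>_nonneg order_trans[OF v_bound abs_ge_self]
    by (intro AE_I2) (auto simp: abs_mult intro!: mult_left_mono)
qed measurable

lemma mollify_bound: "\<bar>mollify \<rho> v x\<bar> \<le> M"
proof -
  have "\<bar>mollify \<rho> v x\<bar> \<le> (LINT z|lborel. \<rho> z * M)"
    unfolding mollify_commute[OF \<rho>_m v_m] real_norm_def[symmetric]
    by (rule Bochner_Integration.integral_norm_bound_integral[OF integrable_mollify_aux])
      (use \<rho>_int \<rho>_nonneg v_bound in \<open>auto simp: abs_mult intro!: mult_left_mono\<close>)
  then show ?thesis using \<rho>_1 by simp
qed

lemma mollify_diff_bound:
  assumes "\<And>z. \<rho> z \<noteq> 0 \<Longrightarrow> \<bar>v (x - z) - v x\<bar> \<le> e"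
  shows "\<bar>mollify \<rho> v x - v x\<bar> \<le> e"
proof -
  have "mollify \<rho> v x - v x = (LINT z|lborel. \<rho> z * v (x - z)) - (LINT z|lborel. \<rho> z * v x)"
    unfolding mollify_commute[OF \<rho>_m v_m] using \<rho>_1 by simp
  also have "\<dots> = (LINT z|lborel. \<rho> z * v (x - z) - \<rho> z * v x)"
    using \<rho>_int by (intro Bochner_Integration.integral_diff[symmetric] integrable_mollify_aux) auto
  finally have eq: "mollify \<rho> v x - v x = (LINT z|lborel. \<rho> z * v (x - z) - \<rho> z * v x)" .
  have "norm (LINT z|lborel. \<rho> z * v (x - z) - \<rho> z * v x) \<le> (LINT z|lborel. \<rho> z * e)"
  proof (rule Bochner_Integration.integral_norm_bound_integral)
    show "integrable lborel (\<lambda>z. \<rho> z * v (x - z) - \<rho> z * v x)"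
      using \<rho>_int by (intro Bochner_Integration.integrable_diff integrable_mollify_aux) auto
    show "norm (\<rho> z * v (x - z) - \<rho> z * v x) \<le> \<rho> z * e" for z
      using assms[of z] \<rho>_nonneg[of z]
      by (cases "\<rho> z = 0") (auto simp: right_diff_distrib[symmetric] abs_mult intro!: mult_left_mono)
  qed (use \<rho>_int in auto)
  then show ?thesis using \<rho>_1 eq by simp
qed

lemma mollify_increment_bound:
  "ennreal \<bar>mollify \<rho> v (x + h) - mollify \<rho> v x\<bar> \<le> (\<integral>\<^sup>+z. ennreal (\<rho> z) * ennreal \<bar>v (x - z + h) - v (x - z)\<bar> \<partial>lborel)"
proof -
  have "mollify \<rho> v (x + h) - mollify \<rho> v x = (LINT z|lborel. \<rho> z * v (x + h - z) - \<rho> z * v (x - z))"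
    unfolding mollify_commute[OF \<rho>_m v_m]
    by (intro Bochner_Integration.integral_diff[symmetric] integrable_mollify_aux)
  moreover have "ennreal (norm (LINT z|lborel. \<rho> z * v (x + h - z) - \<rho> z * v (x - z)))
      \<le> (\<integral>\<^sup>+z. ennreal (norm (\<rho> z * v (x + h - z) - \<rho> z * v (x - z))) \<partial>lborel)"
    by (intro integral_norm_bound_ennreal Bochner_Integration.integrable_diff integrable_mollify_aux)
  moreover have "ennreal (norm (\<rho> z * v (x + h - z) - \<rho> z * v (x - z)))
      = ennreal (\<rho> z) * ennreal \<bar>v (x - z + h) - v (x - z)\<bar>" for z
    using \<rho>_nonneg[of z]
    by (simp add: ennreal_mult[symmetric] right_diff_distrib[symmetric] abs_mult add_diff_eq diff_add_eq)
  ultimately show ?thesis by simp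
qed

end

text \<open>The constant inherits that of \<rho> and is not uniform along a mollifying sequence, so
  it serves to admit the test field and to ensure convergence of integrals, not to estimate
  limits.\<close>

lemma mollify_lipschitz:
  fixes \<rho> :: "'a::euclidean_space \<Rightarrow> real"
  assumes \<rho>: "L-lipschitz_on UNIV \<rho>" and v: "integrable lborel v" and bnd: "\<And>z. \<bar>\<rho> z\<bar> \<le> B"
  shows "(L * (LINT z|lborel. \<bar>v z\<bar>))-lipschitz_on UNIV (mollify \<rho> v)"
proof (rule lipschitz_onI)
  have L: "L \<ge> 0" using \<rho> by (rule lipschitz_on_nonneg)
  then show "0 \<le> L * (LINT z|lborel. \<bar>v z\<bar>)" by simp
  have [measurable]: "\<rho> \<in> borel_measurable borel"
    using lipschitz_on_continuous_on[OF \<rho>] by (rule borel_measurable_continuous_onI)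
  have [measurable]: "v \<in> borel_measurable borel" using v by (simp add: borel_measurable_integrable)
  have int: "integrable lborel (\<lambda>z. \<rho> (x - z) * v z)" for x
  proof (rule Bochner_Integration.integrable_bound)
    show "integrable lborel (\<lambda>z. B * v z)" using v by simp
    show "AE z in lborel. norm (\<rho> (x - z) * v z) \<le> norm (B * v z)"
      using order_trans[OF bnd abs_ge_self] by (intro AE_I2) (auto simp: abs_mult intro!: mult_right_mono)
  qed measurable
  fix x y :: 'a
  have "dist (mollify \<rho> v x) (mollify \<rho> v y) = norm (LINT z|lborel. \<rho> (x - z) * v z - \<rho> (y - z) * v z)"
    unfolding mollify_def dist_norm by (subst Bochner_Integration.integral_diff[OF int int]) simp
  also have "\<dots> \<le> (LINT z|lborel. L * dist x y * \<bar>v z\<bar>)"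
  proof (rule Bochner_Integration.integral_norm_bound_integral)
    show "norm (\<rho> (x - z) * v z - \<rho> (y - z) * v z) \<le> L * dist x y * \<bar>v z\<bar>" for z
      using lipschitz_onD[OF \<rho>, of "x - z" "y - z"]
      by (auto simp: left_diff_distrib[symmetric] abs_mult dist_real_def dist_norm intro!: mult_right_mono)
  qed (use v int in auto)
  also have "\<dots> = L * (LINT z|lborel. \<bar>v z\<bar>) * dist x y" by simp
  finally show "dist (mollify \<rho> v x) (mollify \<rho> v y) \<le> L * (LINT z|lborel. \<bar>v z\<bar>) * dist x y" .
qed

lemma mollify_eq_0:
  assumes "\<And>z. norm z \<ge> d \<Longrightarrow> \<rho> z = 0" "\<And>z. norm z \<ge> r \<Longrightarrow> v z = 0" "norm x \<ge> r + d"
  shows "mollify \<rho> v x = 0"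
proof -
  have "\<rho> (x - z) * v z = 0" for z
  proof (cases "norm z \<ge> r")
    case False
    then have "norm (x - z) \<ge> d" using assms(3) norm_triangle_ineq2[of x z] by linarith
    then show ?thesis using assms(1) by simp
  qed (simp add: assms(2))
  then show ?thesis unfolding mollify_def by (simp only: Bochner_Integration.integral_zero)
qed

text \<open>
  Moving the mollification onto \<open>h\<close>-increments and using translation invariance makes the bound
  independent of the mollifier.
\<close>

lemma mollify_besov_bound:
  fixes f v \<rho> :: "real^'n \<Rightarrow> real"
  assumes pq: "1 \<le> p" "p \<noteq> \<infinity>" "1 / p + 1 / q = 1"
    and f[measurable]: "f \<in> borel_measurable borel"
    and \<rho>_m[measurable]: "\<rho> \<in> borel_measurable borel" and v_m[measurable]: "v \<in> borel_measurable borel"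
    and \<rho>: "\<And>z. \<rho> z \<ge> 0" "integrable lborel \<rho>" "(LINT z|lborel. \<rho> z) = 1"
    and v: "\<And>x. \<bar>v x\<bar> \<le> M"
  shows "(\<integral>\<^sup>+x. ennreal \<bar>f x\<bar> *
      (\<integral>\<^sup>+h. ennreal (\<bar>mollify \<rho> v (x + h) - mollify \<rho> v x\<bar> / norm h powr (real CARD('n) + \<alpha>)) \<partial>lborel) \<partial>lborel)
    \<le> Lp_norm p f * besov_seminorm \<alpha> q v"
proof -
  define \<kappa> where "\<kappa> h = ennreal (1 / norm h powr (real CARD('n) + \<alpha>))" for h :: "real^'n"
  have [measurable]: "\<kappa> \<in> borel_measurable borel" unfolding \<kappa>_def by measurable
  \<comment> \<open>The full integrand in three variables. Integrating over \<open>x\<close> first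
    allows Holder's inequality at fixed \<open>h\<close> and \<open>z\<close>; the translation by
    \<open>z\<close> then disappears from the norm, and \<rho> integrates to 1.\<close>
  define F where "F x h z = ennreal \<bar>f x\<bar> * (\<kappa> h * (ennreal (\<rho> z) * ennreal \<bar>v (x - z + h) - v (x - z)\<bar>))" for x h z
  have ptw: "ennreal \<bar>f x\<bar> * (\<integral>\<^sup>+h. ennreal (\<bar>mollify \<rho> v (x + h) - mollify \<rho> v x\<bar> / norm h powr (real CARD('n) + \<alpha>)) \<partial>lborel)
     \<le> (\<integral>\<^sup>+h. (\<integral>\<^sup>+z. F x h z \<partial>lborel) \<partial>lborel)" for x
  proof -
    have "ennreal (\<bar>mollify \<rho> v (x + h) - mollify \<rho> v x\<bar> / norm h powr (real CARD('n) + \<alpha>))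
      \<le> \<kappa> h * (\<integral>\<^sup>+z. ennreal (\<rho> z) * ennreal \<bar>v (x - z + h) - v (x - z)\<bar> \<partial>lborel)" for h
    proof -
      have "ennreal (\<bar>mollify \<rho> v (x + h) - mollify \<rho> v x\<bar> / norm h powr (real CARD('n) + \<alpha>))
        = \<kappa> h * ennreal \<bar>mollify \<rho> v (x + h) - mollify \<rho> v x\<bar>"
        by (simp add: \<kappa>_def ennreal_mult[symmetric])
      then show ?thesis
        by (simp add: mult_left_mono mollify_increment_bound[OF \<rho>_m v_m \<rho> v])
    qed
    then have "(\<integral>\<^sup>+h. ennreal (\<bar>mollify \<rho> v (x + h) - mollify \<rho> v x\<bar> / norm h powr (real CARD('n) + \<alpha>)) \<partial>lborel)
      \<le> (\<integral>\<^sup>+h. \<kappa> h * (\<integral>\<^sup>+z. ennreal (\<rho> z) * ennreal \<bar>v (x - z + h) - v (x - z)\<bar> \<partial>lborel) \<partial>lborel)"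
      by (rule nn_integral_mono)
    then have "ennreal \<bar>f x\<bar> * (\<integral>\<^sup>+h. ennreal (\<bar>mollify \<rho> v (x + h) - mollify \<rho> v x\<bar> / norm h powr (real CARD('n) + \<alpha>)) \<partial>lborel)
      \<le> ennreal \<bar>f x\<bar> * (\<integral>\<^sup>+h. \<kappa> h * (\<integral>\<^sup>+z. ennreal (\<rho> z) * ennreal \<bar>v (x - z + h) - v (x - z)\<bar> \<partial>lborel) \<partial>lborel)"
      by (rule mult_left_mono) simp
    also have "\<dots> = (\<integral>\<^sup>+h. (\<integral>\<^sup>+z. F x h z \<partial>lborel) \<partial>lborel)"
      unfolding F_def by (simp add: nn_integral_cmult)
    finally show ?thesis .
  qed
  have inner: "(\<integral>\<^sup>+x. F x h z \<partial>lborel) \<le> \<kappa> h * (ennreal (\<rho> z) * (Lp_norm p f * Lp_norm q (\<lambda>x. v (x + h) - v x)))" for h z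
  proof -
    have "(\<integral>\<^sup>+x. F x h z \<partial>lborel) = (\<integral>\<^sup>+x. \<kappa> h * (ennreal (\<rho> z) * ennreal (\<bar>f x\<bar> * \<bar>v (x - z + h) - v (x - z)\<bar>)) \<partial>lborel)"
      by (intro nn_integral_cong) (simp add: F_def ennreal_mult mult_ac)
    also have "\<dots> = \<kappa> h * (ennreal (\<rho> z) * (\<integral>\<^sup>+x. ennreal (\<bar>f x\<bar> * \<bar>v (x - z + h) - v (x - z)\<bar>) \<partial>lborel))"
      by (simp add: nn_integral_cmult)
    also have "\<dots> \<le> \<kappa> h * (ennreal (\<rho> z) * (Lp_norm p f * Lp_norm q (\<lambda>x. v (x - z + h) - v (x - z))))"
      by (intro mult_left_mono Holder_Lp_norm pq) auto
    also have "Lp_norm q (\<lambda>x. v (x - z + h) - v (x - z)) = Lp_norm q (\<lambda>x. v (x + h) - v x)"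
      using Lp_norm_shift[of "\<lambda>x. v (x + h) - v x" q "- z"] by simp
    finally show ?thesis .
  qed
  have [measurable]: "(\<lambda>h. Lp_norm q (\<lambda>x. v (x + h) - v x)) \<in> borel_measurable borel"
    by (rule borel_measurable_Lp_norm_diff) measurable
  have "(\<integral>\<^sup>+x. ennreal \<bar>f x\<bar> *
      (\<integral>\<^sup>+h. ennreal (\<bar>mollify \<rho> v (x + h) - mollify \<rho> v x\<bar> / norm h powr (real CARD('n) + \<alpha>)) \<partial>lborel) \<partial>lborel)
    \<le> (\<integral>\<^sup>+x. (\<integral>\<^sup>+h. (\<integral>\<^sup>+z. F x h z \<partial>lborel) \<partial>lborel) \<partial>lborel)"
    by (intro nn_integral_mono ptw)
  also have "\<dots> = (\<integral>\<^sup>+h. (\<integral>\<^sup>+x. (\<integral>\<^sup>+z. F x h z \<partial>lborel) \<partial>lborel) \<partial>lborel)"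
    unfolding F_def by (rule lborel_pair.Fubini') measurable
  also have "\<dots> = (\<integral>\<^sup>+h. (\<integral>\<^sup>+z. (\<integral>\<^sup>+x. F x h z \<partial>lborel) \<partial>lborel) \<partial>lborel)"
    unfolding F_def by (intro nn_integral_cong lborel_pair.Fubini') measurable
  also have "\<dots> \<le> (\<integral>\<^sup>+h. (\<integral>\<^sup>+z. \<kappa> h * (ennreal (\<rho> z) * (Lp_norm p f * Lp_norm q (\<lambda>x. v (x + h) - v x))) \<partial>lborel) \<partial>lborel)"
    by (intro nn_integral_mono inner)
  also have "\<dots> = (\<integral>\<^sup>+h. Lp_norm p f * (Lp_norm q (\<lambda>x. v (x + h) - v x) * \<kappa> h) \<partial>lborel)"
  proof (rule nn_integral_cong)
    fix h
    have "(\<integral>\<^sup>+z. ennreal (\<rho> z) \<partial>lborel) = 1"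
      using \<rho> by (simp add: nn_integral_eq_integral)
    then show "(\<integral>\<^sup>+z. \<kappa> h * (ennreal (\<rho> z) * (Lp_norm p f * Lp_norm q (\<lambda>x. v (x + h) - v x))) \<partial>lborel)
       = Lp_norm p f * (Lp_norm q (\<lambda>x. v (x + h) - v x) * \<kappa> h)"
      by (simp add: nn_integral_cmult nn_integral_multc mult_ac)
  qed
  also have "\<dots> = Lp_norm p f * besov_seminorm \<alpha> q v"
    unfolding besov_seminorm_lborel \<kappa>_def[symmetric] by (rule nn_integral_cmult) measurable
  finally show ?thesis .
qed

section \<open>The fractional gradient of a half-space\<close>

text \<open>Cauchy-Schwarz gains one power of the norm of \<open>h\<close>, which lowers the
  exponent to that of the Besov kernel. At the origin both sides are 0.\<close>

lemma kernel_norm_le: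
  fixes h e :: "real^'n"
  shows "norm ((h \<bullet> e) * c / norm h powr (N + \<alpha> + 1)) \<le> norm e * (\<bar>c\<bar> / norm h powr (N + \<alpha>))"
proof (cases "h = 0")
  case False
  have "norm ((h \<bullet> e) * c / norm h powr (N + \<alpha> + 1)) = \<bar>h \<bullet> e\<bar> * (\<bar>c\<bar> / norm h powr (N + \<alpha> + 1))"
    by (simp add: abs_mult)
  also have "\<dots> \<le> (norm h * norm e) * (\<bar>c\<bar> / norm h powr (N + \<alpha> + 1))"
    by (intro mult_right_mono Cauchy_Schwarz_ineq2) auto
  also have "\<dots> = norm e * (\<bar>c\<bar> / norm h powr (N + \<alpha>))"
    using False by (simp add: powr_add)
  finally show ?thesis .
qed simp

lemma kernel_integrable:
  fixes e :: "real^'n" and w :: "real^'n \<Rightarrow> real"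
  assumes [measurable]: "w \<in> borel_measurable borel"
    and fin: "(\<integral>\<^sup>+h. ennreal (\<bar>w h\<bar> / norm h powr (real CARD('n) + \<alpha>)) \<partial>lborel) \<le> ennreal B" and "B \<ge> 0"
  shows "integrable lborel (\<lambda>h. (h \<bullet> e) * w h / norm h powr (real CARD('n) + \<alpha> + 1))" (is ?A)
    and "\<bar>LINT h|lborel. (h \<bullet> e) * w h / norm h powr (real CARD('n) + \<alpha> + 1)\<bar> \<le> norm e * B" (is ?B)
proof -
  let ?F = "\<lambda>h. (h \<bullet> e) * w h / norm h powr (real CARD('n) + \<alpha> + 1)"
  have ptw: "norm (?F h) \<le> norm e * (\<bar>w h\<bar> / norm h powr (real CARD('n) + \<alpha>))" for h :: "real^'n"
    by (rule kernel_norm_le)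
  have "(\<integral>\<^sup>+h. ennreal (norm (?F h)) \<partial>lborel)
    \<le> (\<integral>\<^sup>+h. ennreal (norm e) * ennreal (\<bar>w h\<bar> / norm h powr (real CARD('n) + \<alpha>)) \<partial>lborel)"
    using ptw by (intro nn_integral_mono) (simp add: ennreal_mult[symmetric] ennreal_leI)
  also have "\<dots> = ennreal (norm e) * (\<integral>\<^sup>+h. ennreal (\<bar>w h\<bar> / norm h powr (real CARD('n) + \<alpha>)) \<partial>lborel)"
    by (rule nn_integral_cmult) measurable
  also have "\<dots> \<le> ennreal (norm e) * ennreal B" by (intro mult_left_mono fin) simp
  finally have le: "(\<integral>\<^sup>+h. ennreal (norm (?F h)) \<partial>lborel) \<le> ennreal (norm e * B)"
    using \<open>B \<ge> 0\<close> by (simp add: ennreal_mult)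
  show int: ?A
    by (rule integrableI_bounded) (use le in \<open>auto intro: le_less_trans\<close>)
  have "ennreal (norm (LINT h|lborel. ?F h)) \<le> ennreal (norm e * B)"
    using integral_norm_bound_ennreal[OF int] le by (rule order_trans)
  then show ?B using \<open>B \<ge> 0\<close> by (simp add: ennreal_le_iff)
qed

text \<open>The slope starts at 0 instead of being centred there, so the pointwise limit is the
  indicator of the open half-line also at \<open>t = 0\<close>. This matters because
  \<open>D\<close> may charge the hyperplane.\<close>

definition ramp :: "nat \<Rightarrow> real \<Rightarrow> real" where
  "ramp k t = max 0 (min 1 (real (Suc k) * t))"

lemma ramp_bounds: "0 \<le> ramp k t" "ramp k t \<le> 1"
  by (auto simp: ramp_def)

lemma ramp_lipschitz: "\<bar>ramp k s - ramp k t\<bar> \<le> real (Suc k) * \<bar>s - t\<bar>"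
proof -
  have "\<bar>max 0 (min 1 a) - max 0 (min 1 b)\<bar> \<le> \<bar>a - b\<bar>" for a b :: real by linarith
  from this[of "real (Suc k) * s" "real (Suc k) * t"] show ?thesis
    unfolding ramp_def by (simp add: right_diff_distrib[symmetric] abs_mult del: of_nat_Suc)
qed

lemma ramp_tendsto: "(\<lambda>k. ramp k t) \<longlonglongrightarrow> indicator {0<..} t"
proof (cases "t > 0")
  case True
  obtain k0 where "1 / t \<le> real k0" using real_arch_simple by blast
  then have k0: "1 \<le> real k0 * t" using True by (simp add: field_simps)
  have "ramp k t = 1" if "k \<ge> k0" for k
  proof -
    have "real k0 * t \<le> real (Suc k) * t" using that True by (intro mult_right_mono) auto
    then show ?thesis using k0 by (simp add: ramp_def del: of_nat_Suc)
  qed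
  then have "eventually (\<lambda>k. ramp k t = 1) sequentially" by (auto simp: eventually_sequentially)
  then show ?thesis using True by (simp add: tendsto_eventually)
next
  case False
  then have "ramp k t = 0" for k
  proof -
    have "real (Suc k) * t \<le> 0" using False by (intro mult_nonneg_nonpos) auto
    then show ?thesis unfolding ramp_def by linarith
  qed
  then show ?thesis using False by simp
qed

text \<open>The bound is uniform in \<open>k\<close>, as \<open>ramp k\<close> is constant away from \<open>[0, 1 / (k + 1)]\<close>.\<close>

lemma ramp_increment:
  assumes "s \<noteq> 0"
  shows "\<bar>ramp k (s + u) - ramp k s\<bar> \<le> min 1 (2 / \<bar>s\<bar> * \<bar>u\<bar>)"
proof -
  define K where "K = real (Suc k)"
  have K: "K > 0" by (simp add: K_def)
  have 1: "\<bar>ramp k (s + u) - ramp k s\<bar> \<le> 1"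
    using ramp_bounds[of k "s + u"] ramp_bounds[of k s] by linarith
  have "\<bar>ramp k (s + u) - ramp k s\<bar> \<le> 2 / \<bar>s\<bar> * \<bar>u\<bar>"
  \<comment> \<open>A slope of at most 2/|s| is handled by the Lipschitz bound. For a steeper ramp,
    a step \<open>u\<close> shorter than |s|/2 leaves the point on the same flat piece, and a longer
    one makes the right-hand side at least 1.\<close>
  proof (cases "K \<le> 2 / \<bar>s\<bar>")
    case True
    have "\<bar>ramp k (s + u) - ramp k s\<bar> \<le> K * \<bar>u\<bar>" using ramp_lipschitz[of k "s + u" s] by (simp add: K_def)
    also have "\<dots> \<le> 2 / \<bar>s\<bar> * \<bar>u\<bar>" by (rule mult_right_mono[OF True]) simp
    finally show ?thesis .
  next
    case far: False
    then have s: "K * \<bar>s\<bar> > 2" using assms by (simp add: field_simps)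
    show ?thesis
    proof (cases "\<bar>s\<bar> \<le> 2 * \<bar>u\<bar>")
      case True
      then have "1 \<le> 2 / \<bar>s\<bar> * \<bar>u\<bar>" using assms by (simp add: field_simps)
      with 1 show ?thesis by linarith
    next
      case False
      have *: "K * (2 * \<bar>u\<bar>) < K * \<bar>s\<bar>" using False K by (intro mult_strict_left_mono) auto
      have "ramp k (s + u) = ramp k s"
      proof (cases "s > 0")
        case True
        have "K * (s + u) \<ge> K * s - K * \<bar>u\<bar>" using K mult_left_mono[of "- \<bar>u\<bar>" u K] by (simp add: distrib_left)
        then have "K * (s + u) \<ge> 1" "K * s \<ge> 1" using s * True by auto
        then show ?thesis by (simp add: ramp_def K_def[symmetric] del: of_nat_Suc)
      next
        case neg: False
        then have "s + u \<le> 0" using False by linarith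
        then have "K * (s + u) \<le> 0" "K * s \<le> 0" using K neg by (auto simp: mult_nonneg_nonpos)
        then show ?thesis by (simp add: ramp_def K_def[symmetric] del: of_nat_Suc)
      qed
      then show ?thesis by simp
    qed
  qed
  with 1 show ?thesis by simp
qed

text \<open>The indicator changes only when \<open>u\<close> points from \<open>s\<close> across 0,
  and then its increment has the sign of \<open>u\<close>. What remains is the integral of
  r^(-\<alpha>-1) from |s| to infinity.\<close>

lemma nn_integral_half_line:
  assumes \<alpha>: "0 < \<alpha>" and s: "s \<noteq> 0"
  shows "(\<integral>\<^sup>+u. ennreal (u * (indicator {0<..} (s + u) - indicator {0<..} s)) * ennreal (1 / \<bar>u\<bar> powr (\<alpha> + 2)) \<partial>lborel)
    = ennreal (1 / (\<alpha> * \<bar>s\<bar> powr \<alpha>))"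
proof -
  define F where "F u = ennreal (indicator {\<bar>s\<bar>..} u * (u powr (- \<alpha> - 1)))" for u :: real
  have [measurable]: "F \<in> borel_measurable borel" unfolding F_def by measurable
  have I: "(\<integral>\<^sup>+u. F u \<partial>lborel) = ennreal (1 / (\<alpha> * \<bar>s\<bar> powr \<alpha>))"
  proof -
    have "((\<lambda>r. r powr (- \<alpha> - 1)) has_integral (- (\<bar>s\<bar> powr ((- \<alpha> - 1) + 1)) / ((- \<alpha> - 1) + 1))) {\<bar>s\<bar>..}"
      using \<alpha> s by (intro has_integral_powr_to_inf) auto
    also have "- (\<bar>s\<bar> powr ((- \<alpha> - 1) + 1)) / ((- \<alpha> - 1) + 1) = 1 / (\<alpha> * \<bar>s\<bar> powr \<alpha>)"
      using \<alpha> s by (simp add: powr_minus field_simps)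
    finally show ?thesis unfolding F_def
      by (subst nn_integral_has_integral_lebesgue[where I="1 / (\<alpha> * \<bar>s\<bar> powr \<alpha>)"]) auto
  qed
  \<comment> \<open>At \<open>u = - s\<close> the open and the closed half-line differ; the point is
    dropped as a null set.\<close>
  have key: "ennreal (u * (indicator {0<..} (s + u) - indicator {0<..} s)) * ennreal (1 / \<bar>u\<bar> powr (\<alpha> + 2))
      = F (- sgn s * u)" if "u \<noteq> - s" for u
  proof -
    have pw: "t * (1 / t powr (\<alpha> + 2)) = t powr (- \<alpha> - 1)" if "t > 0" for t
    proof -
      have "t powr (\<alpha> + 2) = t powr (\<alpha> + 1) * t" using that by (simp add: powr_add power2_eq_square)
      moreover have "t powr (- \<alpha> - 1) = 1 / t powr (\<alpha> + 1)" by (simp add: powr_minus_divide[symmetric])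
      ultimately show ?thesis using that by simp
    qed
    show ?thesis
    proof (cases "s > 0")
      case True
      show ?thesis
      proof (cases "u < - s")
        case lt: True
        then show ?thesis using pw[of "- u"] True
          by (simp add: F_def indicator_def ennreal_mult[symmetric])
      qed (use True that in \<open>auto simp: F_def indicator_def\<close>)
    next
      case False
      then have "s < 0" using s by simp
      show ?thesis
      proof (cases "u > - s")
        case gt: True
        then show ?thesis using pw[of u] \<open>s < 0\<close>
          by (simp add: F_def indicator_def ennreal_mult[symmetric])
      qed (use \<open>s < 0\<close> that in \<open>auto simp: F_def indicator_def\<close>)
    qed
  qed
  have "(\<integral>\<^sup>+u. ennreal (u * (indicator {0<..} (s + u) - indicator {0<..} s)) * ennreal (1 / \<bar>u\<bar> powr (\<alpha> + 2)) \<partial>lborel)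
      = (\<integral>\<^sup>+u. F (0 + (- sgn s) * u) \<partial>lborel)"
  proof (rule nn_integral_cong_AE)
    have "AE u in lborel. u \<noteq> - s" by (rule AE_lborel_singleton)
    then show "AE u in lborel. ennreal (u * (indicator {0<..} (s + u) - indicator {0<..} s)) * ennreal (1 / \<bar>u\<bar> powr (\<alpha> + 2))
      = F (0 + (- sgn s) * u)"
      by eventually_elim (use key in simp)
  qed
  also have "\<dots> = (\<integral>\<^sup>+u. F u \<partial>lborel)"
    using nn_integral_real_affine[of F "- sgn s" 0] s by (simp add: abs_sgn_eq sgn_zero_iff)
  finally show ?thesis using I by simp
qed

text \<open>The factor from \<open>nn_integral_kernel_projection\<close>, produced by integrating
  out the directions orthogonal to \<nu>.\<close>

definition kernel_const :: "nat \<Rightarrow> real \<Rightarrow> real" where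
  "kernel_const n \<alpha> = pi powr ((real n - 1) / 2) * Gamma ((\<alpha> + 2) / 2) / Gamma ((real n + \<alpha> + 1) / 2)"

text \<open>The Gamma factor of dimension n cancels; this is why the one-dimensional constant
  appears in the theorem for every n.\<close>

lemma frac_mu_kernel_const:
  assumes "0 < \<alpha>"
  shows "frac_mu n \<alpha> * kernel_const n \<alpha> = frac_mu 1 \<alpha>"
proof -
  have "Gamma ((real n + \<alpha> + 1) / 2) > 0" using assms by (intro Gamma_real_pos) auto
  moreover have "pi powr (- real n / 2) * pi powr ((real n - 1) / 2) = pi powr (- real 1 / 2)"
    by (simp add: powr_add[symmetric] diff_divide_distrib)
  moreover have "(real 1 + \<alpha> + 1) / 2 = (\<alpha> + 2) / 2" by simp
  ultimately show ?thesis unfolding frac_mu_def kernel_const_def by (simp only:) (simp add: field_simps)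
qed

text \<open>
  The reflection across the line spanned by \<open>\<nu>\<close> removes the component of \<open>e\<close> orthogonal to \<open>\<nu>\<close>;
  the remaining integral depends on \<open>h \<bullet> \<nu>\<close> only.
\<close>

lemma integral_half_space_kernel:
  fixes \<nu> e :: "real^'n"
  assumes \<alpha>: "0 < \<alpha>" "\<alpha> < 1" and \<nu>: "norm \<nu> = 1" and s: "s \<noteq> 0"
  shows "(LINT h|lborel. (h \<bullet> e) * (indicator {0<..} (s + h \<bullet> \<nu>) - indicator {0<..} s) / norm h powr (real CARD('n) + \<alpha> + 1))
    = (\<nu> \<bullet> e) * kernel_const CARD('n) \<alpha> / (\<alpha> * \<bar>s\<bar> powr \<alpha>)"
proof -
  define w where "w h = (indicator {0<..} (s + h \<bullet> \<nu>) - indicator {0<..} s :: real)" for h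
  have [measurable]: "w \<in> borel_measurable borel" unfolding w_def by measurable
  define \<kappa> where "\<kappa> h = 1 / norm h powr (real CARD('n) + \<alpha> + 1)" for h :: "real^'n"
  have [measurable]: "\<kappa> \<in> borel_measurable borel" unfolding \<kappa>_def by measurable
  obtain C where C: "C \<ge> 0" "\<And>t. t > 0 \<Longrightarrow> (\<integral>\<^sup>+h. ennreal (min 1 (t * norm (h::real^'n)) / norm h powr (real CARD('n) + \<alpha>)) \<partial>lborel)
       \<le> ennreal (C * t powr \<alpha>)"
    using nn_integral_kernel_bound[OF \<alpha>] by blast
  \<comment> \<open>The increment of the indicator vanishes unless \<open>h\<close> is long enough
    to reach the hyperplane, so it is dominated by a truncated linear function of the norm, the
    input of \<open>nn_integral_kernel_bound\<close>.\<close>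
  have w_le: "\<bar>w h\<bar> \<le> min 1 (1 / \<bar>s\<bar> * norm h)" for h
  proof -
    have "\<bar>h \<bullet> \<nu>\<bar> \<le> norm h" using Cauchy_Schwarz_ineq2[of h \<nu>] \<nu> by simp
    moreover have "w h \<noteq> 0 \<Longrightarrow> \<bar>s\<bar> \<le> \<bar>h \<bullet> \<nu>\<bar>" 
      unfolding w_def indicator_def by (cases "0 < s + h \<bullet> \<nu>"; cases "0 < s"; simp)
    moreover have "\<bar>w h\<bar> \<le> 1" by (auto simp: w_def indicator_def)
    ultimately show ?thesis using s by (cases "w h = 0") (auto simp: field_simps)
  qed
  have "(\<integral>\<^sup>+h. ennreal (\<bar>w h\<bar> / norm h powr (real CARD('n) + \<alpha>)) \<partial>lborel) \<le> ennreal (C * (1 / \<bar>s\<bar>) powr \<alpha>)"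
    by (rule order_trans[OF nn_integral_mono C(2)]) (use s w_le in \<open>auto intro!: ennreal_leI divide_right_mono simp del: min.bounded_iff\<close>)
  from kernel_integrable(1)[OF _ this] have int: "integrable lborel (\<lambda>h. (h \<bullet> d) * w h * \<kappa> h)" for d
    using C(1) by (simp add: \<kappa>_def)
  define T where "T h = (2 * (h \<bullet> \<nu>)) *\<^sub>R \<nu> - h" for h
  have \<nu>\<nu>: "\<nu> \<bullet> \<nu> = 1" using \<nu> by (simp add: dot_square_norm)
  have T: "orthogonal_transformation T"
    unfolding orthogonal_transformation_def
  proof
    show "linear T" unfolding T_def
      by (intro linear_compose_sub linear_ident) (auto intro!: linearI simp: inner_add_left algebra_simps)
    show "\<forall>v w. T v \<bullet> T w = v \<bullet> w"
      by (simp add: T_def inner_diff_left inner_diff_right \<nu>\<nu> inner_commute algebra_simps)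
  qed
  have T\<nu>: "T h \<bullet> \<nu> = h \<bullet> \<nu>" for h by (simp add: T_def inner_diff_left \<nu>\<nu>)
  have Tn: "norm (T h) = norm h" for h by (rule orthogonal_transformation_norm[OF T])
  have wT: "w (T h) = w h" "\<kappa> (T h) = \<kappa> h" for h by (auto simp: w_def \<kappa>_def T\<nu> Tn)
  let ?I = "LINT h|lborel. (h \<bullet> e) * w h * \<kappa> h"
  have "?I = (LINT h|lborel. (T h \<bullet> e) * w (T h) * \<kappa> (T h))"
    by (rule integral_lborel_orthogonal[OF T, symmetric]) measurable
  also have "\<dots> = (LINT h|lborel. 2 * (\<nu> \<bullet> e) * ((h \<bullet> \<nu>) * w h * \<kappa> h) - (h \<bullet> e) * w h * \<kappa> h)"
    by (intro Bochner_Integration.integral_cong refl) (simp add: wT, simp add: T_def inner_diff_left algebra_simps)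
  also have "\<dots> = 2 * (\<nu> \<bullet> e) * (LINT h|lborel. (h \<bullet> \<nu>) * w h * \<kappa> h) - ?I"
    using int by (simp add: Bochner_Integration.integral_diff)
  finally have eq: "?I = (\<nu> \<bullet> e) * (LINT h|lborel. (h \<bullet> \<nu>) * w h * \<kappa> h)" by simp
  have nn: "0 \<le> u * (indicator {0<..} (s + u) - indicator {0<..} s)" for u :: real
    by (auto simp: indicator_def)
  have kc: "kernel_const CARD('n) \<alpha> \<ge> 0" using \<alpha> by (simp add: kernel_const_def Gamma_real_pos less_imp_le)
  have "(\<integral>\<^sup>+h. ennreal ((h \<bullet> \<nu>) * w h * \<kappa> h) \<partial>lborel)
     = (\<integral>\<^sup>+h. ennreal ((h \<bullet> \<nu>) * (indicator {0<..} (s + h \<bullet> \<nu>) - indicator {0<..} s)) * ennreal (1 / norm h powr (real CARD('n) + \<alpha> + 1)) \<partial>lborel)"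
    using nn by (intro nn_integral_cong) (simp add: w_def \<kappa>_def ennreal_mult[symmetric])
  also have "\<dots> = ennreal (kernel_const CARD('n) \<alpha>) * ennreal (1 / (\<alpha> * \<bar>s\<bar> powr \<alpha>))"
    unfolding kernel_const_def
    by (subst nn_integral_kernel_projection[where F="\<lambda>u. ennreal (u * (indicator {0<..} (s + u) - indicator {0<..} s))", OF _ \<nu> \<alpha>(1)])
      (simp_all add: nn_integral_half_line[OF \<alpha>(1) s])
  also have "\<dots> = ennreal (kernel_const CARD('n) \<alpha> / (\<alpha> * \<bar>s\<bar> powr \<alpha>))"
    using kc \<alpha> by (simp add: ennreal_mult[symmetric])
  finally have "(LINT h|lborel. (h \<bullet> \<nu>) * w h * \<kappa> h) = kernel_const CARD('n) \<alpha> / (\<alpha> * \<bar>s\<bar> powr \<alpha>)"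
    using nn kc \<alpha> by (intro integral_eq_nn_integral[THEN trans]) (auto simp: w_def \<kappa>_def)
  then show ?thesis using eq by (simp add: w_def \<kappa>_def)
qed

text \<open>On a ball the indicator is at most a constant times a Gaussian centred at
  \<open>x0\<close>, which factors along \<nu>. This leaves the one-dimensional integral of
  |u|^(-\<alpha>) exp(-u^2), finite since \<alpha> < 1.\<close>

lemma integrable_hyperplane_weight:
  fixes \<nu> x0 :: "real^'n"
  assumes \<alpha>: "0 < \<alpha>" "\<alpha> < 1" and \<nu>: "norm \<nu> = 1"
  shows "integrable lborel (\<lambda>x. indicator (cball 0 r) x / \<bar>(x - x0) \<bullet> \<nu>\<bar> powr \<alpha>)"
proof (rule integrableI_bounded)
  have [measurable]: "cball (0::real^'n) r \<in> sets borel" by simp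
  have m[measurable]: "(\<lambda>x. indicator (cball 0 r) x / \<bar>(x - x0) \<bullet> \<nu>\<bar> powr \<alpha> :: real) \<in> borel_measurable borel"
    by measurable
  then show "(\<lambda>x. indicator (cball 0 r) x / \<bar>(x - x0) \<bullet> \<nu>\<bar> powr \<alpha> :: real) \<in> borel_measurable lborel" by simp
  define R where "R = max 0 r + norm x0"
  define F where "F u = ennreal (1 / \<bar>u\<bar> powr \<alpha>)" for u :: real
  have [measurable]: "F \<in> borel_measurable borel" unfolding F_def by measurable
  have I1: "(\<integral>\<^sup>+u. ennreal (indicator {0..1} u * (u powr (- \<alpha>))) \<partial>lborel) < \<infinity>"
  proof -
    have "((\<lambda>u. u powr (- \<alpha>)) has_integral (1 powr (- \<alpha> + 1) / (- \<alpha> + 1))) {0..1}"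
      using \<alpha> by (intro has_integral_powr_from_0) auto
    from nn_integral_has_integral_lebesgue[OF _ this] show ?thesis by simp
  qed
  have I2: "(\<integral>\<^sup>+u. ennreal (indicator {0..1} (0 + -1 * u) * ((0 + -1 * u) powr (- \<alpha>))) \<partial>lborel) < \<infinity>"
    using I1 nn_integral_real_affine[of "\<lambda>u. ennreal (indicator {0..1} u * (u powr (- \<alpha>)))" "-1" 0] by simp
  have "(\<integral>\<^sup>+u. F u * ennreal (exp (- 1 * u\<^sup>2)) \<partial>lborel)
    \<le> (\<integral>\<^sup>+u. ennreal (indicator {0..1} u * (u powr (- \<alpha>)))
        + (ennreal (indicator {0..1} (0 + -1 * u) * ((0 + -1 * u) powr (- \<alpha>))) + ennreal (exp (- 1 * u\<^sup>2))) \<partial>lborel)"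
  proof (rule nn_integral_mono)
    fix u :: real
    have "1 / \<bar>u\<bar> powr \<alpha> * exp (- 1 * u\<^sup>2) \<le> indicator {0..1} u * (u powr (- \<alpha>))
        + (indicator {0..1} (0 + -1 * u) * ((0 + -1 * u) powr (- \<alpha>)) + exp (- 1 * u\<^sup>2))"
    proof (cases "\<bar>u\<bar> \<le> 1")
      case True
      have "1 / \<bar>u\<bar> powr \<alpha> * exp (- 1 * u\<^sup>2) \<le> 1 / \<bar>u\<bar> powr \<alpha> * 1" by (intro mult_left_mono) auto
      also have "\<dots> \<le> indicator {0..1} u * (u powr (- \<alpha>)) + indicator {0..1} (0 + -1 * u) * ((0 + -1 * u) powr (- \<alpha>))"
        using True by (cases "u \<ge> 0"; cases "u = 0") (auto simp: indicator_def powr_minus_divide)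
      finally show ?thesis by (smt (verit) exp_gt_zero)
    next
      case False
      then have "1 \<le> \<bar>u\<bar> powr \<alpha>" using \<alpha> by (intro ge_one_powr_ge_zero) auto
      then have "1 / \<bar>u\<bar> powr \<alpha> * exp (- 1 * u\<^sup>2) \<le> 1 * exp (- 1 * u\<^sup>2)" by (intro mult_right_mono) (auto simp: divide_le_eq_1)
      moreover have "0 \<le> indicator {0..1} u * (u powr (- \<alpha>))" "0 \<le> indicator {0..1} (0 + -1 * u) * ((0 + -1 * u) powr (- \<alpha>))" by auto
      ultimately show ?thesis by linarith
    qed
    then show "F u * ennreal (exp (- 1 * u\<^sup>2)) \<le> ennreal (indicator {0..1} u * (u powr (- \<alpha>)))
        + (ennreal (indicator {0..1} (0 + -1 * u) * ((0 + -1 * u) powr (- \<alpha>))) + ennreal (exp (- 1 * u\<^sup>2)))"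
      unfolding F_def by (simp add: ennreal_mult[symmetric] ennreal_plus[symmetric] ennreal_leI del: ennreal_plus)
  qed
  also have "\<dots> < \<infinity>"
    using I1 I2 nn_integral_exp_power2[of 1] by (simp add: nn_integral_add)
  finally have fin: "(\<integral>\<^sup>+u. F u * ennreal (exp (- 1 * u\<^sup>2)) \<partial>lborel) < \<infinity>" .
  have "(\<integral>\<^sup>+x. ennreal (norm (indicator (cball 0 r) x / \<bar>(x - x0) \<bullet> \<nu>\<bar> powr \<alpha>)) \<partial>lborel)
    = (\<integral>\<^sup>+h. ennreal (norm (indicator (cball 0 r) (x0 + h) / \<bar>(x0 + h - x0) \<bullet> \<nu>\<bar> powr \<alpha>)) \<partial>lborel)"
    by (rule nn_integral_lborel_shift[symmetric, where F="\<lambda>x. ennreal (norm (indicator (cball 0 r) x / \<bar>(x - x0) \<bullet> \<nu>\<bar> powr \<alpha>))"])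
      (use m in measurable)
  also have "\<dots> \<le> (\<integral>\<^sup>+h. ennreal (exp (R\<^sup>2)) * (F (h \<bullet> \<nu>) * ennreal (exp (- 1 * (norm h)\<^sup>2))) \<partial>lborel)"
  proof (rule nn_integral_mono)
    fix h :: "real^'n"
    have "indicator (cball 0 r) (x0 + h) \<le> exp (R\<^sup>2) * exp (- 1 * (norm h)\<^sup>2)"
    proof (cases "x0 + h \<in> cball 0 r")
      case True
      then have "norm (x0 + h) \<le> r" by simp
      moreover have "norm h \<le> norm (x0 + h) + norm x0" using norm_triangle_ineq4[of "x0 + h" x0] by simp
      ultimately have "norm h \<le> R" by (simp add: R_def)
      then have "(norm h)\<^sup>2 \<le> R\<^sup>2" by (intro power_mono) auto
      then show ?thesis by (simp add: exp_add[symmetric] indicator_def)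
    qed simp
    then have "1 / \<bar>h \<bullet> \<nu>\<bar> powr \<alpha> * indicator (cball 0 r) (x0 + h) \<le> 1 / \<bar>h \<bullet> \<nu>\<bar> powr \<alpha> * (exp (R\<^sup>2) * exp (- 1 * (norm h)\<^sup>2))"
      by (intro mult_left_mono) auto
    then show "ennreal (norm (indicator (cball 0 r) (x0 + h) / \<bar>(x0 + h - x0) \<bullet> \<nu>\<bar> powr \<alpha>))
      \<le> ennreal (exp (R\<^sup>2)) * (F (h \<bullet> \<nu>) * ennreal (exp (- 1 * (norm h)\<^sup>2)))"
      unfolding F_def by (simp add: ennreal_mult[symmetric] mult_ac ennreal_leI)
  qed
  also have "\<dots> = ennreal (exp (R\<^sup>2)) * (ennreal ((pi / 1) powr ((real CARD('n) - 1) / 2)) * (\<integral>\<^sup>+u. F u * ennreal (exp (- 1 * u\<^sup>2)) \<partial>lborel))"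
    by (subst nn_integral_cmult, measurable, subst nn_integral_exp_norm[OF _ \<nu>]) auto
  also have "\<dots> < \<infinity>" using fin by (simp add: ennreal_mult_less_top)
  finally show "(\<integral>\<^sup>+x. ennreal (norm (indicator (cball 0 r) x / \<bar>(x - x0) \<bullet> \<nu>\<bar> powr \<alpha>)) \<partial>lborel) < \<infinity>" .
qed

section \<open>The half-space estimate\<close>

text \<open>Brings increments into the form handled by \<open>nn_integral_kernel_bound\<close>. The
  added ones keep the slope positive and let the prefactor, being at least 1, be placed outside the
  minimum.\<close>

lemma lipschitz_increment:
  fixes u :: "'a::real_normed_vector \<Rightarrow> real"
  assumes L: "L-lipschitz_on UNIV u" and M: "\<And>x. \<bar>u x\<bar> \<le> M"
  shows "\<bar>u (x + h) - u x\<bar> \<le> (2 * M + 1) * min 1 ((L + 1) * norm h)"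
proof -
  define A t where "A = 2 * M + 1" and "t = L + 1"
  have "L \<ge> 0" using L by (rule lipschitz_on_nonneg)
  moreover have "M \<ge> 0" using M[of 0] by linarith
  ultimately have A: "A \<ge> 1" and t: "t \<ge> 1" "L \<le> t" by (auto simp: A_def t_def)
  have "\<bar>u (x + h) - u x\<bar> \<le> A" using M[of "x + h"] M[of x] by (simp add: A_def)
  moreover have "\<bar>u (x + h) - u x\<bar> \<le> L * norm h"
    using lipschitz_onD[OF L, of "x + h" x] by (simp add: dist_real_def dist_norm)
  moreover have "L * norm h \<le> A * (t * norm h)"
  proof -
    have "L * norm h \<le> t * norm h" using t by (intro mult_right_mono) auto
    also have "\<dots> \<le> A * (t * norm h)" using A t mult_right_mono[of 1 A "t * norm h"] by simp
    finally show ?thesis .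
  qed
  ultimately show ?thesis unfolding A_def[symmetric] t_def[symmetric] by (auto simp: min_def)
qed

lemma continuous_compact_support_bounded:
  fixes u :: "'a::euclidean_space \<Rightarrow> real"
  assumes u: "continuous_on UNIV u" and supp: "\<And>x. norm x \<ge> r \<Longrightarrow> u x = 0"
  obtains M where "\<And>x. \<bar>u x\<bar> \<le> M"
proof -
  have "compact (u ` cball 0 r)" using u by (intro compact_continuous_image) (auto intro: continuous_on_subset)
  then have "bounded (u ` cball 0 r)" by (rule compact_imp_bounded)
  then obtain M where "\<forall>y\<in>u ` cball 0 r. norm y \<le> M" unfolding bounded_iff by blast
  then have M: "\<bar>u x\<bar> \<le> M" if "norm x \<le> r" for x using that by simp
  have "\<bar>u x\<bar> \<le> max M 0" for x using M[of x] supp[of x] by (cases "norm x \<le> r") auto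
  then show thesis by (rule that)
qed

text \<open>The bound depends on the Lipschitz constant and thus later on \<open>k\<close>; it
  certifies absolute convergence and does not survive into the final estimate.\<close>

lemma lipschitz_kernel_finite:
  fixes u :: "real^'n \<Rightarrow> real"
  assumes \<alpha>: "0 < \<alpha>" "\<alpha> < 1" and L: "L-lipschitz_on UNIV u" and M: "\<And>x. \<bar>u x\<bar> \<le> M"
  obtains B where "B \<ge> 0" "\<And>x. (\<integral>\<^sup>+h. ennreal (\<bar>u (x + h) - u x\<bar> / norm h powr (real CARD('n) + \<alpha>)) \<partial>lborel) \<le> ennreal B"
proof -
  obtain C where C: "C \<ge> 0" "\<And>t. t > 0 \<Longrightarrow> (\<integral>\<^sup>+h. ennreal (min 1 (t * norm (h::real^'n)) / norm h powr (real CARD('n) + \<alpha>)) \<partial>lborel)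
       \<le> ennreal (C * t powr \<alpha>)"
    using nn_integral_kernel_bound[OF \<alpha>] by blast
  define A t where "A = 2 * M + 1" and "t = L + 1"
  have A: "A \<ge> 1" using M[of 0] by (simp add: A_def)
  have t: "t \<ge> 1" using lipschitz_on_nonneg[OF L] by (simp add: t_def)
  have ptw: "\<bar>u (x + h) - u x\<bar> \<le> A * min 1 (t * norm h)" for x h
    unfolding A_def t_def by (rule lipschitz_increment[OF L M])
  show thesis
  proof (rule that[of "A * (C * t powr \<alpha>)"])
    show "0 \<le> A * (C * t powr \<alpha>)" using A C by simp
    fix x :: "real^'n"
    have "(\<integral>\<^sup>+h. ennreal (\<bar>u (x + h) - u x\<bar> / norm h powr (real CARD('n) + \<alpha>)) \<partial>lborel)
      \<le> (\<integral>\<^sup>+h. ennreal A * ennreal (min 1 (t * norm (h::real^'n)) / norm h powr (real CARD('n) + \<alpha>)) \<partial>lborel)"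
    proof (rule nn_integral_mono)
      fix h :: "real^'n"
      have "\<bar>u (x + h) - u x\<bar> / norm h powr (real CARD('n) + \<alpha>) \<le> A * min 1 (t * norm h) / norm h powr (real CARD('n) + \<alpha>)"
        by (intro divide_right_mono ptw) simp
      then show "ennreal (\<bar>u (x + h) - u x\<bar> / norm h powr (real CARD('n) + \<alpha>))
        \<le> ennreal A * ennreal (min 1 (t * norm h) / norm h powr (real CARD('n) + \<alpha>))"
        using A t by (simp add: ennreal_mult[symmetric] ennreal_leI)
    qed
    also have "\<dots> = ennreal A * (\<integral>\<^sup>+h. ennreal (min 1 (t * norm h) / norm (h::real^'n) powr (real CARD('n) + \<alpha>)) \<partial>lborel)"
      by (rule nn_integral_cmult) measurable
    also have "\<dots> \<le> ennreal A * ennreal (C * t powr \<alpha>)" using t by (intro mult_left_mono C) auto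
    also have "\<dots> = ennreal (A * (C * t powr \<alpha>))" using A C by (simp add: ennreal_mult)
    finally show "(\<integral>\<^sup>+h. ennreal (\<bar>u (x + h) - u x\<bar> / norm h powr (real CARD('n) + \<alpha>)) \<partial>lborel) \<le> ennreal (A * (C * t powr \<alpha>))" .
  qed
qed

lemma lipschitz_borel_measurable:
  "L-lipschitz_on UNIV u \<Longrightarrow> u \<in> borel_measurable borel"
  by (intro borel_measurable_continuous_onI lipschitz_on_continuous_on)

lemma lipschitz_mult:
  fixes u g :: "'a::metric_space \<Rightarrow> real"
  assumes u: "L-lipschitz_on UNIV u" and g: "K-lipschitz_on UNIV g" and M: "\<And>x. \<bar>u x\<bar> \<le> M" "\<And>x. \<bar>g x\<bar> \<le> 1"
  shows "(L + M * K)-lipschitz_on UNIV (\<lambda>x. u x * g x)"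
proof (rule lipschitz_onI)
  have "M \<ge> 0" using M(1) abs_ge_zero order_trans by blast
  then show "0 \<le> L + M * K" using lipschitz_on_nonneg[OF u] lipschitz_on_nonneg[OF g] by simp
  fix x y
  have "u x * g x - u y * g y = (u x - u y) * g x + u y * (g x - g y)" by (simp add: algebra_simps)
  then have "\<bar>u x * g x - u y * g y\<bar> \<le> \<bar>u x - u y\<bar> * \<bar>g x\<bar> + \<bar>u y\<bar> * \<bar>g x - g y\<bar>"
    by (metis abs_mult abs_triangle_ineq)
  also have "\<dots> \<le> (L * dist x y) * 1 + M * (K * dist x y)"
    using lipschitz_onD[OF u, of x y] lipschitz_onD[OF g, of x y] M \<open>M \<ge> 0\<close> lipschitz_on_nonneg[OF u]
    by (intro add_mono mult_mono) (auto simp: dist_real_def)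
  also have "\<dots> = (L + M * K) * dist x y" by (simp add: algebra_simps)
  finally show "dist (u x * g x) (u y * g y) \<le> (L + M * K) * dist x y" by (simp add: dist_real_def)
qed

text \<open>Evaluating \<open>g\<close> at \<open>x + h\<close> in the second integral leaves no
  increment of \<open>g\<close> there, so that term can be bounded independently of the steepness of
  the ramp. Lipschitz continuity makes both integrals converge absolutely, which justifies the
  splitting.\<close>

lemma frac_div_product:
  fixes u g :: "real^'n \<Rightarrow> real"
  assumes \<alpha>: "0 < \<alpha>" "\<alpha> < 1" and u: "L-lipschitz_on UNIV u" and g: "K-lipschitz_on UNIV g"
    and M: "\<And>x. \<bar>u x\<bar> \<le> M" "\<And>x. \<bar>g x\<bar> \<le> 1"
  shows "frac_div \<alpha> (\<lambda>x. (u x * g x) *\<^sub>R e) x = frac_mu CARD('n) \<alpha> *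
    (u x * (LINT h|lborel. (h \<bullet> e) * (g (x + h) - g x) / norm h powr (real CARD('n) + \<alpha> + 1))
     + (LINT h|lborel. (h \<bullet> e) * ((u (x + h) - u x) * g (x + h)) / norm h powr (real CARD('n) + \<alpha> + 1)))"
proof -
  have [measurable]: "u \<in> borel_measurable borel" "g \<in> borel_measurable borel"
    using u g by (auto intro: lipschitz_borel_measurable)
  obtain B where B: "B \<ge> 0" "\<And>x. (\<integral>\<^sup>+h. ennreal (\<bar>u (x + h) - u x\<bar> / norm h powr (real CARD('n) + \<alpha>)) \<partial>lborel) \<le> ennreal B"
    using lipschitz_kernel_finite[OF \<alpha> u M(1)] by blast
  obtain B' where B': "B' \<ge> 0" "\<And>x. (\<integral>\<^sup>+h. ennreal (\<bar>g (x + h) - g x\<bar> / norm h powr (real CARD('n) + \<alpha>)) \<partial>lborel) \<le> ennreal B'"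
    using lipschitz_kernel_finite[OF \<alpha> g M(2)] by blast
  have i1: "integrable lborel (\<lambda>h. (h \<bullet> e) * (g (x + h) - g x) / norm h powr (real CARD('n) + \<alpha> + 1))"
    using B' by (intro kernel_integrable(1)[where B=B']) auto
  have i2: "integrable lborel (\<lambda>h. (h \<bullet> e) * ((u (x + h) - u x) * g (x + h)) / norm h powr (real CARD('n) + \<alpha> + 1))"
  proof (rule kernel_integrable(1))
    have "\<bar>(u (x + h) - u x) * g (x + h)\<bar> \<le> \<bar>u (x + h) - u x\<bar>" for h
      using M(2)[of "x + h"] mult_left_mono[of "\<bar>g (x + h)\<bar>" 1 "\<bar>u (x + h) - u x\<bar>"] by (simp add: abs_mult)
    then show "(\<integral>\<^sup>+h. ennreal (\<bar>(u (x + h) - u x) * g (x + h)\<bar> / norm h powr (real CARD('n) + \<alpha>)) \<partial>lborel) \<le> ennreal B"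
      by (intro order_trans[OF nn_integral_mono B(2)[of x]] ennreal_leI divide_right_mono) auto
  qed (use B in auto)
  have "(LINT y|lebesgue. ((y - x) \<bullet> ((u y * g y) *\<^sub>R e - (u x * g x) *\<^sub>R e)) / norm (y - x) powr (real CARD('n) + \<alpha> + 1))
    = (LINT y|lborel. ((y - x) \<bullet> e) * (u y * g y - u x * g x) / norm (y - x) powr (real CARD('n) + \<alpha> + 1))"
    by (subst integral_completion, measurable) (simp add: inner_diff_right mult.commute right_diff_distrib)
  also have "\<dots> = (LINT h|lborel. ((x + h - x) \<bullet> e) * (u (x + h) * g (x + h) - u x * g x) / norm (x + h - x) powr (real CARD('n) + \<alpha> + 1))"
    by (rule integral_lborel_shift[symmetric]) measurable
  also have "\<dots> = (LINT h|lborel. u x * ((h \<bullet> e) * (g (x + h) - g x) / norm h powr (real CARD('n) + \<alpha> + 1))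
      + (h \<bullet> e) * ((u (x + h) - u x) * g (x + h)) / norm h powr (real CARD('n) + \<alpha> + 1))"
    by (intro Bochner_Integration.integral_cong refl)
      (simp add: add_divide_distrib[symmetric] algebra_simps)
  also have "\<dots> = u x * (LINT h|lborel. (h \<bullet> e) * (g (x + h) - g x) / norm h powr (real CARD('n) + \<alpha> + 1))
     + (LINT h|lborel. (h \<bullet> e) * ((u (x + h) - u x) * g (x + h)) / norm h powr (real CARD('n) + \<alpha> + 1))"
    by (subst Bochner_Integration.integral_add[OF integrable_mult_right[OF i1] i2]) (simp only: integral_mult_right_zero)
  finally show ?thesis unfolding frac_div_def by simp
qed

section \<open>One coordinate of the variation measure on a half-space\<close>

lemma AE_not_in_hyperplane:
  fixes \<nu> x0 :: "real^'n"
  assumes "norm \<nu> = 1"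
  shows "AE x in lborel. (x - x0) \<bullet> \<nu> \<noteq> 0"
proof -
  have "negligible {x. \<nu> \<bullet> x = \<nu> \<bullet> x0}" using assms by (intro negligible_hyperplane) auto
  then have "AE x in lebesgue. x \<notin> {x. \<nu> \<bullet> x = \<nu> \<bullet> x0}"
    by (intro AE_not_in) (simp add: negligible_iff_null_sets)
  then show ?thesis unfolding AE_completion_iff
    by eventually_elim (auto simp: inner_diff_left inner_commute[of \<nu>])
qed

lemma signed_borel_measure_component:
  assumes "vector_radon_measure D"
  shows "signed_borel_measure (\<lambda>B. D B $ i)"
proof
  show "D {} $ i = 0" using assms by (simp add: vector_radon_measure_def)
  fix A :: "nat \<Rightarrow> (real^'a) set" assume "range A \<subseteq> sets borel" "disjoint_family A"
  then have "(\<lambda>k. D (A k)) sums D (\<Union>k. A k)" using assms by (simp add: vector_radon_measure_def)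
  then show "(\<lambda>k. D (A k) $ i) sums D (\<Union>k. A k) $ i"
    unfolding sums_def by (drule_tac tendsto_vec_nth[where i=i]) (simp add: sum_component)
qed

lemma vector_integral_axis:
  "vector_integral D (\<lambda>x. c x *\<^sub>R axis i 1) = signed_integral (\<lambda>B. D B $ i) c"
proof -
  have "signed_integral (\<lambda>B. D B $ j) (\<lambda>x. (c x *\<^sub>R axis i 1) $ j)
    = (if j = i then signed_integral (\<lambda>B. D B $ i) c else 0)" for j
    by (auto simp: signed_integral_def axis_def)
  then show ?thesis by (simp add: vector_integral_def)
qed

text \<open>The quantitative core, before dilation. \<eta> enters the error through its Besov
  seminorm alone, and the direction \<nu> and the base point do not enter it at all.\<close>

lemma half_space_estimate:
  fixes f \<eta> :: "real^'n \<Rightarrow> real" and D :: "(real^'n) set \<Rightarrow> real^'n" and \<nu> x0 :: "real^'n"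
  assumes \<alpha>: "0 < \<alpha>" "\<alpha> < 1" and pq: "1 \<le> p" "p \<noteq> \<infinity>" "1 / p + 1 / q = 1"
    and f[measurable]: "f \<in> borel_measurable borel" and f_bound: "\<And>x. \<bar>f x\<bar> \<le> M\<^sub>f" and fp: "Lp_norm p f < \<infinity>"
    and D: "has_frac_variation_measure \<alpha> f D"
    and \<eta>: "continuous_on UNIV \<eta>" and supp: "\<And>x. norm x \<ge> r \<Longrightarrow> \<eta> x = 0" and bes: "besov_seminorm \<alpha> q \<eta> < \<infinity>"
    and \<nu>: "norm \<nu> = 1"
  shows "\<bar>signed_integral (\<lambda>B. D B $ i) (\<lambda>x. \<eta> x * indicator (half_space \<nu> x0) x)
      + frac_mu 1 \<alpha> / \<alpha> * \<nu> $ i * (LINT x|lborel. f x * \<eta> x / \<bar>(x - x0) \<bullet> \<nu>\<bar> powr \<alpha>)\<bar>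
    \<le> frac_mu CARD('n) \<alpha> * enn2real (Lp_norm p f * besov_seminorm \<alpha> q \<eta>)"
proof -
  define N where "N = real CARD('n)"
  define \<mu> where "\<mu> = frac_mu CARD('n) \<alpha>"
  have \<mu>: "\<mu> \<ge> 0" using \<alpha> by (simp add: \<mu>_def frac_mu_def Gamma_real_pos less_imp_le)
  define e :: "real^'n" where "e = axis i 1"
  have e: "norm e = 1" by (simp add: e_def)
  define E where "E = enn2real (Lp_norm p f * besov_seminorm \<alpha> q \<eta>)"
  have E: "ennreal E = Lp_norm p f * besov_seminorm \<alpha> q \<eta>" "E \<ge> 0"
    using fp bes by (auto simp: E_def ennreal_enn2real_if ennreal_mult_eq_top_iff less_top)
  interpret signed_borel_measure "\<lambda>B. D B $ i"
    using D by (intro signed_borel_measure_component) (simp add: has_frac_variation_measure_def)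
  have \<eta>m[measurable]: "\<eta> \<in> borel_measurable borel" using \<eta> by (rule borel_measurable_continuous_onI)
  obtain M where M: "\<And>x. \<bar>\<eta> x\<bar> \<le> M" using continuous_compact_support_bounded[OF \<eta> supp] by blast
  have M0: "M \<ge> 0" using M[of 0] by linarith
  have \<eta>_int: "integrable lborel \<eta>"
  proof (rule Bochner_Integration.integrable_bound)
    show "integrable lborel (\<lambda>x. M * indicator (cball (0::real^'n) r) x)"
      using emeasure_bounded_finite[of "cball (0::real^'n) r"]
      by (intro integrable_mult_right integrable_real_indicator) auto
    show "AE x in lborel. norm (\<eta> x) \<le> norm (M * indicator (cball (0::real^'n) r) x)"
      using M M0 supp by (intro AE_I2) (auto simp: indicator_def)
  qed simp
  obtain \<rho> :: "nat \<Rightarrow> real^'n \<Rightarrow> real" where \<rho>: "\<And>k z. \<rho> k z \<ge> 0" "\<And>k. \<exists>L. L-lipschitz_on UNIV (\<rho> k)"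
    "\<And>k. \<exists>B. \<forall>z. \<bar>\<rho> k z\<bar> \<le> B" "\<And>k z. norm z \<ge> 1 / real (Suc k) \<Longrightarrow> \<rho> k z = 0"
    "\<And>k. integrable lborel (\<rho> k)" "\<And>k. (LINT z|lborel. \<rho> k z) = 1"
    by (rule mollifier_exists) blast
  have \<rho>m[measurable]: "\<rho> k \<in> borel_measurable borel" for k using \<rho>(2)[of k] lipschitz_borel_measurable by blast
  define v where "v k = mollify (\<rho> k) \<eta>" for k
  have v_bound: "\<bar>v k x\<bar> \<le> M" for k x
    unfolding v_def by (rule mollify_bound[OF \<rho>m \<eta>m \<rho>(1) \<rho>(5) \<rho>(6) M])
  have v_lip: "\<exists>L. L-lipschitz_on UNIV (v k)" for k
    unfolding v_def using mollify_lipschitz[OF _ \<eta>_int] \<rho>(2,3)[of k] by blast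
  have v_supp: "v k x = 0" if "norm x \<ge> r + 1" for k x
    unfolding v_def
  proof (rule mollify_eq_0[OF \<rho>(4) supp])
    have "1 / real (Suc k) \<le> 1" by simp
    then show "r + 1 / real (Suc k) \<le> norm x" using that by linarith
  qed auto
  have v_lim: "(\<lambda>k. v k x) \<longlonglongrightarrow> \<eta> x" for x
  proof (rule LIMSEQ_I)
    fix \<epsilon> :: real assume "\<epsilon> > 0"
    have "isCont \<eta> x" using \<eta> by (simp add: continuous_on_eq_continuous_at)
    then obtain d where d: "d > 0" "\<And>y. dist y x < d \<Longrightarrow> dist (\<eta> y) (\<eta> x) < \<epsilon> / 2"
      using \<open>\<epsilon> > 0\<close> unfolding continuous_at_eps_delta by (metis half_gt_zero)
    obtain k0 where k0: "1 / real (Suc k0) < d" using reals_Archimedean[OF d(1)] by (auto simp: inverse_eq_divide)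
    have "norm (v k x - \<eta> x) < \<epsilon>" if "k \<ge> k0" for k
    proof -
      have "\<bar>v k x - \<eta> x\<bar> \<le> \<epsilon> / 2" unfolding v_def
      proof (rule mollify_diff_bound[OF \<rho>m \<eta>m \<rho>(1) \<rho>(5) \<rho>(6) M])
        fix z assume "\<rho> k z \<noteq> 0"
        then have "norm z < 1 / real (Suc k)" using \<rho>(4)[of k z] by (meson not_le)
        also have "\<dots> \<le> 1 / real (Suc k0)" using that by (intro divide_left_mono) auto
        finally have "dist (x - z) x < d" using k0 by (simp add: dist_norm)
        from d(2)[OF this] show "\<bar>\<eta> (x - z) - \<eta> x\<bar> \<le> \<epsilon> / 2" by (simp add: dist_real_def)
      qed
      then show ?thesis using \<open>\<epsilon> > 0\<close> by simp
    qed
    then show "\<exists>k0. \<forall>k\<ge>k0. norm (v k x - \<eta> x) < \<epsilon>" by blast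
  qed
  have vm[measurable]: "v k \<in> borel_measurable borel" for k using v_lip[of k] lipschitz_borel_measurable by blast
  define g where "g k x = ramp k ((x - x0) \<bullet> \<nu>)" for k x
  have g_bound: "\<bar>g k x\<bar> \<le> 1" for k x using ramp_bounds[of k] by (simp add: g_def)
  have g_lip: "(real (Suc k))-lipschitz_on UNIV (g k)" for k
  proof (rule lipschitz_onI)
    fix x y :: "real^'n"
    have "\<bar>g k x - g k y\<bar> \<le> real (Suc k) * \<bar>(x - x0) \<bullet> \<nu> - (y - x0) \<bullet> \<nu>\<bar>" unfolding g_def by (rule ramp_lipschitz)
    also have "(x - x0) \<bullet> \<nu> - (y - x0) \<bullet> \<nu> = (x - y) \<bullet> \<nu>" by (simp add: inner_diff_left)
    also have "\<bar>(x - y) \<bullet> \<nu>\<bar> \<le> norm (x - y)" using Cauchy_Schwarz_ineq2[of "x - y" \<nu>] \<nu> by simp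
    finally show "dist (g k x) (g k y) \<le> real (Suc k) * dist x y"
      by (simp add: dist_real_def dist_norm mult_left_mono)
  qed simp
  have gm[measurable]: "g k \<in> borel_measurable borel" for k using g_lip lipschitz_borel_measurable by blast
  \<comment> \<open>\<open>I\<close> is the kernel integral of the ramp and will converge to the
    gradient of the half-space; \<open>B\<close> is the remainder, which is only bounded.\<close>
  define I where "I k x = (LINT h|lborel. (h \<bullet> e) * (g k (x + h) - g k x) / norm h powr (N + \<alpha> + 1))" for k x
  define B where "B k x = (LINT h|lborel. (h \<bullet> e) * ((v k (x + h) - v k x) * g k (x + h)) / norm h powr (N + \<alpha> + 1))" for k x
  have [measurable]: "I k \<in> borel_measurable borel" "B k \<in> borel_measurable borel" for k
    unfolding I_def B_def by measurable
  have div: "frac_div \<alpha> (\<lambda>x. (v k x * g k x) *\<^sub>R e) = (\<lambda>x. \<mu> * (v k x * I k x + B k x))" for k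
  proof
    obtain L where "L-lipschitz_on UNIV (v k)" using v_lip by blast
    from frac_div_product[OF \<alpha> this g_lip[of k] v_bound[of k] g_bound[of k]]
    show "frac_div \<alpha> (\<lambda>x. (v k x * g k x) *\<^sub>R e) x = \<mu> * (v k x * I k x + B k x)" for x
      by (simp add: I_def B_def \<mu>_def N_def)
  qed
  have B_le: "ennreal \<bar>B k x\<bar> \<le> (\<integral>\<^sup>+h. ennreal (\<bar>v k (x + h) - v k x\<bar> / norm h powr (N + \<alpha>)) \<partial>lborel)" for k x
  proof -
    obtain L where "L-lipschitz_on UNIV (v k)" using v_lip by blast
    from lipschitz_kernel_finite[OF \<alpha> this v_bound[of k]] obtain b where b: "b \<ge> 0"
      "\<And>x. (\<integral>\<^sup>+h. ennreal (\<bar>v k (x + h) - v k x\<bar> / norm h powr (N + \<alpha>)) \<partial>lborel) \<le> ennreal b"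
      unfolding N_def by blast
    \<comment> \<open>The Lipschitz bound \<open>b\<close> only shows that \<open>J\<close> is
      finite; \<open>J\<close> itself then serves as the real bound in
      \<open>kernel_integrable\<close>, so that no Lipschitz constant remains.\<close>
    define J where "J = (\<integral>\<^sup>+h. ennreal (\<bar>v k (x + h) - v k x\<bar> / norm h powr (N + \<alpha>)) \<partial>lborel)"
    have J: "J = ennreal (enn2real J)" using b(2)[of x] by (auto simp: J_def ennreal_enn2real_if top_unique)
    have "\<bar>(v k (x + h) - v k x) * g k (x + h)\<bar> \<le> \<bar>v k (x + h) - v k x\<bar>" for h
      using g_bound[of k "x + h"] mult_left_mono[of "\<bar>g k (x + h)\<bar>" 1 "\<bar>v k (x + h) - v k x\<bar>"] by (simp add: abs_mult)
    then have "(\<integral>\<^sup>+h. ennreal (\<bar>(v k (x + h) - v k x) * g k (x + h)\<bar> / norm h powr (N + \<alpha>)) \<partial>lborel) \<le> J"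
      unfolding J_def by (intro nn_integral_mono ennreal_leI divide_right_mono) auto
    then have "\<bar>B k x\<bar> \<le> norm e * enn2real J"
      unfolding B_def N_def by (intro kernel_integrable(2)) (use J in \<open>auto simp: N_def\<close>)
    then have "ennreal \<bar>B k x\<bar> \<le> ennreal (enn2real J)" using e by (intro ennreal_leI) simp
    then show ?thesis unfolding J_def[symmetric] by (subst J)
  qed
  have fB: "(\<integral>\<^sup>+x. ennreal (norm (f x * B k x)) \<partial>lborel) \<le> ennreal E" for k
  proof -
    have "(\<integral>\<^sup>+x. ennreal (norm (f x * B k x)) \<partial>lborel)
      \<le> (\<integral>\<^sup>+x. ennreal \<bar>f x\<bar> * (\<integral>\<^sup>+h. ennreal (\<bar>v k (x + h) - v k x\<bar> / norm h powr (N + \<alpha>)) \<partial>lborel) \<partial>lborel)"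
      by (intro nn_integral_mono) (simp add: abs_mult ennreal_mult mult_left_mono B_le)
    also have "\<dots> \<le> Lp_norm p f * besov_seminorm \<alpha> q \<eta>"
      unfolding v_def N_def by (rule mollify_besov_bound[OF pq f \<rho>m \<eta>m \<rho>(1) \<rho>(5) \<rho>(6) M])
    finally show ?thesis by (simp add: E)
  qed
  have fB_int: "integrable lborel (\<lambda>x. f x * B k x)" for k
    using fB[of k] by (intro integrableI_bounded) (auto intro: le_less_trans)
  have fB_bound: "\<bar>LINT x|lborel. f x * B k x\<bar> \<le> E" for k
  proof -
    have "ennreal (norm (LINT x|lborel. f x * B k x)) \<le> ennreal E"
      using integral_norm_bound_ennreal[OF fB_int] fB by (rule order_trans)
    then show ?thesis using E(2) by (simp only: ennreal_le_iff real_norm_def)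
  qed
  define s where "s x = (x - x0) \<bullet> \<nu>" for x
  have g_inc: "g k (x + h) - g k x = ramp k (s x + h \<bullet> \<nu>) - ramp k (s x)" for k x h
    by (simp add: g_def s_def inner_add_left inner_diff_left algebra_simps)
  have s_AE: "AE x in lborel. s x \<noteq> 0" unfolding s_def by (rule AE_not_in_hyperplane[OF \<nu>])
  obtain C where C: "C \<ge> 0" "\<And>t. t > 0 \<Longrightarrow> (\<integral>\<^sup>+h. ennreal (min 1 (t * norm (h::real^'n)) / norm h powr (N + \<alpha>)) \<partial>lborel)
       \<le> ennreal (C * t powr \<alpha>)"
    unfolding N_def using nn_integral_kernel_bound[OF \<alpha>] by blast
  have inc_le: "\<bar>g k (x + h) - g k x\<bar> \<le> min 1 (2 / \<bar>s x\<bar> * norm h)" if "s x \<noteq> 0" for k x h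
  proof -
    have "\<bar>h \<bullet> \<nu>\<bar> \<le> norm h" using Cauchy_Schwarz_ineq2[of h \<nu>] \<nu> by simp
    then have "min 1 (2 / \<bar>s x\<bar> * \<bar>h \<bullet> \<nu>\<bar>) \<le> min 1 (2 / \<bar>s x\<bar> * norm h)"
      by (intro min.mono mult_left_mono) auto
    then show ?thesis unfolding g_inc using ramp_increment[OF that, of k "h \<bullet> \<nu>"] by linarith
  qed
  \<comment> \<open>Uniform in \<open>k\<close> because \<open>ramp_increment\<close> is; the
    singularity on the hyperplane has the integrable order \<alpha>.\<close>
  have I_bound: "\<bar>I k x\<bar> \<le> C * (2 / \<bar>s x\<bar>) powr \<alpha>" if "s x \<noteq> 0" for k x
  proof -
    have "(\<integral>\<^sup>+h. ennreal (\<bar>g k (x + h) - g k x\<bar> / norm h powr (N + \<alpha>)) \<partial>lborel) \<le> ennreal (C * (2 / \<bar>s x\<bar>) powr \<alpha>)"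
      using that inc_le[OF that]
      by (intro order_trans[OF nn_integral_mono C(2)] ennreal_leI divide_right_mono) auto
    then have "\<bar>I k x\<bar> \<le> norm e * (C * (2 / \<bar>s x\<bar>) powr \<alpha>)"
      unfolding I_def N_def using C(1) by (intro kernel_integrable(2)) (auto simp: N_def)
    then show ?thesis by (simp add: e)
  qed
  \<comment> \<open>Multiplied by \<open>frac_mu CARD('n) \<alpha>\<close> this becomes
    \<open>frac_mu 1 \<alpha> / \<alpha> * \<nu> $ i\<close>.\<close>
  define c where "c = \<nu> $ i * kernel_const CARD('n) \<alpha> / \<alpha>"
  have I_lim: "(\<lambda>k. I k x) \<longlonglongrightarrow> c / \<bar>s x\<bar> powr \<alpha>" if sx: "s x \<noteq> 0" for x
  proof -
    let ?w = "\<lambda>h::real^'n. min 1 (2 / \<bar>s x\<bar> * norm h) / norm h powr (N + \<alpha>)"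
    have "(\<lambda>k. I k x) \<longlonglongrightarrow> (LINT h|lborel. (h \<bullet> e) * (indicator {0<..} (s x + h \<bullet> \<nu>) - indicator {0<..} (s x)) / norm h powr (N + \<alpha> + 1))"
      unfolding I_def
    proof (rule integral_dominated_convergence[where w="?w"])
      show "integrable lborel ?w"
      proof (rule integrableI_nonneg)
        show "(\<integral>\<^sup>+h. ennreal (?w h) \<partial>(lborel :: (real^'n) measure)) < \<infinity>"
          using C(2)[of "2 / \<bar>s x\<bar>"] sx by (auto intro: le_less_trans)
      qed auto
      show "AE h in lborel. (\<lambda>k. (h \<bullet> e) * (g k (x + h) - g k x) / norm h powr (N + \<alpha> + 1)) \<longlonglongrightarrow>
          (h \<bullet> e) * (indicator {0<..} (s x + h \<bullet> \<nu>) - indicator {0<..} (s x)) / norm h powr (N + \<alpha> + 1)"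
        unfolding g_inc divide_inverse by (intro AE_I2 tendsto_intros ramp_tendsto)
      show "AE h in lborel. norm ((h \<bullet> e) * (g k (x + h) - g k x) / norm h powr (N + \<alpha> + 1)) \<le> ?w h" for k
      proof (rule AE_I2)
        fix h
        have "norm ((h \<bullet> e) * (g k (x + h) - g k x) / norm h powr (N + \<alpha> + 1)) \<le> norm e * (\<bar>g k (x + h) - g k x\<bar> / norm h powr (N + \<alpha>))"
          by (rule kernel_norm_le)
        also have "\<dots> \<le> ?w h" unfolding e mult_1 by (intro divide_right_mono inc_le sx) simp
        finally show "norm ((h \<bullet> e) * (g k (x + h) - g k x) / norm h powr (N + \<alpha> + 1)) \<le> ?w h" .
      qed
    qed measurable
    also have "(LINT h|lborel. (h \<bullet> e) * (indicator {0<..} (s x + h \<bullet> \<nu>) - indicator {0<..} (s x)) / norm h powr (N + \<alpha> + 1))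
      = c / \<bar>s x\<bar> powr \<alpha>"
      unfolding N_def by (subst integral_half_space_kernel[OF \<alpha> \<nu> sx]) (simp add: c_def e_def inner_axis)
    finally show ?thesis .
  qed
  \<comment> \<open>Here the boundedness of \<open>f\<close> enters. The ball of radius
    \<open>r + 1\<close> contains the supports of all mollified functions.\<close>
  define W where "W x = M\<^sub>f * M * (C * 2 powr \<alpha>) * (indicator (cball 0 (r + 1)) x / \<bar>s x\<bar> powr \<alpha>)" for x
  have W_int: "integrable lborel W"
    unfolding W_def s_def by (intro integrable_mult_right integrable_hyperplane_weight \<alpha> \<nu>)
  have Mf0: "M\<^sub>f \<ge> 0" using f_bound[of 0] by linarith
  have [measurable]: "s \<in> borel_measurable borel" unfolding s_def by measurable
  have dom: "AE x in lborel. norm (f x * (v k x * I k x)) \<le> W x" for k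
    using s_AE
  proof eventually_elim
    case (elim x)
    show ?case
    proof (cases "x \<in> cball 0 (r + 1)")
      case True
      have "norm (f x * (v k x * I k x)) \<le> M\<^sub>f * (M * (C * (2 / \<bar>s x\<bar>) powr \<alpha>))"
        unfolding real_norm_def abs_mult using Mf0 M0 C(1)
        by (intro mult_mono f_bound v_bound I_bound[OF elim]) auto
      also have "\<dots> = W x" using True elim by (simp add: W_def powr_divide)
      finally show ?thesis .
    next
      case False
      then have "v k x = 0" by (intro v_supp) simp
      then show ?thesis using False by (simp add: W_def)
    qed
  qed
  have P_int: "integrable lborel (\<lambda>x. f x * (v k x * I k x))" for k
  proof (rule Bochner_Integration.integrable_bound[OF W_int])
    show "AE x in lborel. norm (f x * (v k x * I k x)) \<le> norm (W x)"
      using dom[of k] by eventually_elim (metis abs_ge_self order_trans real_norm_def)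
  qed measurable
  define P where "P k = (LINT x|lborel. f x * (v k x * I k x))" for k
  have P_lim: "P \<longlonglongrightarrow> (LINT x|lborel. f x * (\<eta> x * (c / \<bar>s x\<bar> powr \<alpha>)))"
    unfolding P_def
  proof (rule integral_dominated_convergence[OF _ _ W_int _ dom])
    show "AE x in lborel. (\<lambda>k. f x * (v k x * I k x)) \<longlonglongrightarrow> f x * (\<eta> x * (c / \<bar>s x\<bar> powr \<alpha>))"
      using s_AE by eventually_elim (intro tendsto_intros v_lim I_lim)
  qed measurable
  define S where "S k = signed_integral (\<lambda>B. D B $ i) (\<lambda>x. v k x * g k x)" for k
  have S_lim: "S \<longlonglongrightarrow> signed_integral (\<lambda>B. D B $ i) (\<lambda>x. \<eta> x * indicator (half_space \<nu> x0) x)"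
    unfolding S_def
  proof (rule signed_integral_dominated_convergence)
    show "(\<lambda>x. \<eta> x * indicator (half_space \<nu> x0) x) \<in> borel_measurable borel"
      unfolding half_space_def by measurable
    show "(\<lambda>k. v k x * g k x) \<longlonglongrightarrow> \<eta> x * indicator (half_space \<nu> x0) x" for x
    proof (intro tendsto_mult v_lim)
      show "(\<lambda>k. g k x) \<longlonglongrightarrow> indicator (half_space \<nu> x0) x"
        using ramp_tendsto[of "(x - x0) \<bullet> \<nu>"] by (simp add: g_def half_space_def indicator_def)
    qed
    show "\<bar>v k x * g k x\<bar> \<le> M" for k x
      using mult_mono[OF v_bound[of k x] g_bound[of k x]] M0 by (simp add: abs_mult)
  qed measurable
  \<comment> \<open>The defining identity of \<open>D\<close>, tested with the field, gives
    \<open>S k + \<mu> * P k\<close> as minus the remainder integral, whose bound does not depend on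
    \<open>k\<close>.\<close>
  have est: "\<bar>S k + \<mu> * P k\<bar> \<le> \<mu> * E" for k
  proof -
    let ?\<phi> = "\<lambda>x. (v k x * g k x) *\<^sub>R e"
    have "?\<phi> \<in> lip_c"
    proof -
      obtain L where "L-lipschitz_on UNIV (v k)" using v_lip by blast
      from lipschitz_mult[OF this g_lip v_bound g_bound] obtain L' where L': "L'-lipschitz_on UNIV (\<lambda>x. v k x * g k x)" by blast
      have "L'-lipschitz_on UNIV ?\<phi>"
        using lipschitz_onD[OF L'] lipschitz_on_nonneg[OF L'] e
        by (intro lipschitz_onI) (auto simp: dist_norm scaleR_left_diff_distrib[symmetric])
      moreover have "bounded {x. ?\<phi> x \<noteq> 0}"
      proof (rule bounded_subset[OF bounded_cball])
        show "{x. ?\<phi> x \<noteq> 0} \<subseteq> cball 0 (r + 1)" using v_supp[of _ k] by (auto simp: not_le intro: less_imp_le ccontr)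
      qed
      ultimately show ?thesis by (auto simp: lip_c_def compactly_supported_def)
    qed
    then have "(LINT x|lebesgue. f x * frac_div \<alpha> ?\<phi> x) = - S k"
      using D by (simp add: has_frac_variation_measure_def vector_integral_axis e_def S_def)
    moreover have "(LINT x|lebesgue. f x * frac_div \<alpha> ?\<phi> x) = \<mu> * (P k + (LINT x|lborel. f x * B k x))"
    proof -
      have "(LINT x|lebesgue. f x * frac_div \<alpha> ?\<phi> x) = (LINT x|lborel. \<mu> * (f x * (v k x * I k x) + f x * B k x))"
        unfolding div by (subst integral_completion, measurable) (simp add: algebra_simps)
      also have "\<dots> = \<mu> * (P k + (LINT x|lborel. f x * B k x))"
        unfolding P_def using P_int fB_int by (simp add: Bochner_Integration.integral_add)
      finally show ?thesis .
    qed
    ultimately have "S k + \<mu> * P k = - (\<mu> * (LINT x|lborel. f x * B k x))" by (simp add: algebra_simps)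
    then show ?thesis using fB_bound[of k] \<mu> by (simp add: abs_mult mult_left_mono)
  qed
  have "(\<lambda>k. \<bar>S k + \<mu> * P k\<bar>) \<longlonglongrightarrow> \<bar>signed_integral (\<lambda>B. D B $ i) (\<lambda>x. \<eta> x * indicator (half_space \<nu> x0) x)
      + \<mu> * (LINT x|lborel. f x * (\<eta> x * (c / \<bar>s x\<bar> powr \<alpha>)))\<bar>"
    by (intro tendsto_intros S_lim P_lim)
  then have "\<bar>signed_integral (\<lambda>B. D B $ i) (\<lambda>x. \<eta> x * indicator (half_space \<nu> x0) x)
      + \<mu> * (LINT x|lborel. f x * (\<eta> x * (c / \<bar>s x\<bar> powr \<alpha>)))\<bar> \<le> \<mu> * E"
    using est by (intro LIMSEQ_le_const2) auto
  moreover have "\<mu> * (LINT x|lborel. f x * (\<eta> x * (c / \<bar>s x\<bar> powr \<alpha>)))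
    = frac_mu 1 \<alpha> / \<alpha> * \<nu> $ i * (LINT x|lborel. f x * \<eta> x / \<bar>(x - x0) \<bullet> \<nu>\<bar> powr \<alpha>)"
  proof -
    have "(LINT x|lborel. f x * (\<eta> x * (c / \<bar>s x\<bar> powr \<alpha>))) = (LINT x|lborel. c * (f x * \<eta> x / \<bar>(x - x0) \<bullet> \<nu>\<bar> powr \<alpha>))"
      by (simp add: s_def mult_ac)
    also have "\<dots> = c * (LINT x|lborel. f x * \<eta> x / \<bar>(x - x0) \<bullet> \<nu>\<bar> powr \<alpha>)"
      by (rule integral_mult_right_zero)
    also have "\<mu> * \<dots> = (\<mu> * kernel_const CARD('n) \<alpha>) / \<alpha> * \<nu> $ i * (LINT x|lborel. f x * \<eta> x / \<bar>(x - x0) \<bullet> \<nu>\<bar> powr \<alpha>)"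
      by (simp add: c_def mult_ac)
    finally show ?thesis unfolding \<mu>_def frac_mu_kernel_const[OF \<alpha>(1)] .
  qed
  ultimately show ?thesis by (simp add: \<mu>_def E_def)
qed

text \<open>Makes the cutoff of the last claim admissible. An increment is at most
  \<open>m h\<close> and lives on two balls of volume \<open>V\<close>, so its norm is at most a
  constant times \<open>m h\<close>.\<close>

lemma lipschitz_besov:
  fixes u :: "real^'n \<Rightarrow> real"
  assumes \<alpha>: "0 < \<alpha>" "\<alpha> < 1" and q: "q = \<infinity> \<or> (q \<noteq> \<infinity> \<and> enn2real q > 1)"
    and L: "L-lipschitz_on UNIV u" and M: "\<And>x. \<bar>u x\<bar> \<le> M" and supp: "\<And>x. norm x \<ge> r \<Longrightarrow> u x = 0"
  shows "besov_seminorm \<alpha> q u < \<infinity>"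
proof -
  have [measurable]: "u \<in> borel_measurable borel" using L by (rule lipschitz_borel_measurable)
  obtain C where C: "C \<ge> 0" "\<And>t. t > 0 \<Longrightarrow> (\<integral>\<^sup>+h. ennreal (min 1 (t * norm (h::real^'n)) / norm h powr (real CARD('n) + \<alpha>)) \<partial>lborel)
       \<le> ennreal (C * t powr \<alpha>)"
    using nn_integral_kernel_bound[OF \<alpha>] by blast
  define A t where "A = 2 * M + 1" and "t = L + 1"
  have t: "t > 0" using lipschitz_on_nonneg[OF L] by (simp add: t_def)
  have A: "A \<ge> 1" using M[of 0] by (simp add: A_def)
  define m where "m h = A * min 1 (t * norm h)" for h :: "real^'n"
  have m0: "m h \<ge> 0" for h using A t by (simp add: m_def)
  have inc: "\<bar>u (x + h) - u x\<bar> \<le> m h" for x h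
    unfolding m_def A_def t_def by (rule lipschitz_increment[OF L M])
  define V where "V = measure lborel (ball (0::real^'n) r)"
  have V: "emeasure lborel (ball (0::real^'n) r) = ennreal V"
    using emeasure_bounded_finite[of "ball (0::real^'n) r"] by (simp add: V_def emeasure_eq_ennreal_measure)
  have V0: "V \<ge> 0" by (simp add: V_def)
  \<comment> \<open>Serves both kinds of exponent: the summand 1 covers the supremum norm, the other
    one the two balls when \<open>q\<close> is finite.\<close>
  define K where "K = 1 + (2 * V) powr (1 / enn2real q)"
  have K: "K \<ge> 1" by (simp add: K_def)
  have Lp: "Lp_norm q (\<lambda>x. u (x + h) - u x) \<le> ennreal (K * m h)" for h
  proof (cases "q = \<infinity>")
    case True
    have "AE x in lborel. ennreal (norm (u (x + h) - u x)) \<le> ennreal (K * m h)"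
    proof (rule AE_I2)
      fix x
      have "norm (u (x + h) - u x) \<le> 1 * m h" using inc[of x h] by simp
      also have "\<dots> \<le> K * m h" by (intro mult_right_mono K m0)
      finally show "ennreal (norm (u (x + h) - u x)) \<le> ennreal (K * m h)" by (rule ennreal_leI)
    qed
    then show ?thesis unfolding True by (subst Lp_norm_top_le_iff) (auto intro!: measurable_completion)
  next
    case False
    have [measurable]: "ball (0::real^'n) r \<in> sets borel" by simp
    define b where "b = enn2real q"
    have b: "b > 1" using q False by (simp add: b_def)
    define I where "I = (\<integral>\<^sup>+x. ennreal (norm (u (x + h) - u x) powr b) \<partial>lborel)"
    have "I \<le> (\<integral>\<^sup>+x. ennreal (m h powr b) * (indicator (ball 0 r) (h + x) + indicator (ball 0 r) x) \<partial>lborel)"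
      unfolding I_def
    proof (rule nn_integral_mono)
      fix x
      have le: "norm (u (x + h) - u x) powr b \<le> m h powr b"
        using inc[of x h] b by (intro powr_mono2) auto
      consider "h + x \<in> ball 0 r" | "x \<in> ball 0 r" | "u (x + h) = 0" "u x = 0"
        using supp[of "x + h"] supp[of x] by (force simp: add.commute)
      then show "ennreal (norm (u (x + h) - u x) powr b) \<le> ennreal (m h powr b) * (indicator (ball 0 r) (h + x) + indicator (ball 0 r) x)"
        using ennreal_leI[OF le] by cases (auto simp: distrib_left add_increasing add_increasing2)
    qed
    also have "\<dots> = ennreal (m h powr b) * (\<integral>\<^sup>+x. indicator (ball 0 r) (h + x) + indicator (ball 0 r) x \<partial>lborel)"
      by (rule nn_integral_cmult) measurable
    also have "(\<integral>\<^sup>+x. indicator (ball 0 r) (h + x) + indicator (ball 0 r) x \<partial>lborel) = ennreal V + ennreal V"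
    proof -
      have "(\<integral>\<^sup>+x. indicator (ball 0 r) (h + x) \<partial>lborel) = ennreal V"
        using nn_integral_lborel_shift[of "indicator (ball (0::real^'n) r)" h] by (simp add: V)
      then show ?thesis by (subst nn_integral_add) (simp_all add: V)
    qed
    also have "ennreal (m h powr b) * (ennreal V + ennreal V) = ennreal (m h powr b * (2 * V))"
      using V0 by (simp add: ennreal_mult ennreal_plus[symmetric] del: ennreal_plus)
    finally have I: "I \<le> ennreal (m h powr b * (2 * V))" .
    then have "I \<noteq> \<infinity>" by (auto simp: top_unique)
    moreover have "enn2real I \<le> m h powr b * (2 * V)"
      using I V0 by (intro enn2real_leI) auto
    ultimately have "Lp_norm q (\<lambda>x. u (x + h) - u x) \<le> ennreal ((m h powr b * (2 * V)) powr (1 / b))"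
      unfolding Lp_norm_fin[OF False] b_def[symmetric] I_def[symmetric] Let_def
      using b by (auto intro!: ennreal_leI powr_mono2)
    also have "(m h powr b * (2 * V)) powr (1 / b) = m h * (2 * V) powr (1 / b)"
      using b m0[of h] V0 by (simp add: powr_mult powr_powr)
    also have "ennreal \<dots> \<le> ennreal (K * m h)"
      using m0[of h] by (intro ennreal_leI) (simp add: K_def b_def algebra_simps)
    finally show ?thesis .
  qed
  have "besov_seminorm \<alpha> q u \<le> (\<integral>\<^sup>+h. ennreal (K * A) * ennreal (min 1 (t * norm (h::real^'n)) / norm h powr (real CARD('n) + \<alpha>)) \<partial>lborel)"
    unfolding besov_seminorm_lborel
  proof (rule nn_integral_mono)
    fix h :: "real^'n"
    have "Lp_norm q (\<lambda>x. u (x + h) - u x) * ennreal (1 / norm h powr (real CARD('n) + \<alpha>))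
      \<le> ennreal (K * m h) * ennreal (1 / norm h powr (real CARD('n) + \<alpha>))"
      by (intro mult_right_mono Lp) simp
    also have "\<dots> = ennreal (K * A) * ennreal (min 1 (t * norm h) / norm h powr (real CARD('n) + \<alpha>))"
      using K A t m0[of h] by (simp add: ennreal_mult[symmetric] m_def)
    finally show "Lp_norm q (\<lambda>x. u (x + h) - u x) * ennreal (1 / norm h powr (real CARD('n) + \<alpha>))
      \<le> ennreal (K * A) * ennreal (min 1 (t * norm h) / norm h powr (real CARD('n) + \<alpha>))" .
  qed
  also have "\<dots> = ennreal (K * A) * (\<integral>\<^sup>+h. ennreal (min 1 (t * norm (h::real^'n)) / norm h powr (real CARD('n) + \<alpha>)) \<partial>lborel)"
    by (rule nn_integral_cmult) measurable
  also have "\<dots> < \<infinity>"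
    using C(2)[OF t] by (auto simp: ennreal_mult_less_top intro: le_less_trans)
  finally show ?thesis .
qed

section \<open>Letting the dilation parameter tend to infinity\<close>

lemma integrable_weighted:
  fixes \<nu> x0 :: "real^'n" and u :: "real^'n \<Rightarrow> real"
  assumes \<alpha>: "0 < \<alpha>" "\<alpha> < 1" and \<nu>: "norm \<nu> = 1" and [measurable]: "u \<in> borel_measurable borel"
    and M: "AE x in lborel. \<bar>u x\<bar> \<le> M" and supp: "AE x in lborel. norm x > r \<longrightarrow> u x = 0"
  shows "integrable lborel (\<lambda>x. u x / \<bar>(x - x0) \<bullet> \<nu>\<bar> powr \<alpha>)"
proof (rule Bochner_Integration.integrable_bound)
  show "integrable lborel (\<lambda>x. M * (indicator (cball 0 r) x / \<bar>(x - x0) \<bullet> \<nu>\<bar> powr \<alpha>))"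
    by (intro integrable_mult_right integrable_hyperplane_weight \<alpha> \<nu>)
  show "AE x in lborel. norm (u x / \<bar>(x - x0) \<bullet> \<nu>\<bar> powr \<alpha>) \<le> norm (M * (indicator (cball 0 r) x / \<bar>(x - x0) \<bullet> \<nu>\<bar> powr \<alpha>))"
    using M supp
  proof eventually_elim
    case (elim x)
    have "\<bar>u x\<bar> \<le> \<bar>M * indicator (cball 0 r) x\<bar>" using elim by (cases "norm x \<le> r") (auto simp: indicator_def)
    then have "\<bar>u x\<bar> / \<bar>(x - x0) \<bullet> \<nu>\<bar> powr \<alpha> \<le> \<bar>M * indicator (cball 0 r) x\<bar> / \<bar>(x - x0) \<bullet> \<nu>\<bar> powr \<alpha>"
      by (rule divide_right_mono) simp
    then show ?case by (simp add: abs_mult)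
  qed
qed measurable

lemma half_space_limit:
  fixes f \<eta> :: "real^'n \<Rightarrow> real" and D :: "(real^'n) set \<Rightarrow> real^'n" and \<nu> x0 :: "real^'n"
  assumes \<alpha>: "0 < \<alpha>" "\<alpha> < 1" and pq: "1 \<le> p" "p \<noteq> \<infinity>" "1 / p + 1 / q = 1" and q: "real CARD('n) / enn2real q < \<alpha>"
    and f: "f \<in> borel_measurable borel" and f_bound: "\<And>x. \<bar>f x\<bar> \<le> M\<^sub>f" and fp: "Lp_norm p f < \<infinity>"
    and D: "has_frac_variation_measure \<alpha> f D"
    and \<eta>: "continuous_on UNIV \<eta>" and supp: "\<And>x. norm x \<ge> r \<Longrightarrow> \<eta> x = 0" and bes: "besov_seminorm \<alpha> q \<eta> < \<infinity>"
    and \<nu>: "norm \<nu> = 1"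
  shows "((\<lambda>R. frac_mu 1 \<alpha> / \<alpha> * \<nu> $ i * (LINT x|lborel. f x * \<eta> (x /\<^sub>R R) / \<bar>(x - x0) \<bullet> \<nu>\<bar> powr \<alpha>))
    \<longlongrightarrow> - (\<eta> 0 * D (half_space \<nu> x0) $ i)) at_top"
proof (rule tendsto_at_topI_sequentially)
  \<comment> \<open>Dominated convergence for \<open>signed_integral\<close> concerns sequences, so
    the limit in \<open>R\<close> is tested along an arbitrary sequence tending to infinity.\<close>
  fix X :: "nat \<Rightarrow> real" assume X: "filterlim X at_top sequentially"
  have [measurable]: "\<eta> \<in> borel_measurable borel" using \<eta> by (rule borel_measurable_continuous_onI)
  interpret signed_borel_measure "\<lambda>B. D B $ i"
    using D by (intro signed_borel_measure_component) (simp add: has_frac_variation_measure_def)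
  define J where "J R = frac_mu 1 \<alpha> / \<alpha> * \<nu> $ i * (LINT x|lborel. f x * \<eta> (x /\<^sub>R R) / \<bar>(x - x0) \<bullet> \<nu>\<bar> powr \<alpha>)" for R
  define S where "S R = signed_integral (\<lambda>B. D B $ i) (\<lambda>x. \<eta> (x /\<^sub>R R) * indicator (half_space \<nu> x0) x)" for R
  define K where "K = frac_mu CARD('n) \<alpha> * enn2real (Lp_norm p f * besov_seminorm \<alpha> q \<eta>)"
  define \<gamma> where "\<gamma> = real CARD('n) / enn2real q - \<alpha>"
  have hs[measurable]: "half_space \<nu> x0 \<in> sets borel" unfolding half_space_def by measurable
  have inv: "((\<lambda>k. inverse (X k)) \<longlongrightarrow> 0) sequentially"
    by (rule tendsto_inverse_0_at_top[OF X])
  have est: "\<bar>S R + J R\<bar> \<le> K * R powr \<gamma>" if R: "R > 0" for R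
  proof -
    have b: "besov_seminorm \<alpha> q (\<lambda>x. \<eta> (x /\<^sub>R R)) = ennreal (R powr \<gamma>) * besov_seminorm \<alpha> q \<eta>"
      unfolding \<gamma>_def using R by (intro besov_seminorm_scale) auto
    have "\<bar>S R + J R\<bar> \<le> frac_mu CARD('n) \<alpha> * enn2real (Lp_norm p f * besov_seminorm \<alpha> q (\<lambda>x. \<eta> (x /\<^sub>R R)))"
      unfolding S_def J_def
    proof (rule half_space_estimate[OF \<alpha> pq f f_bound fp D _ _ _ \<nu>])
      show "continuous_on UNIV (\<lambda>x. \<eta> (x /\<^sub>R R))"
        by (rule continuous_on_compose2[OF \<eta>]) (auto intro!: continuous_intros)
      show "\<eta> (x /\<^sub>R R) = 0" if "norm x \<ge> R * r" for x
        using R that by (intro supp) (simp add: field_simps)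
      show "besov_seminorm \<alpha> q (\<lambda>x. \<eta> (x /\<^sub>R R)) < \<infinity>"
        unfolding b using bes by (simp add: ennreal_mult_less_top)
    qed
    also have "\<dots> = K * R powr \<gamma>"
      unfolding b K_def by (simp add: enn2real_mult mult_ac)
    finally show ?thesis .
  qed
  have "(\<lambda>k. K * X k powr \<gamma>) \<longlonglongrightarrow> K * 0"
    using q X by (intro tendsto_mult tendsto_const tendsto_neg_powr) (auto simp: \<gamma>_def)
  then have lim0: "(\<lambda>k. K * X k powr \<gamma>) \<longlonglongrightarrow> 0" by simp
  have SJ: "(\<lambda>k. S (X k) + J (X k)) \<longlonglongrightarrow> 0"
  proof (rule Lim_null_comparison[OF _ lim0])
    have "eventually (\<lambda>k. X k > 0) sequentially" using X by (simp add: filterlim_at_top_dense)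
    then show "eventually (\<lambda>k. norm (S (X k) + J (X k)) \<le> K * X k powr \<gamma>) sequentially"
      by eventually_elim (use est in auto)
  qed
  obtain M where M: "\<And>x. \<bar>\<eta> x\<bar> \<le> M" using continuous_compact_support_bounded[OF \<eta> supp] by blast
  have "(\<lambda>k. S (X k)) \<longlonglongrightarrow> signed_integral (\<lambda>B. D B $ i) (\<lambda>x. \<eta> 0 * indicator (half_space \<nu> x0) x)"
    unfolding S_def
  proof (rule signed_integral_dominated_convergence)
    show "(\<lambda>k. \<eta> (x /\<^sub>R X k) * indicator (half_space \<nu> x0) x) \<longlonglongrightarrow> \<eta> 0 * indicator (half_space \<nu> x0) x" for x
    proof (intro tendsto_mult tendsto_const)
      have "(\<lambda>k. x /\<^sub>R X k) \<longlonglongrightarrow> 0 *\<^sub>R x" by (intro tendsto_scaleR inv tendsto_const)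
      then have "(\<lambda>k. x /\<^sub>R X k) \<longlonglongrightarrow> 0" by simp
      then show "(\<lambda>k. \<eta> (x /\<^sub>R X k)) \<longlonglongrightarrow> \<eta> 0"
        using \<eta> by (intro isCont_tendsto_compose[of 0 \<eta>]) (simp_all add: continuous_on_eq_continuous_at)
    qed
    show "\<bar>\<eta> (x /\<^sub>R X k) * indicator (half_space \<nu> x0) x\<bar> \<le> M" for k x
      using M[of "x /\<^sub>R X k"] M[of 0] by (auto simp: indicator_def)
  qed measurable
  then have S_lim: "(\<lambda>k. S (X k)) \<longlonglongrightarrow> \<eta> 0 * D (half_space \<nu> x0) $ i"
    by (simp add: signed_integral_indicator)
  have "(\<lambda>k. (S (X k) + J (X k)) - S (X k)) \<longlonglongrightarrow> 0 - \<eta> 0 * D (half_space \<nu> x0) $ i"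
    by (intro tendsto_diff SJ S_lim)
  then show "(\<lambda>k. J (X k)) \<longlonglongrightarrow> - (\<eta> 0 * D (half_space \<nu> x0) $ i)" by simp
qed

section \<open>Representatives\<close>

text \<open>Completeness of Lebesgue measure: the exceptional part of each preimage lies in a null
  set and is therefore measurable.\<close>

lemma borel_measurable_lebesgue_AE:
  fixes g g' :: "'a::euclidean_space \<Rightarrow> 'b::topological_space"
  assumes g': "g' \<in> borel_measurable borel" and ae: "AE x in lborel. g x = g' x"
  shows "g \<in> borel_measurable lebesgue"
proof (rule measurableI)
  fix A :: "'b set" assume A: "A \<in> sets borel"
  obtain Z where Z: "Z \<in> null_sets (lborel :: 'a measure)" "{x. g x \<noteq> g' x} \<subseteq> Z"
    using ae by (auto simp: eventually_ae_filter)
  have Z': "Z \<in> null_sets (lebesgue :: 'a measure)" using Z(1) by (rule null_sets_completionI)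
  have "g' \<in> borel_measurable lebesgue" using g' by (simp add: measurable_completion)
  then have "g' -` A \<in> sets lebesgue" using measurable_sets[of g' lebesgue borel A] A by simp
  then have "g' -` A - Z \<in> sets lebesgue" using Z' by (intro sets.Diff) auto
  moreover have "g -` A \<inter> Z \<in> sets lebesgue"
    by (rule null_setsD2, rule null_sets_completion_subset[OF _ Z']) auto
  ultimately have "(g' -` A - Z) \<union> (g -` A \<inter> Z) \<in> sets lebesgue" by (rule sets.Un)
  moreover have "(g' -` A - Z) \<union> (g -` A \<inter> Z) = g -` A" using Z(2) by auto
  ultimately show "g -` A \<inter> space lebesgue \<in> sets lebesgue" by simp
qed simp

lemma AE_lborel_shift:
  fixes h :: "'a::euclidean_space"
  assumes "AE x in lborel. P x"
  shows "AE x in lborel. P (x + h)"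
proof -
  have "AE x in distr lborel borel ((+) h). P x" using assms by (subst lborel_distr_plus)
  from AE_distrD[OF _ this] show ?thesis by (simp add: add.commute)
qed

lemma AE_lborel_scale:
  fixes P :: "'a::euclidean_space \<Rightarrow> bool"
  assumes "AE x in lborel. P x" and R: "R > 0"
  shows "AE x in lborel. P (x /\<^sub>R R)"
proof -
  have "AE x in density (distr lborel borel (\<lambda>x. 0 + inverse R *\<^sub>R x)) (\<lambda>_. ennreal (\<bar>inverse R\<bar> ^ DIM('a))). P x"
    using assms by (subst lborel_affine[of "inverse R" 0, symmetric]) simp_all
  then have "AE x in distr lborel borel (\<lambda>x. 0 + inverse R *\<^sub>R x). P x"
    using R by (simp add: AE_density)
  from AE_distrD[OF _ this] show ?thesis by simp
qed

text \<open>The union defining the complement of the support may be uncountable; Lindelof's theorem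
  extracts a countable subfamily, so the exceptional null sets can be united.\<close>

lemma AE_zero_outside_ess_support:
  fixes u :: "real^'n \<Rightarrow> real"
  shows "AE x in lborel. x \<notin> ess_support u \<longrightarrow> u x = 0"
proof -
  define \<F> where "\<F> = {U. open U \<and> (AE x in lborel. x \<in> U \<longrightarrow> u x = 0)}"
  obtain \<F>' where F: "\<F>' \<subseteq> \<F>" "countable \<F>'" "\<Union>\<F>' = \<Union>\<F>"
    by (rule Lindelof[of \<F>]) (auto simp: \<F>_def)
  have "AE x in lborel. \<forall>U\<in>\<F>'. x \<in> U \<longrightarrow> u x = 0"
    using F(1,2) by (subst AE_ball_countable) (auto simp: \<F>_def)
  then show ?thesis
  proof eventually_elim
    case (elim x)
    have "ess_support u = - \<Union>\<F>'" unfolding F(3) by (simp add: ess_support_def \<F>_def AE_completion_iff)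
    then show ?case using elim by auto
  qed
qed

text \<open>Otherwise \<open>v\<close> would be nonzero on a nonempty open set where it vanishes
  almost everywhere, but nonempty open sets are not negligible.\<close>

lemma continuous_representative_zero:
  fixes u v :: "real^'n \<Rightarrow> real"
  assumes rep: "continuous_representative u v" and x: "x \<notin> ess_support u"
  shows "v x = 0"
proof (rule ccontr)
  assume "v x \<noteq> 0"
  obtain U where U: "open U" "AE y in lborel. y \<in> U \<longrightarrow> u y = 0" "x \<in> U"
    using x by (auto simp: ess_support_def AE_completion_iff)
  have v: "continuous_on UNIV v" "AE y in lborel. u y = v y"
    using rep by (auto simp: continuous_representative_def AE_completion_iff)
  define W where "W = U \<inter> {y. v y \<noteq> 0}"
  have "open W" unfolding W_def
    using U(1) v(1) by (intro open_Int open_Collect_neq) (auto intro: continuous_intros)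
  moreover have "x \<in> W" using U \<open>v x \<noteq> 0\<close> by (simp add: W_def)
  ultimately have "\<not> negligible W" using open_not_negligible by blast
  moreover have "AE y in lborel. y \<notin> W" using U(2) v(2) by eventually_elim (auto simp: W_def)
  then have "AE y in lebesgue. y \<notin> W" by (simp add: AE_completion_iff)
  then have "negligible W"
    using \<open>open W\<close> by (simp add: negligible_iff_null_sets AE_iff_null_sets[symmetric])
  ultimately show False by simp
qed

lemma besov_seminorm_representative:
  fixes u v :: "real^'n \<Rightarrow> real"
  assumes [measurable]: "v \<in> borel_measurable borel" and ae: "AE x in lborel. u x = v x"
  shows "besov_seminorm \<alpha> q u = besov_seminorm \<alpha> q v"
proof -
  have "Lp_norm q (\<lambda>x. u (x + h) - u x) = Lp_norm q (\<lambda>x. v (x + h) - v x)" for h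
  proof -
    have 1: "AE x in lborel. u (x + h) - u x = v (x + h) - v x"
      using ae AE_lborel_shift[OF ae, of h] by eventually_elim simp
    have m: "(\<lambda>x. v (x + h) - v x) \<in> borel_measurable borel" by measurable
    show ?thesis
      by (rule Lp_norm_cong_AE[OF borel_measurable_lebesgue_AE[OF m 1] _ 1]) (use m in \<open>simp add: measurable_completion\<close>)
  qed
  then show ?thesis by (simp add: besov_seminorm_def)
qed

lemma borel_measurable_frac_div:
  fixes \<phi> :: "real^'n \<Rightarrow> real^'n"
  assumes [measurable]: "\<phi> \<in> borel_measurable borel"
  shows "frac_div \<alpha> \<phi> \<in> borel_measurable borel"
proof -
  have "frac_div \<alpha> \<phi> = (\<lambda>x. frac_mu CARD('n) \<alpha> *
     (LINT y|lborel. ((y - x) \<bullet> (\<phi> y - \<phi> x)) / norm (y - x) powr (real CARD('n) + \<alpha> + 1)))"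
    unfolding frac_div_def by (subst integral_completion) simp_all
  also have "\<dots> \<in> borel_measurable borel" by measurable
  finally show ?thesis .
qed

text \<open>Truncating a Borel version of \<open>f\<close> at its essential bound alters it on a
  null set, which affects neither norms nor the integrals against fractional divergences; afterwards
  the bound holds at every point.\<close>

lemma bounded_borel_representative:
  fixes f :: "real^'n \<Rightarrow> real" and D :: "(real^'n) set \<Rightarrow> real^'n"
  assumes f: "f \<in> Lp_space \<infinity>" and D: "has_frac_variation_measure \<alpha> f D"
  obtains f' M where "f' \<in> borel_measurable borel" "\<And>x. \<bar>f' x\<bar> \<le> M" "AE x in lborel. f x = f' x"
    "Lp_norm p f' = Lp_norm p f" "has_frac_variation_measure \<alpha> f' D"
proof -
  have fm: "f \<in> borel_measurable lebesgue" and fin: "Lp_norm \<infinity> f < \<infinity>" using f by (auto simp: Lp_space_def)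
  obtain f0 where f0[measurable]: "f0 \<in> borel_measurable lborel" "AE x in lborel. f x = f0 x"
    using completion_ex_borel_measurable_real[OF fm] by blast
  define M where "M = enn2real (Lp_norm \<infinity> f)"
  have M: "Lp_norm \<infinity> f = ennreal M" "M \<ge> 0" using fin by (auto simp: M_def ennreal_enn2real_if)
  have bnd: "AE x in lborel. ennreal (norm (f x)) \<le> ennreal M"
    using Lp_norm_top_le_iff[OF fm, of "ennreal M"] M by simp
  define f' where "f' x = (if \<bar>f0 x\<bar> \<le> M then f0 x else 0)" for x
  have f'm[measurable]: "f' \<in> borel_measurable borel" using f0(1) unfolding f'_def by simp
  have ae: "AE x in lborel. f x = f' x" using f0(2) bnd
    by eventually_elim (use M(2) in \<open>auto simp: f'_def ennreal_le_iff\<close>)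
  have f'l: "f' \<in> borel_measurable lebesgue" by (simp add: measurable_completion)
  have "(LINT x|lebesgue. f' x * frac_div \<alpha> \<phi> x) = (LINT x|lebesgue. f x * frac_div \<alpha> \<phi> x)" if \<phi>: "\<phi> \<in> lip_c" for \<phi>
  proof (rule integral_cong_AE)
    obtain L where "L-lipschitz_on UNIV \<phi>" using \<phi> by (auto simp: lip_c_def)
    then have "\<phi> \<in> borel_measurable borel"
      by (intro borel_measurable_continuous_onI lipschitz_on_continuous_on)
    then have "frac_div \<alpha> \<phi> \<in> borel_measurable lebesgue"
      by (intro measurable_completion) (simp add: borel_measurable_frac_div)
    then show "(\<lambda>x. f' x * frac_div \<alpha> \<phi> x) \<in> borel_measurable lebesgue" "(\<lambda>x. f x * frac_div \<alpha> \<phi> x) \<in> borel_measurable lebesgue"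
      using fm f'l by (auto intro: borel_measurable_times)
    show "AE x in lebesgue. f' x * frac_div \<alpha> \<phi> x = f x * frac_div \<alpha> \<phi> x"
      using ae unfolding AE_completion_iff by eventually_elim simp
  qed
  then have "has_frac_variation_measure \<alpha> f' D" using D by (simp add: has_frac_variation_measure_def)
  moreover have "Lp_norm p f' = Lp_norm p f"
    by (rule Lp_norm_cong_AE[OF f'l fm]) (use ae in eventually_elim, simp)
  moreover have "\<bar>f' x\<bar> \<le> M" for x using M(2) by (auto simp: f'_def)
  ultimately show thesis using that f'm ae by blast
qed

text \<open>Every vector integrand of the theorem is almost everywhere a scalar Borel function times
  the fixed vector \<nu>, so the analysis can be scalar and over \<open>lborel\<close>.\<close>

lemma integral_lebesgue_weighted:
  fixes w :: "real^'n \<Rightarrow> real" and W :: "real^'n \<Rightarrow> real^'n"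
  assumes w: "integrable lborel w" and ae: "AE x in lborel. W x = w x *\<^sub>R \<nu>"
  shows "integrable lebesgue W" "(LINT x|lebesgue. W x) = (LINT x|lborel. w x) *\<^sub>R \<nu>"
proof -
  have wm[measurable]: "w \<in> borel_measurable borel" using w by (simp add: borel_measurable_integrable)
  have i: "integrable lborel (\<lambda>x. w x *\<^sub>R \<nu>)" using w by simp
  have m: "(\<lambda>x. w x *\<^sub>R \<nu>) \<in> borel_measurable borel" by measurable
  have ml: "(\<lambda>x. w x *\<^sub>R \<nu>) \<in> borel_measurable lebesgue" using m by (simp add: measurable_completion)
  have Wm: "W \<in> borel_measurable lebesgue" by (rule borel_measurable_lebesgue_AE[OF m ae])
  have ael: "AE x in lebesgue. W x = w x *\<^sub>R \<nu>" using ae by (simp only: AE_completion_iff)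
  have "integrable lebesgue (\<lambda>x. w x *\<^sub>R \<nu>)" using i m by (simp add: integrable_completion)
  then show "integrable lebesgue W" using integrable_cong_AE[OF Wm ml ael] by simp
  have "(LINT x|lebesgue. W x) = (LINT x|lebesgue. w x *\<^sub>R \<nu>)" by (rule integral_cong_AE[OF Wm ml ael])
  also have "\<dots> = (LINT x|lborel. w x *\<^sub>R \<nu>)" using m by (intro integral_completion) simp
  also have "\<dots> = (LINT x|lborel. w x) *\<^sub>R \<nu>" using w by simp
  finally show "(LINT x|lebesgue. W x) = (LINT x|lborel. w x) *\<^sub>R \<nu>" .
qed

section \<open>The limit formula and its cutoff-free version\<close>

theorem theorem1p6:
  fixes \<alpha> :: real and p q :: ennreal
    and f :: "real^'n \<Rightarrow> real" and D :: "(real^'n) set \<Rightarrow> real^'n"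
  assumes "0 < \<alpha>" and "\<alpha> < 1"
    and "1 \<le> p" and "p < ennreal (real CARD('n) / (real CARD('n) - \<alpha>))"
    and "ennreal (real CARD('n) / \<alpha>) < q"
    and "1 / p + 1 / q = 1"
    and "f \<in> frac_BV \<alpha> p \<inter> Lp_space \<infinity>"
    and "has_frac_variation_measure \<alpha> f D"
  shows "(\<forall>\<eta> \<eta>c. \<eta> \<in> besov_space \<alpha> q \<longrightarrow> compact (ess_support \<eta>) \<longrightarrow>
            continuous_representative \<eta> \<eta>c \<longrightarrow>
            (\<forall>\<nu> x0 :: real^'n. norm \<nu> = 1 \<longrightarrow>
              (\<forall>R>0. integrable lebesgue
                 (\<lambda>x. \<eta> (x /\<^sub>R R) *\<^sub>R ((f x / \<bar>(x - x0) \<bullet> \<nu>\<bar> powr \<alpha>) *\<^sub>R \<nu>))) \<and>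
              ((\<lambda>R. (frac_mu 1 \<alpha> / \<alpha>) *\<^sub>R
                  (LINT x|lebesgue. \<eta> (x /\<^sub>R R) *\<^sub>R ((f x / \<bar>(x - x0) \<bullet> \<nu>\<bar> powr \<alpha>) *\<^sub>R \<nu>)))
                \<longlongrightarrow> - (\<eta>c 0 *\<^sub>R D (half_space \<nu> x0))) at_top))
       \<and> (bounded (ess_support f) \<or> (AE x in lebesgue. f x \<ge> 0) \<or> (AE x in lebesgue. f x \<le> 0) \<longrightarrow>
            (\<forall>\<nu> x0 :: real^'n. norm \<nu> = 1 \<longrightarrow>
              integrable lebesgue (\<lambda>x. (f x / \<bar>(x - x0) \<bullet> \<nu>\<bar> powr \<alpha>) *\<^sub>R \<nu>) \<and>
              (frac_mu 1 \<alpha> / \<alpha>) *\<^sub>R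
                 (LINT x|lebesgue. (f x / \<bar>(x - x0) \<bullet> \<nu>\<bar> powr \<alpha>) *\<^sub>R \<nu>)
               = - D (half_space \<nu> x0)))"
proof -
  note \<alpha> = assms(1,2)
  have p: "p \<noteq> \<infinity>" using assms(4) by auto
  note pq = assms(3) p assms(6)
  have q_cases: "q = \<infinity> \<or> (q \<noteq> \<infinity> \<and> enn2real q > 1)" using conjugate_exponents[OF pq] by auto
  have q: "real CARD('n) / enn2real q < \<alpha>"
  proof (cases "q = \<infinity>")
    \<comment> \<open>Here \<open>enn2real q = 0\<close>, so the quotient is 0 by the convention for
      division by zero.\<close>
    case True then show ?thesis using \<alpha> by simp
  next
    case False
    then have q1: "enn2real q > 1" using q_cases by simp
    have "q = ennreal (enn2real q)" using False by (simp add: ennreal_enn2real_if)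
    then have "real CARD('n) / \<alpha> < enn2real q"
      using assms(5) \<alpha> by (metis divide_nonneg_pos ennreal_less_iff of_nat_0_le_iff)
    then show ?thesis using \<alpha> q1 by (simp add: field_simps)
  qed
  obtain f' M where f'[measurable]: "f' \<in> borel_measurable borel" and f'_bound: "\<And>x. \<bar>f' x\<bar> \<le> M"
    and ff': "AE x in lborel. f x = f' x" and f'p: "Lp_norm p f' = Lp_norm p f" and D: "has_frac_variation_measure \<alpha> f' D"
    using bounded_borel_representative[OF _ assms(8)] assms(7) by (metis IntD2)
  have fp: "Lp_norm p f' < \<infinity>" using assms(7) unfolding f'p by (auto simp: frac_BV_def Lp_space_def)
  have M0: "M \<ge> 0" using f'_bound[of 0] by linarith
  note limit = half_space_limit[OF \<alpha> pq q f' f'_bound fp D]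
  have scaled_int: "integrable lborel (\<lambda>x. f' x * \<eta> (x /\<^sub>R R) / \<bar>(x - x0) \<bullet> \<nu>\<bar> powr \<alpha>)"
    if \<eta>: "continuous_on UNIV \<eta>" and supp: "\<And>x. norm x \<ge> r \<Longrightarrow> \<eta> x = 0" and R: "R > 0" and \<nu>: "norm \<nu> = 1"
    for \<eta> :: "real^'n \<Rightarrow> real" and r R and \<nu> x0 :: "real^'n"
  proof -
    have [measurable]: "\<eta> \<in> borel_measurable borel" using \<eta> by (rule borel_measurable_continuous_onI)
    obtain B where B: "\<And>x. \<bar>\<eta> x\<bar> \<le> B" using continuous_compact_support_bounded[OF \<eta> supp] by blast
    have "\<eta> (x /\<^sub>R R) = 0" if "norm x > R * r" for x
      using R that by (intro supp) (simp add: field_simps)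
    moreover have "\<bar>f' x * \<eta> (x /\<^sub>R R)\<bar> \<le> M * B" for x
      using mult_mono[OF f'_bound B[of "x /\<^sub>R R"] M0] by (simp add: abs_mult)
    ultimately show ?thesis
      by (intro integrable_weighted[where M="M * B" and r="R * r"] \<alpha> \<nu> AE_I2) auto
  qed
  have part1: "(\<forall>R>0. integrable lebesgue (\<lambda>x. \<eta> (x /\<^sub>R R) *\<^sub>R ((f x / \<bar>(x - x0) \<bullet> \<nu>\<bar> powr \<alpha>) *\<^sub>R \<nu>))) \<and>
      ((\<lambda>R. (frac_mu 1 \<alpha> / \<alpha>) *\<^sub>R
          (LINT x|lebesgue. \<eta> (x /\<^sub>R R) *\<^sub>R ((f x / \<bar>(x - x0) \<bullet> \<nu>\<bar> powr \<alpha>) *\<^sub>R \<nu>)))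
        \<longlongrightarrow> - (\<eta>c 0 *\<^sub>R D (half_space \<nu> x0))) at_top"
    if \<eta>: "\<eta> \<in> besov_space \<alpha> q" "compact (ess_support \<eta>)" "continuous_representative \<eta> \<eta>c" and \<nu>: "norm \<nu> = 1"
    for \<eta> \<eta>c :: "real^'n \<Rightarrow> real" and \<nu> x0 :: "real^'n"
  proof -
    have \<eta>c: "continuous_on UNIV \<eta>c" and ae: "AE x in lborel. \<eta> x = \<eta>c x"
      using \<eta>(3) by (auto simp: continuous_representative_def AE_completion_iff)
    have m: "\<eta>c \<in> borel_measurable borel" using \<eta>c by (rule borel_measurable_continuous_onI)
    obtain r where r: "ess_support \<eta> \<subseteq> ball 0 r" using compact_imp_bounded[OF \<eta>(2)] bounded_subset_ballD by blast
    have supp: "\<eta>c x = 0" if "norm x \<ge> r" for x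
      using r that by (intro continuous_representative_zero[OF \<eta>(3)]) auto
    have bes: "besov_seminorm \<alpha> q \<eta>c < \<infinity>"
      using \<eta>(1) unfolding besov_seminorm_representative[OF m ae, symmetric] by (simp add: besov_space_def)
    define J where "J R = (LINT x|lborel. f' x * \<eta>c (x /\<^sub>R R) / \<bar>(x - x0) \<bullet> \<nu>\<bar> powr \<alpha>)" for R
    have aeR: "AE x in lborel. \<eta> (x /\<^sub>R R) *\<^sub>R ((f x / \<bar>(x - x0) \<bullet> \<nu>\<bar> powr \<alpha>) *\<^sub>R \<nu>)
        = (f' x * \<eta>c (x /\<^sub>R R) / \<bar>(x - x0) \<bullet> \<nu>\<bar> powr \<alpha>) *\<^sub>R \<nu>" if "R > 0" for R
      using ff' AE_lborel_scale[OF ae that] by eventually_elim (simp add: mult.commute)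
    note int = integral_lebesgue_weighted[OF scaled_int[OF \<eta>c supp _ \<nu>] aeR]
    have lim: "((\<lambda>R. (frac_mu 1 \<alpha> / \<alpha>) *\<^sub>R (J R *\<^sub>R \<nu>)) \<longlongrightarrow> - (\<eta>c 0 *\<^sub>R D (half_space \<nu> x0))) at_top"
    proof (rule vec_tendstoI)
      fix i
      show "((\<lambda>R. ((frac_mu 1 \<alpha> / \<alpha>) *\<^sub>R (J R *\<^sub>R \<nu>)) $ i) \<longlongrightarrow> (- (\<eta>c 0 *\<^sub>R D (half_space \<nu> x0))) $ i) at_top"
        using limit[OF \<eta>c supp bes \<nu>, where i=i and ?x0.0=x0] by (simp add: J_def mult_ac)
    qed
    \<comment> \<open>The vector integral and \<open>J R\<close> are identified for
      \<open>R > 0\<close> only, which holds eventually.\<close>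
    have "((\<lambda>R. (frac_mu 1 \<alpha> / \<alpha>) *\<^sub>R
          (LINT x|lebesgue. \<eta> (x /\<^sub>R R) *\<^sub>R ((f x / \<bar>(x - x0) \<bullet> \<nu>\<bar> powr \<alpha>) *\<^sub>R \<nu>)))
        \<longlongrightarrow> - (\<eta>c 0 *\<^sub>R D (half_space \<nu> x0))) at_top"
      by (rule Lim_transform_eventually[OF lim])
        (use eventually_gt_at_top[of "0::real"] in \<open>eventually_elim, simp only: int(2) J_def\<close>)
    then show ?thesis using int(1) by blast
  qed
  have part2: "integrable lebesgue (\<lambda>x. (f x / \<bar>(x - x0) \<bullet> \<nu>\<bar> powr \<alpha>) *\<^sub>R \<nu>) \<and>
      (frac_mu 1 \<alpha> / \<alpha>) *\<^sub>R (LINT x|lebesgue. (f x / \<bar>(x - x0) \<bullet> \<nu>\<bar> powr \<alpha>) *\<^sub>R \<nu>) = - D (half_space \<nu> x0)"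
    if cases: "bounded (ess_support f) \<or> (AE x in lebesgue. f x \<ge> 0) \<or> (AE x in lebesgue. f x \<le> 0)" and \<nu>: "norm \<nu> = 1"
    for \<nu> x0 :: "real^'n"
  proof -
    \<comment> \<open>Equal to 1 on the unit ball, so each dilated value is eventually exactly 1,
      and nonincreasing in the norm, so the dilates increase with \<open>k\<close>.\<close>
    define \<theta> :: "real^'n \<Rightarrow> real" where "\<theta> x = max 0 (min 1 (2 - norm x))" for x
    have \<theta>_lip: "1-lipschitz_on UNIV \<theta>"
    proof (rule lipschitz_onI)
      fix x y :: "real^'n"
      have "\<bar>\<theta> x - \<theta> y\<bar> \<le> \<bar>norm x - norm y\<bar>" unfolding \<theta>_def by linarith
      also have "\<dots> \<le> norm (x - y)" by (rule norm_triangle_ineq3)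
      finally show "dist (\<theta> x) (\<theta> y) \<le> 1 * dist x y" by (simp add: dist_real_def dist_norm)
    qed simp
    have \<theta>_cont: "continuous_on UNIV \<theta>" using \<theta>_lip by (rule lipschitz_on_continuous_on)
    have [measurable]: "\<theta> \<in> borel_measurable borel" using \<theta>_lip by (rule lipschitz_borel_measurable)
    have \<theta>_supp: "\<theta> x = 0" if "norm x \<ge> 2" for x using that by (simp add: \<theta>_def)
    have \<theta>_bnd: "0 \<le> \<theta> x" "\<theta> x \<le> 1" "\<bar>\<theta> x\<bar> \<le> 1" for x by (auto simp: \<theta>_def)
    have \<theta>_1: "\<theta> x = 1" if "norm x \<le> 1" for x using that by (simp add: \<theta>_def)
    have \<theta>_bes: "besov_seminorm \<alpha> q \<theta> < \<infinity>"
      by (rule lipschitz_besov[OF \<alpha> q_cases \<theta>_lip \<theta>_bnd(3) \<theta>_supp])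
    define X where "X k = real (Suc k)" for k
    have X: "filterlim X at_top sequentially"
      unfolding X_def using filterlim_compose[OF filterlim_real_sequentially filterlim_Suc] by simp
    have X0: "X k > 0" for k by (simp add: X_def)
    define w where "w x = f' x / \<bar>(x - x0) \<bullet> \<nu>\<bar> powr \<alpha>" for x
    have [measurable]: "w \<in> borel_measurable borel" unfolding w_def by measurable
    define J where "J k = (LINT x|lborel. w x * \<theta> (x /\<^sub>R X k))" for k
    have J_int: "integrable lborel (\<lambda>x. w x * \<theta> (x /\<^sub>R X k))" for k
      using scaled_int[OF \<theta>_cont \<theta>_supp X0 \<nu>, where ?x0.0=x0] by (simp add: w_def)
    have lim: "(\<lambda>k. frac_mu 1 \<alpha> / \<alpha> * \<nu> $ i * J k) \<longlonglongrightarrow> - D (half_space \<nu> x0) $ i" for i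
      using filterlim_compose[OF limit[OF \<theta>_cont \<theta>_supp \<theta>_bes \<nu>, where i=i and ?x0.0=x0] X] \<theta>_1[of 0]
      by (simp add: J_def w_def)
    have w_lim: "(\<lambda>k. w x * \<theta> (x /\<^sub>R X k)) \<longlonglongrightarrow> w x" for x
    proof (rule tendsto_eventually)
      have "eventually (\<lambda>k. X k \<ge> norm x) sequentially" using X by (simp add: filterlim_at_top)
      then show "eventually (\<lambda>k. w x * \<theta> (x /\<^sub>R X k) = w x) sequentially"
      proof eventually_elim
        case (elim k)
        then have "norm (x /\<^sub>R X k) \<le> 1" using X0[of k] by (simp add: inverse_eq_divide)
        from \<theta>_1[OF this] show ?case by simp
      qed
    qed
    have "integrable lborel w \<and> J \<longlonglongrightarrow> (LINT x|lborel. w x)"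
    proof (cases "bounded (ess_support f)")
      case True
      then obtain r where r: "ess_support f \<subseteq> ball 0 r" using bounded_subset_ballD by blast
      have zero: "AE x in lborel. norm x > r \<longrightarrow> f' x = 0"
        using AE_zero_outside_ess_support[of f] ff' by eventually_elim (use r in force)
      have int: "integrable lborel w"
        unfolding w_def by (rule integrable_weighted[OF \<alpha> \<nu> f' AE_I2[OF f'_bound] zero])
      have "J \<longlonglongrightarrow> (LINT x|lborel. w x)"
        unfolding J_def
      proof (rule integral_dominated_convergence[where w="\<lambda>x. \<bar>w x\<bar>"])
        show "AE x in lborel. norm (w x * \<theta> (x /\<^sub>R X k)) \<le> \<bar>w x\<bar>" for k
          using \<theta>_bnd(3) by (intro AE_I2) (simp add: abs_mult mult_left_le)
      qed (use int w_lim in auto)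
      then show ?thesis using int by simp
    next
      case False
      \<comment> \<open>The sign \<open>\<sigma>\<close> makes the integrand nonnegative, so that
        the cutoffs produce an increasing sequence; it is divided out at the end.\<close>
      obtain \<sigma> :: real where \<sigma>: "\<sigma> = 1 \<or> \<sigma> = - 1" and pos: "AE x in lborel. \<sigma> * w x \<ge> 0"
      proof -
        have "(AE x in lborel. f x \<ge> 0) \<or> (AE x in lborel. f x \<le> 0)"
          using cases False by (simp add: AE_completion_iff)
        then show thesis
        proof
          assume "AE x in lborel. f x \<ge> 0"
          then have "AE x in lborel. 1 * w x \<ge> 0" using ff' by eventually_elim (simp add: w_def)
          then show thesis by (intro that[of 1]) auto
        next
          assume "AE x in lborel. f x \<le> 0"
          then have "AE x in lborel. - 1 * w x \<ge> 0" using ff' by eventually_elim (simp add: w_def divide_nonpos_nonneg)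
          then show thesis by (intro that[of "- 1"]) auto
        qed
      qed
      have "\<nu> \<noteq> 0" using \<nu> by auto
      \<comment> \<open>The limit formula controls \<open>J\<close> only after multiplication by a
        coordinate of \<nu>. Dividing by a nonzero coordinate yields convergence of \<open>J\<close>
        itself, the boundedness that monotone convergence turns into integrability.\<close>
      then obtain i where i: "\<nu> $ i \<noteq> 0" by (auto simp: vec_eq_iff)
      have \<mu>: "frac_mu 1 \<alpha> > 0" using \<alpha> by (simp add: frac_mu_def Gamma_real_pos)
      define c where "c = frac_mu 1 \<alpha> / \<alpha> * \<nu> $ i"
      have c: "c \<noteq> 0" using i \<mu> \<alpha> by (simp add: c_def)
      have "(\<lambda>k. c * J k / c) \<longlonglongrightarrow> - D (half_space \<nu> x0) $ i / c"
        using lim[of i] c unfolding c_def[symmetric] by (intro tendsto_divide tendsto_const) auto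
      then have J_lim: "J \<longlonglongrightarrow> - D (half_space \<nu> x0) $ i / c" using c by simp
      have mono: "\<theta> (x /\<^sub>R X k) \<le> \<theta> (x /\<^sub>R X l)" if "k \<le> l" for k l x
      proof -
        have "norm (x /\<^sub>R X l) \<le> norm (x /\<^sub>R X k)"
          using that by (auto simp: X_def field_simps intro!: mult_right_mono)
        then show ?thesis by (auto simp: \<theta>_def)
      qed
      have 1: "integrable lborel (\<lambda>x. \<sigma> * w x * \<theta> (x /\<^sub>R X k))" for k
        using integrable_mult_right[OF J_int, of \<sigma> k] by (simp add: mult.assoc)
      have 2: "AE x in lborel. mono (\<lambda>k. \<sigma> * w x * \<theta> (x /\<^sub>R X k))"
        using pos by eventually_elim (auto intro!: monoI mult_left_mono mono)
      have 3: "AE x in lborel. (\<lambda>k. \<sigma> * w x * \<theta> (x /\<^sub>R X k)) \<longlonglongrightarrow> \<sigma> * w x"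
        using tendsto_mult[OF tendsto_const w_lim, of \<sigma>] by (intro AE_I2) (simp add: mult.assoc)
      have 4: "(\<lambda>k. LINT x|lborel. \<sigma> * w x * \<theta> (x /\<^sub>R X k)) \<longlonglongrightarrow> \<sigma> * (- D (half_space \<nu> x0) $ i / c)"
        using tendsto_mult[OF tendsto_const J_lim, of \<sigma>] by (simp add: J_def mult.assoc)
      have 5: "(\<lambda>x. \<sigma> * w x) \<in> borel_measurable lborel" by measurable
      have "\<sigma> \<noteq> 0" using \<sigma> by auto
      have "integrable lborel (\<lambda>x. \<sigma> * w x)" by (rule integrable_monotone_convergence[OF 1 2 3 4 5])
      then have "integrable lborel w" using \<open>\<sigma> \<noteq> 0\<close> by simp
      moreover have "(LINT x|lborel. \<sigma> * w x) = \<sigma> * (- D (half_space \<nu> x0) $ i / c)"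
        by (rule integral_monotone_convergence[OF 1 2 3 4 5])
      then have "(LINT x|lborel. w x) = - D (half_space \<nu> x0) $ i / c"
        unfolding integral_mult_right_zero mult_left_cancel[OF \<open>\<sigma> \<noteq> 0\<close>] .
      ultimately show ?thesis using J_lim by simp
    qed
    then have int: "integrable lborel w" and J_lim: "J \<longlonglongrightarrow> (LINT x|lborel. w x)" by auto
    have ae: "AE x in lborel. (f x / \<bar>(x - x0) \<bullet> \<nu>\<bar> powr \<alpha>) *\<^sub>R \<nu> = w x *\<^sub>R \<nu>"
      using ff' by eventually_elim (simp add: w_def)
    note W = integral_lebesgue_weighted[OF int ae]
    have "frac_mu 1 \<alpha> / \<alpha> * \<nu> $ i * (LINT x|lborel. w x) = - D (half_space \<nu> x0) $ i" for i
      by (rule LIMSEQ_unique[OF _ lim]) (intro tendsto_intros J_lim)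
    then have "(frac_mu 1 \<alpha> / \<alpha>) *\<^sub>R ((LINT x|lborel. w x) *\<^sub>R \<nu>) = - D (half_space \<nu> x0)"
      by (simp add: vec_eq_iff mult_ac)
    then show ?thesis using W by simp
  qed
  show ?thesis using part1 part2 by blast
qed

end
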